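(* Let $d\ge1$ and let $\{Z(t)\}_{t\in\mathbb{R}^d}$ be a continuous stationary Gaussian random field with mean zero and variance one. Suppose that its correlation is of the form $\mathrm{Corr}(Z(t),Z(s))=\rho(\|t-s\|)$ and that $\rho(\|t-s\|)\to0$ monotonically as $\|t-s\|\to\infty$. For every $\gamma>0$ define the random set $$\mathcal{Z}(\gamma)=\left\{t\in\mathbb{R}^d:\ \|t\|\ge e,\ Z(t)\ge\sqrt{2\gamma\log\|t\|}\right\}.$$ Then, for all $\gamma>0$, $$\mathrm{Dim}_{\mathrm H}(\mathcal{Z}(\gamma))=(d-\gamma)\vee0\qquad\text{almost surely},$$ where $\mathrm{Dim}_{\mathrm H}$ denotes the macroscopic (Barlow–Taylor) Hausdorff dimension of subsets of $\mathbb{R}^d$.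
   Context: Notation: $a\vee b=\max\{a,b\}$; $\|\cdot\|$ is the Euclidean norm. Macroscopic Hausdorff dimension in $\mathbb{R}^d$: for integers $n\ge0$ let $V_n=[-e^n,e^n)^d$, $S_0=V_0$, $S_{n+1}=V_{n+1}\setminus V_n$. Let $\mathcal{Q}$ be the collection of all cubes $Q(x,r)=\prod_{i=1}^d[x_i,x_i+r)$ with $x\in\mathbb{R}^d$ and $r\in[1,\infty)$; write $s(Q(x,r))=r$. For $E\subset\mathbb{R}^d$, $\rho>0$ and integers $n\ge1$ let $$\nu^n_\rho(E)=\inf\left\{\sum_{i=1}^m\left(\frac{s(Q_i)}{e^n}\right)^\rho:\ Q_i\in\mathcal{Q},\ Q_i\subset S_n,\ E\cap S_n\subset\bigcup_{i=1}^mQ_i\right\}.$$ Then $\mathrm{Dim}_{\mathrm H}(E)=\inf\{\rho>0:\ \sum_{n=1}^\infty\nu^n_\rho(E)<\infty\}$. (Here $\rho$ is a positive number, unrelated to the correlation function.) *)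

theory Defs
  imports "HOL-Probability.Probability"
begin

definition half_open_cube :: "real ^ 'd \<Rightarrow> real \<Rightarrow> (real ^ 'd) set" where
  "half_open_cube x r = {y. \<forall>i. x $ i \<le> y $ i \<and> y $ i < x $ i + r}"

definition macro_V :: "nat \<Rightarrow> (real ^ 'd) set" where
  "macro_V n = {y. \<forall>i. - exp (real n) \<le> y $ i \<and> y $ i < exp (real n)}"

fun macro_S :: "nat \<Rightarrow> (real ^ 'd) set" where
  "macro_S 0 = macro_V 0"
| "macro_S (Suc n) = macro_V (Suc n) - macro_V n"

text \<open>A finite family of cubes is given by its number of members \<open>m\<close>, the corners \<open>x i\<close> and
  the sides \<open>r i\<close> for \<open>i < m\<close>. The empty family \<open>m = 0\<close> is allowed; it is admissible only if
  \<open>E \<inter> macro_S n = {}\<close>, and excluding it would not change \<open>macro_Dim_H\<close>.\<close>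

definition macro_nu :: "real \<Rightarrow> nat \<Rightarrow> (real ^ 'd) set \<Rightarrow> ennreal" where
  "macro_nu \<rho> n E =
     Inf {\<Sum>i<m. ennreal ((r i / exp (real n)) powr \<rho>) | (m :: nat) (x :: nat \<Rightarrow> real ^ 'd) r.
            (\<forall>i<m. 1 \<le> r i \<and> half_open_cube (x i) (r i) \<subseteq> macro_S n) \<and>
            E \<inter> macro_S n \<subseteq> (\<Union>i<m. half_open_cube (x i) (r i))}"

text \<open>The macroscopic (Barlow--Taylor) Hausdorff dimension. The infimum is taken in \<open>ereal\<close> so that it carries no junk value.\<close>

definition macro_Dim_H :: "(real ^ 'd) set \<Rightarrow> ereal" where
  "macro_Dim_H E = Inf {ereal \<rho> | \<rho>. 0 < \<rho> \<and> (\<Sum>n. macro_nu \<rho> (Suc n) E) < \<infinity>}"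

context prob_space
begin

text \<open>Normal laws of variance zero, i.e. point masses, count as Gaussian.\<close>

definition gaussian_rv :: "('a \<Rightarrow> real) \<Rightarrow> bool" where
  "gaussian_rv X \<longleftrightarrow> random_variable borel X \<and>
     ((\<exists>\<mu>. AE \<omega> in M. X \<omega> = \<mu>) \<or> (\<exists>\<mu> \<sigma>. 0 < \<sigma> \<and> distributed M lborel X (normal_density \<mu> \<sigma>)))"

definition gaussian_field :: "('t \<Rightarrow> 'a \<Rightarrow> real) \<Rightarrow> bool" where
  "gaussian_field Z \<longleftrightarrow>
     (\<forall>T a. finite T \<longrightarrow> gaussian_rv (\<lambda>\<omega>. \<Sum>t\<in>T. a t * Z t \<omega>))"

text \<open>Strict, not merely wide-sense, stationarity.\<close>

definition stationary_field :: "('t::ab_group_add \<Rightarrow> 'a \<Rightarrow> real) \<Rightarrow> bool" where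
  "stationary_field Z \<longleftrightarrow>
     (\<forall>T h. finite T \<longrightarrow>
        distr M (Pi\<^sub>M T (\<lambda>_. borel)) (\<lambda>\<omega>. \<lambda>t\<in>T. Z (t + h) \<omega>) =
        distr M (Pi\<^sub>M T (\<lambda>_. borel)) (\<lambda>\<omega>. \<lambda>t\<in>T. Z t \<omega>))"

definition continuous_field :: "('t::topological_space \<Rightarrow> 'a \<Rightarrow> real) \<Rightarrow> bool" where
  "continuous_field Z \<longleftrightarrow> (AE \<omega> in M. continuous_on UNIV (\<lambda>t. Z t \<omega>))"

definition Cov :: "('a \<Rightarrow> real) \<Rightarrow> ('a \<Rightarrow> real) \<Rightarrow> real" where
  "Cov X Y = expectation (\<lambda>\<omega>. (X \<omega> - expectation X) * (Y \<omega> - expectation Y))"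

definition Corr :: "('a \<Rightarrow> real) \<Rightarrow> ('a \<Rightarrow> real) \<Rightarrow> real" where
  "Corr X Y = Cov X Y / sqrt (variance X * variance Y)"

end

definition exceedance_set :: "(real ^ 'd \<Rightarrow> 'w \<Rightarrow> real) \<Rightarrow> real \<Rightarrow> 'w \<Rightarrow> (real ^ 'd) set" where
  "exceedance_set Z \<gamma> \<omega> =
     {t. exp 1 \<le> norm t \<and> sqrt (2 * \<gamma> * ln (norm t)) \<le> Z t \<omega>}"

end

theory Submission
  imports Defs "HOL-Real_Asymp.Real_Asymp"
begin

text \<open>The shell \<open>macro_S (Suc n)\<close> has diameter of order \<open>exp n\<close>, and on it the threshold defining the exceedance
set is \<open>sqrt (2 * \<gamma> * n)\<close> up to lower-order terms. A standard Gaussian variable lies above that threshold with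
probability \<open>exp (- \<gamma> * n)\<close> to exponential order, so about \<open>exp ((d - \<gamma>) * n)\<close> of the \<open>exp (d * n)\<close> unit
cubes in the shell are hit. This is the source of the dimension \<open>d - \<gamma>\<close>; the work lies in showing that neither the
oscillation of the field inside a unit cube nor its correlations spoil the heuristic, although continuity and the decay
of \<open>\<rho>\<close> are only qualitative: there is no modulus of continuity and no rate of decay.

One inequality handles both. For a centered Gaussian family with variances at most \<open>v\<close> and a countable index set,
\<open>P (sup X \<ge> a) * P (sup X \<le> b) \<le> exp (- 2 * (a - b)\<^sup>2 / (pi\<^sup>2 * v))\<close> whenever \<open>b \<le> a\<close> (lemma
\<open>gaussian_max_concentration\<close>). It comes from the rotation invariance of a pair of independent copies of the family:
rotating one copy into the other along a quarter circle turns the difference of the two maxima into a sum of small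
increments, each of which is conditionally dominated by a single Gaussian variable. Rotation invariance in turn rests
on the fact that a finite family of real random variables has its law determined by the characteristic function
(theorem \<open>char_eq_imp_distr_PiM_eq\<close>).

Upper bound. Continuity of the paths makes \<open>\<rho>\<close> continuous at \<open>0\<close>, hence on a small ball around \<open>c\<close> the increments
\<open>Z t - Z c\<close> have small variance, while their supremum is finite and so bounded by some \<open>b\<close> with probability at least one
half. Concentration turns this into a Gaussian tail with an arbitrarily good constant, and the supremum of \<open>Z\<close> over a
unit cube has the same tail exponent as a single value, up to an arbitrarily small loss
(\<open>bounded_set_sup_tail\<close>). Covering the shell by the unit cubes that are hit gives a summable expected content for every
positive exponent above \<open>d - \<gamma>\<close>.

Lower bound. Only the case \<open>\<gamma> < d\<close> has content. Choose \<open>\<theta>\<close> with \<open>\<gamma> / d < \<theta> < 1\<close> and cut a corner of the shell into cells of side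
\<open>exp (\<theta> * n)\<close>. In a cell select points at mutual distance at least \<open>exp (\<eta> * n)\<close>, so that all correlations are at most
\<open>\<delta> = \<rho> (exp (\<eta> * n))\<close>, which tends to \<open>0\<close>. The second moment method then only yields an exceedance with
probability \<open>exp (- \<epsilon> * n)\<close>: since \<open>\<rho>\<close> may decay arbitrarily slowly, \<open>\<delta> * n\<close> may be unbounded. But concentration
amplifies exactly this: if the maximum exceeds \<open>a\<close> with probability \<open>exp (- \<epsilon> * n)\<close>, then it fails to exceed
a slightly lower level with exponentially small probability (\<open>no_exceedance_prob\<close>). By Borel--Cantelli at least half of
the cells contain an exceedance in all large shells. Points spread over that many cells cannot be covered cheaply
(\<open>macro_nu_ge_grid_count\<close>), so the contents stay bounded away from \<open>0\<close> for all exponents up to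
\<open>d * (1 - \<theta>)\<close>, and \<open>\<theta>\<close> can be taken arbitrarily close to \<open>\<gamma> / d\<close>.\<close>

section \<open>Laws of finite real families are determined by their characteristic functions\<close>

text \<open>After normalisation the weights are probability densities with respect to \<open>M\<close> and \<open>N\<close>, and the hypothesis says that
\<open>X\<close> and \<open>Y\<close> have the same characteristic function under the new measures; Levy's uniqueness theorem applies.
The two lemmas after this one remove the sign restriction, first for real and then for complex weights.\<close>

lemma nonneg_weight_char_imp_eq:
  fixes M :: "'a measure" and N :: "'b measure"
  assumes "prob_space M" "prob_space N"
    and [measurable]: "X \<in> borel_measurable M" "Y \<in> borel_measurable N"
      "W \<in> borel_measurable M" "V \<in> borel_measurable N" "B \<in> sets borel"
    and W: "\<And>x. 0 \<le> W x \<and> W x \<le> (1::real)" and V: "\<And>y. 0 \<le> V y \<and> V y \<le> (1::real)"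
    and eq: "\<And>t. (CLINT x|M. W x *\<^sub>R iexp (t * X x)) = (CLINT y|N. V y *\<^sub>R iexp (t * Y y))"
  shows "(LINT x|M. W x * indicator B (X x)) = (LINT y|N. V y * indicator B (Y y))"
proof -
  interpret M: prob_space M by fact
  interpret N: prob_space N by fact
  have iW: "integrable M W" by (rule M.integrable_const_bound[where B=1]) (use W in auto)
  have iV: "integrable N V" by (rule N.integrable_const_bound[where B=1]) (use V in auto)
  define m where "m = (LINT x|M. W x)"
  have mN: "m = (LINT y|N. V y)"
    using eq[of 0] unfolding m_def by (simp add: scaleR_conv_of_real)
  have m0: "0 \<le> m" unfolding m_def using W by simp
  show ?thesis
  proof (cases "m = 0")
    case True
    have "AE x in M. W x = 0"
      using True integral_nonneg_eq_0_iff_AE[OF iW] W unfolding m_def by auto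
    hence "(LINT x|M. W x * indicator B (X x)) = 0"
      by (intro integral_eq_zero_AE) auto
    moreover have "AE x in N. V x = 0"
      using True integral_nonneg_eq_0_iff_AE[OF iV] V unfolding mN by auto
    hence "(LINT x|N. V x * indicator B (Y x)) = 0"
      by (intro integral_eq_zero_AE) auto
    ultimately show ?thesis by simp
  next
    case False
    with m0 have m: "0 < m" by simp
    define P where "P = density M (\<lambda>x. ennreal (W x / m))"
    define Q where "Q = density N (\<lambda>x. ennreal (V x / m))"
    have "emeasure P (space P) = 1"
      unfolding P_def using m W iW
      by (subst emeasure_density)
         (auto simp: nn_integral_eq_integral m_def[symmetric] cong: nn_integral_cong)
    hence P: "prob_space P" by (intro prob_spaceI)
    have "emeasure Q (space Q) = 1"
      unfolding Q_def using m V iV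
      by (subst emeasure_density)
         (auto simp: nn_integral_eq_integral mN[symmetric] cong: nn_integral_cong)
    hence Q: "prob_space Q" by (intro prob_spaceI)
    interpret P: prob_space P by fact
    interpret Q: prob_space Q by fact
    have [measurable]: "X \<in> borel_measurable P" "Y \<in> borel_measurable Q"
      unfolding P_def Q_def by simp_all
    have cP: "char (distr P borel X) t = (CLINT x|M. W x *\<^sub>R iexp (t * X x)) / m" for t
    proof -
      have "char (distr P borel X) t = (CLINT x|M. (W x / m) *\<^sub>R iexp (t * X x))"
        unfolding char_def P_def using m W
        by (subst integral_distr, simp, simp, subst integral_density) auto
      also have "\<dots> = (CLINT x|M. (W x *\<^sub>R iexp (t * X x)) / m)"
        by (intro Bochner_Integration.integral_cong) (auto simp: scaleR_conv_of_real)
      also have "\<dots> = (CLINT x|M. W x *\<^sub>R iexp (t * X x)) / m" by simp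
      finally show ?thesis .
    qed
    have cQ: "char (distr Q borel Y) t = (CLINT x|N. V x *\<^sub>R iexp (t * Y x)) / m" for t
    proof -
      have "char (distr Q borel Y) t = (CLINT x|N. (V x / m) *\<^sub>R iexp (t * Y x))"
        unfolding char_def Q_def using m V
        by (subst integral_distr, simp, simp, subst integral_density) auto
      also have "\<dots> = (CLINT x|N. (V x *\<^sub>R iexp (t * Y x)) / m)"
        by (intro Bochner_Integration.integral_cong) (auto simp: scaleR_conv_of_real)
      also have "\<dots> = (CLINT x|N. V x *\<^sub>R iexp (t * Y x)) / m" by simp
      finally show ?thesis .
    qed
    have "distr P borel X = distr Q borel Y"
      by (rule Levy_uniqueness) (simp_all only: fun_eq_iff cP cQ eq P.real_distribution_distr Q.real_distribution_distr
          \<open>X \<in> borel_measurable P\<close> \<open>Y \<in> borel_measurable Q\<close> HOL.simp_thms)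
    hence "measure (distr P borel X) B = measure (distr Q borel Y) B" by simp
    hence "(LINT z|distr P borel X. indicator B z :: real) = (LINT z|distr Q borel Y. indicator B z)"
      by simp
    moreover have "(LINT z|distr P borel X. indicator B z :: real) = (LINT x|M. W x * indicator B (X x)) / m"
      unfolding P_def using m W
      by (subst integral_distr, simp, simp, subst integral_density) auto
    moreover have "(LINT z|distr Q borel Y. indicator B z :: real) = (LINT x|N. V x * indicator B (Y x)) / m"
      unfolding Q_def using m V
      by (subst integral_distr, simp, simp, subst integral_density) auto
    ultimately show ?thesis using m by simp
  qed
qed

text \<open>The affine map \<open>w \<mapsto> (1 + w) / 2\<close> sends weights in \<open>{-1..1}\<close> to \<open>{0..1}\<close>; the constant part is handled by
the last hypothesis.\<close>

lemma real_weight_char_imp_eq: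
  fixes M :: "'a measure" and N :: "'b measure"
  assumes M: "prob_space M" and N: "prob_space N"
    and [measurable]: "X \<in> borel_measurable M" "Y \<in> borel_measurable N"
      "W \<in> borel_measurable M" "V \<in> borel_measurable N" "B \<in> sets borel"
    and W: "\<And>x. \<bar>W x\<bar> \<le> (1::real)" and V: "\<And>y. \<bar>V y\<bar> \<le> (1::real)"
    and eq: "\<And>t. (CLINT x|M. W x *\<^sub>R iexp (t * X x)) = (CLINT y|N. V y *\<^sub>R iexp (t * Y y))"
    and eq1: "\<And>t. (CLINT x|M. iexp (t * X x)) = (CLINT y|N. iexp (t * Y y))"
  shows "(LINT x|M. W x * indicator B (X x)) = (LINT y|N. V y * indicator B (Y y))"
proof -
  interpret M: prob_space M by fact
  interpret N: prob_space N by fact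
  have 1: "integrable M (\<lambda>x. iexp (t * X x))" for t
    by (rule M.integrable_const_bound[where B=1]) auto
  have 2: "integrable N (\<lambda>x. iexp (t * Y x))" for t
    by (rule N.integrable_const_bound[where B=1]) auto
  have 3: "integrable M (\<lambda>x. W x *\<^sub>R iexp (t * X x))" for t
    by (rule M.integrable_const_bound[where B=1]) (use W in auto)
  have 4: "integrable N (\<lambda>x. V x *\<^sub>R iexp (t * Y x))" for t
    by (rule N.integrable_const_bound[where B=1]) (use V in auto)
  have A: "(LINT x|M. (1 + W x) / 2 * indicator B (X x)) = (LINT y|N. (1 + V y) / 2 * indicator B (Y y))"
  proof (rule nonneg_weight_char_imp_eq[OF M N])
    show "0 \<le> (1 + W x) / 2 \<and> (1 + W x) / 2 \<le> 1" for x using W[of x] by (auto simp: abs_le_iff)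
    show "0 \<le> (1 + V x) / 2 \<and> (1 + V x) / 2 \<le> 1" for x using V[of x] by (auto simp: abs_le_iff)
    fix t
    have "(CLINT x|M. ((1 + W x) / 2) *\<^sub>R iexp (t * X x))
        = (CLINT x|M. (1/2) *\<^sub>R (iexp (t * X x) + W x *\<^sub>R iexp (t * X x)))"
      by (intro Bochner_Integration.integral_cong) (auto simp: scaleR_conv_of_real field_simps)
    also have "\<dots> = (1/2) *\<^sub>R ((CLINT x|M. iexp (t * X x)) + (CLINT x|M. W x *\<^sub>R iexp (t * X x)))"
      using 1[of t] 3[of t] by (subst integral_scaleR_right) (auto intro!: Bochner_Integration.integral_add)
    also have "\<dots> = (1/2) *\<^sub>R ((CLINT x|N. iexp (t * Y x)) + (CLINT x|N. V x *\<^sub>R iexp (t * Y x)))"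
      by (simp only: eq eq1)
    also have "\<dots> = (CLINT x|N. (1/2) *\<^sub>R (iexp (t * Y x) + V x *\<^sub>R iexp (t * Y x)))"
      using 2[of t] 4[of t] by (subst integral_scaleR_right) (auto intro!: Bochner_Integration.integral_add[symmetric])
    also have "\<dots> = (CLINT x|N. ((1 + V x) / 2) *\<^sub>R iexp (t * Y x))"
      by (intro Bochner_Integration.integral_cong) (auto simp: scaleR_conv_of_real field_simps)
    finally show "(CLINT x|M. ((1 + W x) / 2) *\<^sub>R iexp (t * X x)) = (CLINT x|N. ((1 + V x) / 2) *\<^sub>R iexp (t * Y x))" .
  qed auto
  have C: "(LINT x|M. 1 * indicator B (X x)) = (LINT y|N. 1 * indicator B (Y y) :: real)"
    by (rule nonneg_weight_char_imp_eq[OF M N]) (auto simp: eq1 simp del: of_real_mult)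
  have i1: "integrable M (\<lambda>x. indicator B (X x) :: real)" "integrable M (\<lambda>x. W x * indicator B (X x))"
     by (rule M.integrable_const_bound[where B=1]; use W in \<open>auto simp: indicator_def\<close>)+
  have i2: "integrable N (\<lambda>x. indicator B (Y x) :: real)" "integrable N (\<lambda>x. V x * indicator B (Y x))"
     by (rule N.integrable_const_bound[where B=1]; use V in \<open>auto simp: indicator_def\<close>)+
  have "(LINT x|M. (1 + W x) / 2 * indicator B (X x)) =
     (LINT x|M. (1/2) * (indicator B (X x) + W x * indicator B (X x)))"
     by (intro Bochner_Integration.integral_cong) (auto simp: field_simps)
  also have "\<dots> = (1/2) * ((LINT x|M. 1 * indicator B (X x)) + (LINT x|M. W x * indicator B (X x)))"
    using i1 by simp
  finally have D: "(LINT x|M. (1 + W x) / 2 * indicator B (X x)) = \<dots>" .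
  have "(LINT x|N. (1 + V x) / 2 * indicator B (Y x)) =
     (LINT x|N. (1/2) * (indicator B (Y x) + V x * indicator B (Y x)))"
     by (intro Bochner_Integration.integral_cong) (auto simp: field_simps)
  also have "\<dots> = (1/2) * ((LINT x|N. 1 * indicator B (Y x)) + (LINT x|N. V x * indicator B (Y x)))"
    using i2 by simp
  finally have E: "(LINT x|N. (1 + V x) / 2 * indicator B (Y x)) = \<dots>" .
  show ?thesis using A unfolding D E C by simp
qed

text \<open>Real and imaginary parts are treated separately; they are combinations of the weight and its conjugate, which is why both
appear in the hypotheses.\<close>

lemma complex_weight_char_imp_eq:
  fixes M :: "'a measure" and N :: "'b measure" and W :: "'a \<Rightarrow> complex"
  assumes M: "prob_space M" and N: "prob_space N"
    and [measurable]: "X \<in> borel_measurable M" "Y \<in> borel_measurable N"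
      "W \<in> borel_measurable M" "V \<in> borel_measurable N" "B \<in> sets borel"
    and W: "\<And>x. norm (W x) \<le> 1" and V: "\<And>y. norm (V y) \<le> 1"
    and eq: "\<And>t. (CLINT x|M. W x * iexp (t * X x)) = (CLINT y|N. V y * iexp (t * Y y))"
    and eqc: "\<And>t. (CLINT x|M. cnj (W x) * iexp (t * X x)) = (CLINT y|N. cnj (V y) * iexp (t * Y y))"
    and eq1: "\<And>t. (CLINT x|M. iexp (t * X x)) = (CLINT y|N. iexp (t * Y y))"
  shows "(CLINT x|M. W x * indicator B (X x)) = (CLINT y|N. V y * indicator B (Y y))"
proof -
  interpret M: prob_space M by fact
  interpret N: prob_space N by fact
  have [measurable]: "(\<lambda>x. cnj (W x)) \<in> borel_measurable M" "(\<lambda>x. cnj (V x)) \<in> borel_measurable N"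
    by (intro borel_measurable_continuous_on[of cnj] continuous_intros; simp)+
  have 1: "integrable M (\<lambda>x. W x * iexp (t * X x))" "integrable M (\<lambda>x. cnj (W x) * iexp (t * X x))" for t
    by (rule M.integrable_const_bound[where B=1]; use W in \<open>auto simp: norm_mult\<close>)+
  have 2: "integrable N (\<lambda>x. V x * iexp (t * Y x))" "integrable N (\<lambda>x. cnj (V x) * iexp (t * Y x))" for t
    by (rule N.integrable_const_bound[where B=1]; use V in \<open>auto simp: norm_mult\<close>)+
  have Re: "(LINT x|M. Re (W x) * indicator B (X x)) = (LINT y|N. Re (V y) * indicator B (Y y))"
  proof (rule real_weight_char_imp_eq[OF M N])
    fix t
    have "(CLINT x|M. Re (W x) *\<^sub>R iexp (t * X x)) = (CLINT x|M. (1/2) * (W x * iexp (t * X x) + cnj (W x) * iexp (t * X x)))"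
      by (intro Bochner_Integration.integral_cong refl)
         (simp add: scaleR_conv_of_real distrib_right[symmetric] complex_add_cnj)
    also have "\<dots> = (1/2) * ((CLINT x|M. W x * iexp (t * X x)) + (CLINT x|M. cnj (W x) * iexp (t * X x)))"
      using 1[of t] by (subst integral_mult_right_zero) (simp only: Bochner_Integration.integral_add)
    also have "\<dots> = (1/2) * ((CLINT x|N. V x * iexp (t * Y x)) + (CLINT x|N. cnj (V x) * iexp (t * Y x)))"
      by (simp only: eq eqc)
    also have "\<dots> = (CLINT x|N. (1/2) * (V x * iexp (t * Y x) + cnj (V x) * iexp (t * Y x)))"
      using 2[of t] by (subst integral_mult_right_zero) (simp only: Bochner_Integration.integral_add)
    also have "\<dots> = (CLINT x|N. Re (V x) *\<^sub>R iexp (t * Y x))"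
      by (intro Bochner_Integration.integral_cong refl)
         (simp add: scaleR_conv_of_real distrib_right[symmetric] complex_add_cnj)
    finally show "(CLINT x|M. Re (W x) *\<^sub>R iexp (t * X x)) = (CLINT x|N. Re (V x) *\<^sub>R iexp (t * Y x))" .
  next
    show "\<bar>Re (W x)\<bar> \<le> 1" for x using W[of x] abs_Re_le_cmod[of "W x"] by linarith
    show "\<bar>Re (V x)\<bar> \<le> 1" for x using V[of x] abs_Re_le_cmod[of "V x"] by linarith
  qed (use eq1 in auto)
  have Im_eq: "Im w *\<^sub>R e = (- \<i> / 2) * (w * e - cnj w * e)" for w e :: complex
    by (simp add: complex_eq_iff field_simps)
  have Im: "(LINT x|M. Im (W x) * indicator B (X x)) = (LINT y|N. Im (V y) * indicator B (Y y))"
  proof (rule real_weight_char_imp_eq[OF M N])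
    fix t
    have "(CLINT x|M. Im (W x) *\<^sub>R iexp (t * X x)) = (CLINT x|M. (- \<i> / 2) * (W x * iexp (t * X x) - cnj (W x) * iexp (t * X x)))"
      by (simp only: Im_eq)
    also have "\<dots> = (- \<i> / 2) * ((CLINT x|M. W x * iexp (t * X x)) - (CLINT x|M. cnj (W x) * iexp (t * X x)))"
      using 1[of t] by (subst integral_mult_right_zero) (simp only: Bochner_Integration.integral_diff)
    also have "\<dots> = (- \<i> / 2) * ((CLINT x|N. V x * iexp (t * Y x)) - (CLINT x|N. cnj (V x) * iexp (t * Y x)))"
      by (simp only: eq eqc)
    also have "\<dots> = (CLINT x|N. (- \<i> / 2) * (V x * iexp (t * Y x) - cnj (V x) * iexp (t * Y x)))"
      using 2[of t] by (subst integral_mult_right_zero) (simp only: Bochner_Integration.integral_diff)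
    also have "\<dots> = (CLINT x|N. Im (V x) *\<^sub>R iexp (t * Y x))"
      by (simp only: Im_eq)
    finally show "(CLINT x|M. Im (W x) *\<^sub>R iexp (t * X x)) = (CLINT x|N. Im (V x) *\<^sub>R iexp (t * Y x))" .
  next
    show "\<bar>Im (W x)\<bar> \<le> 1" for x using W[of x] abs_Im_le_cmod[of "W x"] by linarith
    show "\<bar>Im (V x)\<bar> \<le> 1" for x using V[of x] abs_Im_le_cmod[of "V x"] by linarith
  qed (use eq1 in auto)
  have iM: "integrable M (\<lambda>x. W x * indicator B (X x))"
    by (rule M.integrable_const_bound[where B=1]) (use W in \<open>auto simp: norm_mult indicator_def\<close>)
  have iN: "integrable N (\<lambda>x. V x * indicator B (Y x))"
    by (rule N.integrable_const_bound[where B=1]) (use V in \<open>auto simp: norm_mult indicator_def\<close>)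
  have [simp]: "Re (indicator B r) = indicator B r" "Im (indicator B r) = 0" for r
    by (auto simp: indicator_def)
  show ?thesis
    using Re Im integral_Re[OF iM] integral_Re[OF iN] integral_Im[OF iM] integral_Im[OF iN]
    by (intro complex_eqI) simp_all
qed

text \<open>The exponentials are traded for indicators one coordinate at a time. In the step for coordinate \<open>k\<close>, everything that does
not involve \<open>k\<close> is a bounded complex weight; its conjugate is of the same form with \<open>c\<close> replaced by \<open>- c\<close>.\<close>

lemma char_partial_indicator_eq:
  fixes M :: "'a measure" and N :: "'b measure" and X :: "'i \<Rightarrow> 'a \<Rightarrow> real"
  assumes M: "prob_space M" and N: "prob_space N" and I: "finite I"
    and [measurable]: "\<And>i. i \<in> I \<Longrightarrow> X i \<in> borel_measurable M" "\<And>i. i \<in> I \<Longrightarrow> Y i \<in> borel_measurable N"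
    and eq: "\<And>c. (CLINT x|M. iexp (\<Sum>i\<in>I. c i * X i x)) = (CLINT y|N. iexp (\<Sum>i\<in>I. c i * Y i y))"
    and A: "finite A" "A \<subseteq> I" and B: "\<And>i. B i \<in> sets borel"
  shows "(CLINT x|M. (\<Prod>i\<in>A. indicator (B i) (X i x)) * iexp (\<Sum>i\<in>I - A. c i * X i x))
    = (CLINT y|N. (\<Prod>i\<in>A. indicator (B i) (Y i y)) * iexp (\<Sum>i\<in>I - A. c i * Y i y))"
  using A B
proof (induction A arbitrary: B c rule: finite_induct)
  case empty then show ?case using eq[of c] by simp
next
  case (insert k A)
  interpret M: prob_space M by fact
  interpret N: prob_space N by fact
  have k: "k \<in> I" "k \<notin> A" and AI: "A \<subseteq> I" using insert by auto
  have [measurable]: "B i \<in> sets borel" for i by fact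
  have [measurable]: "X k \<in> borel_measurable M" "Y k \<in> borel_measurable N" using k by auto
  have mX: "(\<lambda>x. \<Prod>i\<in>A. indicator (B i) (X i x) :: complex) \<in> borel_measurable M"
    and mY: "(\<lambda>x. \<Prod>i\<in>A. indicator (B i) (Y i x) :: complex) \<in> borel_measurable N"
    if "\<And>i. B i \<in> sets borel" for B :: "'i \<Rightarrow> real set"
    by (rule borel_measurable_prod, use AI that in force)+
  let ?J = "I - insert k A"
  have nX: "norm (\<Prod>i\<in>A. indicator (B i) (X i x) :: complex) \<le> 1" for x
    by (simp only: prod_norm[symmetric]) (auto intro!: prod_le_1 simp: indicator_def)
  have nY: "norm (\<Prod>i\<in>A. indicator (B i) (Y i x) :: complex) \<le> 1" for x
    by (simp only: prod_norm[symmetric]) (auto intro!: prod_le_1 simp: indicator_def)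
  have split: "I - A = insert k ?J" "k \<notin> ?J" "finite ?J" using k I by auto
  have key: "(CLINT x|M. (\<Prod>i\<in>A. indicator (B i) (X i x)) * iexp (\<Sum>i\<in>?J. c i * X i x) * iexp (t * X k x))
     = (CLINT x|N. (\<Prod>i\<in>A. indicator (B i) (Y i x)) * iexp (\<Sum>i\<in>?J. c i * Y i x) * iexp (t * Y k x))"
     if "\<And>i. B i \<in> sets borel" for c B t
  proof -
    have s: "iexp (\<Sum>i\<in>?J. c i * Z i x) * iexp (t * Z k x) = iexp (\<Sum>i\<in>I - A. (if i = k then t else c i) * Z i x)"
      for Z :: "'i \<Rightarrow> 'c \<Rightarrow> real" and x
    proof -
      have "(\<Sum>i\<in>?J. (if i = k then t else c i) * Z i x) = (\<Sum>i\<in>?J. c i * Z i x)"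
        by (intro sum.cong) auto
      thus ?thesis unfolding split(1) using split(2,3)
        by (simp add: exp_add[symmetric] distrib_left add.commute)
    qed
    show ?thesis unfolding mult.assoc s
      by (rule insert.IH) (use AI that in auto)
  qed
  have "(CLINT x|M. (\<Prod>i\<in>A. indicator (B i) (X i x)) * iexp (\<Sum>i\<in>?J. c i * X i x) * indicator (B k) (X k x))
     = (CLINT x|N. (\<Prod>i\<in>A. indicator (B i) (Y i x)) * iexp (\<Sum>i\<in>?J. c i * Y i x) * indicator (B k) (Y k x))"
  proof (rule complex_weight_char_imp_eq[OF M N])
    have [measurable]: "i \<in> ?J \<Longrightarrow> X i \<in> borel_measurable M" "i \<in> ?J \<Longrightarrow> Y i \<in> borel_measurable N" for i
      by auto
    show "(\<lambda>x. (\<Prod>i\<in>A. indicator (B i) (X i x)) * iexp (\<Sum>i\<in>?J. c i * X i x)) \<in> borel_measurable M"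
      "(\<lambda>x. (\<Prod>i\<in>A. indicator (B i) (Y i x)) * iexp (\<Sum>i\<in>?J. c i * Y i x)) \<in> borel_measurable N"
      by (intro borel_measurable_times mX mY insert.prems(2); measurable)+
    fix t
    have r: "cnj (\<Prod>i\<in>A. indicator (B i) (z i)) = (\<Prod>i\<in>A. indicator (B i) (z i))" for z :: "'i \<Rightarrow> real"
      by (auto simp: cnj_prod intro!: prod.cong simp: indicator_def)
    have e: "cnj (iexp y) = iexp (- y)" for y by (simp add: exp_cnj)
    have n: "- (\<Sum>i\<in>?J. c i * Z i) = (\<Sum>i\<in>?J. (- c i) * Z i)" for Z :: "'i \<Rightarrow> real"
      by (simp add: sum_negf)
    show "(CLINT x|M. cnj ((\<Prod>i\<in>A. indicator (B i) (X i x)) * iexp (\<Sum>i\<in>?J. c i * X i x)) * iexp (t * X k x))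
     = (CLINT x|N. cnj ((\<Prod>i\<in>A. indicator (B i) (Y i x)) * iexp (\<Sum>i\<in>?J. c i * Y i x)) * iexp (t * Y k x))"
      unfolding complex_cnj_mult r e n by (rule key) fact
    show "(CLINT x|M. iexp (t * X k x)) = (CLINT x|N. iexp (t * Y k x))"
      using key[of "\<lambda>_. UNIV" "\<lambda>_. 0" t] by simp
    show "(CLINT x|M. (\<Prod>i\<in>A. indicator (B i) (X i x)) * iexp (\<Sum>i\<in>?J. c i * X i x) * iexp (t * X k x))
     = (CLINT x|N. (\<Prod>i\<in>A. indicator (B i) (Y i x)) * iexp (\<Sum>i\<in>?J. c i * Y i x) * iexp (t * Y k x))"
      by (rule key) fact
  qed (use nX nY in \<open>auto simp: norm_mult\<close>)
  thus ?case using insert.hyps by (simp add: mult_ac)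
qed

text \<open>A form of the Cramer--Wold theorem. Once all coordinates have been traded for indicators, the two laws agree on
rectangles, which generate the product sigma-algebra.\<close>

theorem char_eq_imp_distr_PiM_eq:
  fixes M :: "'a measure" and N :: "'b measure" and X :: "'i \<Rightarrow> 'a \<Rightarrow> real"
  assumes M: "prob_space M" and N: "prob_space N" and I: "finite I"
    and [measurable]: "\<And>i. i \<in> I \<Longrightarrow> X i \<in> borel_measurable M" "\<And>i. i \<in> I \<Longrightarrow> Y i \<in> borel_measurable N"
    and eq: "\<And>c. (CLINT x|M. iexp (\<Sum>i\<in>I. c i * X i x)) = (CLINT y|N. iexp (\<Sum>i\<in>I. c i * Y i y))"
  shows "distr M (Pi\<^sub>M I (\<lambda>_. borel)) (\<lambda>x. \<lambda>i\<in>I. X i x) = distr N (Pi\<^sub>M I (\<lambda>_. borel)) (\<lambda>y. \<lambda>i\<in>I. Y i y)"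
proof (rule measure_eqI_PiM_finite[OF I])
  interpret M: prob_space M by fact
  interpret N: prob_space N by fact
  fix A :: "'i \<Rightarrow> real set" assume A: "\<And>i. i \<in> I \<Longrightarrow> A i \<in> sets borel"
  define B where "B i = (if i \<in> I then A i else UNIV)" for i
  have B: "B i \<in> sets borel" for i using A by (auto simp: B_def)
  have AB: "Pi\<^sub>E I A = Pi\<^sub>E I B" by (auto simp: B_def intro!: PiE_cong)
  have S[measurable]: "Pi\<^sub>E I B \<in> sets (Pi\<^sub>M I (\<lambda>_. borel))" using I B by (intro sets_PiM_I_finite) auto
  have ind: "(\<Prod>i\<in>I. indicator (B i) (z i)) = (indicator (Pi\<^sub>E I B) (\<lambda>i\<in>I. z i) :: complex)" for z :: "'i \<Rightarrow> real"
  proof (cases "\<forall>i\<in>I. z i \<in> B i")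
    case True then show ?thesis by (auto simp: PiE_def Pi_def)
  next
    case False
    then obtain j where "j \<in> I" "z j \<notin> B j" by auto
    hence "(\<Prod>i\<in>I. indicator (B i) (z i) :: complex) = 0" using I by (intro prod_zero bexI[of _ j]) auto
    thus ?thesis using False by (auto simp: indicator_def)
  qed
  have "complex_of_real (measure M ((\<lambda>x. \<lambda>i\<in>I. X i x) -` Pi\<^sub>E I B \<inter> space M)) = (CLINT x|M. indicator (Pi\<^sub>E I B) (\<lambda>i\<in>I. X i x))"
  proof -
    have "(CLINT x|M. indicator (Pi\<^sub>E I B) (\<lambda>i\<in>I. X i x)) = (CLINT x|M. complex_of_real (indicator ((\<lambda>x. \<lambda>i\<in>I. X i x) -` Pi\<^sub>E I B \<inter> space M) x))"
      by (intro Bochner_Integration.integral_cong) (auto simp: indicator_def)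
    thus ?thesis by (simp add: integral_complex_of_real)
  qed
  also have "\<dots> = (CLINT x|N. indicator (Pi\<^sub>E I B) (\<lambda>i\<in>I. Y i x))"
    using char_partial_indicator_eq[OF M N I assms(4,5) eq I order_refl, of B "\<lambda>_. 0"] B by (simp add: ind)
  also have "\<dots> = complex_of_real (measure N ((\<lambda>x. \<lambda>i\<in>I. Y i x) -` Pi\<^sub>E I B \<inter> space N))"
  proof -
    have "(CLINT x|N. indicator (Pi\<^sub>E I B) (\<lambda>i\<in>I. Y i x)) = (CLINT x|N. complex_of_real (indicator ((\<lambda>x. \<lambda>i\<in>I. Y i x) -` Pi\<^sub>E I B \<inter> space N) x))"
      by (intro Bochner_Integration.integral_cong) (auto simp: indicator_def)
    thus ?thesis by (simp add: integral_complex_of_real)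
  qed
  finally show "emeasure (distr M (Pi\<^sub>M I (\<lambda>_. borel)) (\<lambda>x. \<lambda>i\<in>I. X i x)) (Pi\<^sub>E I A)
    = emeasure (distr N (Pi\<^sub>M I (\<lambda>_. borel)) (\<lambda>y. \<lambda>i\<in>I. Y i y)) (Pi\<^sub>E I A)"
    unfolding AB by (simp add: emeasure_distr M.emeasure_eq_measure N.emeasure_eq_measure)
next
  interpret M: prob_space M by fact
  have [measurable]: "(\<lambda>x. \<lambda>i\<in>I. X i x) \<in> M \<rightarrow>\<^sub>M Pi\<^sub>M I (\<lambda>_. borel)" by measurable
  interpret D: prob_space "distr M (Pi\<^sub>M I (\<lambda>_. borel)) (\<lambda>x. \<lambda>i\<in>I. X i x)"
    by (rule M.prob_space_distr) simp
  show "range (\<lambda>_::nat. Pi\<^sub>E I (\<lambda>_. UNIV)) \<subseteq> prod_algebra I (\<lambda>_. borel)"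
    using I by (auto intro!: prod_algebraI_finite)
  show "(\<Union>i::nat. Pi\<^sub>E I (\<lambda>_. UNIV)) = space (Pi\<^sub>M I (\<lambda>_. borel))" by (simp add: space_PiM)
  show "emeasure (distr M (Pi\<^sub>M I (\<lambda>_. borel)) (\<lambda>x. \<lambda>i\<in>I. X i x)) (Pi\<^sub>E I (\<lambda>_. UNIV)) \<noteq> \<infinity>" for i :: nat
    by simp
qed auto

section \<open>One-dimensional centered Gaussian variables\<close>

context prob_space
begin

lemma gaussian_rv_integrable:
  assumes "gaussian_rv X"
  shows "integrable M X"
proof -
  have [measurable]: "X \<in> borel_measurable M" using assms by (simp add: gaussian_rv_def)
  from assms consider \<mu> where "AE \<omega> in M. X \<omega> = \<mu>"
    | \<mu> \<sigma> where "0 < \<sigma>" "distributed M lborel X (normal_density \<mu> \<sigma>)"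
    unfolding gaussian_rv_def by blast
  thus ?thesis
  proof cases
    case 1
    have "integrable M X \<longleftrightarrow> integrable M (\<lambda>_. \<mu>)"
      by (rule Bochner_Integration.integrable_cong_AE) (use 1 in auto)
    thus ?thesis by simp
  next
    case 2
    show ?thesis
      using distributed_integrable[OF 2(2), of "\<lambda>x. x"] integrable_normal_moment_nz_1[OF 2(1), of \<mu>] by simp
  qed
qed

text \<open>In the degenerate case the variable is almost surely \<open>0\<close>, so the formulas below hold in both cases with the second moment
as parameter.\<close>

lemma centered_gaussian_rv_cases:
  assumes "gaussian_rv X" "expectation X = 0"
  obtains "AE \<omega> in M. X \<omega> = 0" "expectation (\<lambda>\<omega>. (X \<omega>)\<^sup>2) = 0"
  | \<sigma> where "0 < \<sigma>" "distributed M lborel X (normal_density 0 \<sigma>)" "expectation (\<lambda>\<omega>. (X \<omega>)\<^sup>2) = \<sigma>\<^sup>2"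
proof -
  have [measurable]: "X \<in> borel_measurable M" using assms by (simp add: gaussian_rv_def)
  from assms consider \<mu> where "AE \<omega> in M. X \<omega> = \<mu>"
    | \<mu> \<sigma> where "0 < \<sigma>" "distributed M lborel X (normal_density \<mu> \<sigma>)"
    unfolding gaussian_rv_def by blast
  thus ?thesis
  proof cases
    case 1
    have "expectation X = expectation (\<lambda>_. \<mu>)"
      by (rule Bochner_Integration.integral_cong_AE) (use 1 in auto)
    hence "\<mu> = 0" using assms by (simp add: prob_space)
    hence *: "AE \<omega> in M. X \<omega> = 0" using 1 by simp
    have "expectation (\<lambda>\<omega>. (X \<omega>)\<^sup>2) = 0"
      by (rule integral_eq_zero_AE) (use * in auto)
    thus ?thesis using * that by blast
  next
    case 2
    have "\<mu> = 0" using normal_distributed_expectation[OF 2] assms by simp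
    moreover have "expectation (\<lambda>\<omega>. (X \<omega>)\<^sup>2) = \<sigma>\<^sup>2"
      using normal_distributed_variance[OF 2] assms(2) by simp
    ultimately show ?thesis using that 2 by blast
  qed
qed

lemma centered_gaussian_rv_square_integrable:
  assumes "gaussian_rv X" "expectation X = 0"
  shows "integrable M (\<lambda>\<omega>. (X \<omega>)\<^sup>2)"
proof -
  have [measurable]: "X \<in> borel_measurable M" using assms by (simp add: gaussian_rv_def)
  from assms show ?thesis
  proof (cases rule: centered_gaussian_rv_cases)
    case 1
    have "integrable M (\<lambda>\<omega>. (X \<omega>)\<^sup>2) \<longleftrightarrow> integrable M (\<lambda>_. 0::real)"
      by (rule Bochner_Integration.integrable_cong_AE) (use 1 in auto)
    thus ?thesis by simp
  next
    case (2 \<sigma>)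
    show ?thesis
      by (rule ccontr) (use 2(1,3) not_integrable_integral_eq in fastforce)
  qed
qed

lemma centered_gaussian_rv_char:
  assumes "gaussian_rv X" "expectation X = 0"
  shows "(CLINT \<omega>|M. iexp (X \<omega>)) = exp (- complex_of_real (expectation (\<lambda>\<omega>. (X \<omega>)\<^sup>2)) / 2)"
proof -
  have [measurable]: "X \<in> borel_measurable M" using assms by (simp add: gaussian_rv_def)
  from assms show ?thesis
  proof (cases rule: centered_gaussian_rv_cases)
    case 1
    have "(CLINT \<omega>|M. iexp (X \<omega>)) = (CLINT \<omega>|M. 1)"
      by (rule Bochner_Integration.integral_cong_AE) (use 1 in auto)
    thus ?thesis using 1 by (simp add: prob_space)
  next
    case (2 \<sigma>)
    have D: "distributed M lborel (\<lambda>\<omega>. X \<omega> / \<sigma>) std_normal_density"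
      using normal_standard_normal_convert[OF 2(1), of X 0] 2(2) by simp
    have "(CLINT \<omega>|M. iexp (X \<omega>)) = (CLINT \<omega>|M. iexp (\<sigma> * (X \<omega> / \<sigma>)))"
      using 2(1) by simp
    also have "\<dots> = (CLINT x|distr M lborel (\<lambda>\<omega>. X \<omega> / \<sigma>). iexp (\<sigma> * x))"
      by (subst integral_distr) auto
    also have "\<dots> = char std_normal_distribution \<sigma>"
      using distributed_distr_eq_density[OF D] unfolding char_def by simp
    also have "\<dots> = exp (- complex_of_real (\<sigma>\<^sup>2) / 2)"
      by (simp add: char_std_normal_distribution exp_of_real[symmetric])
    finally show ?thesis using 2 by simp
  qed
qed

lemma centered_gaussian_rv_mgf:
  assumes "gaussian_rv X" "expectation X = 0"
  shows "(\<integral>\<^sup>+\<omega>. ennreal (exp (s * X \<omega>)) \<partial>M) = ennreal (exp (s\<^sup>2 * expectation (\<lambda>\<omega>. (X \<omega>)\<^sup>2) / 2))"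
proof -
  have [measurable]: "X \<in> borel_measurable M" using assms by (simp add: gaussian_rv_def)
  from assms show ?thesis
  proof (cases rule: centered_gaussian_rv_cases)
    case 1
    have "(\<integral>\<^sup>+\<omega>. ennreal (exp (s * X \<omega>)) \<partial>M) = (\<integral>\<^sup>+\<omega>. 1 \<partial>M)"
      by (rule nn_integral_cong_AE) (use 1 in auto)
    thus ?thesis using 1 by (simp add: emeasure_space_1)
  next
    case (2 \<sigma>)
    have eq: "normal_density 0 \<sigma> x * exp (s * x) = exp (s\<^sup>2 * \<sigma>\<^sup>2 / 2) * normal_density (s * \<sigma>\<^sup>2) \<sigma> x" for x
    proof -
      have "- (x\<^sup>2 / (2 * \<sigma>\<^sup>2)) + s * x = s\<^sup>2 * \<sigma>\<^sup>2 / 2 + - ((x - s * \<sigma>\<^sup>2)\<^sup>2 / (2 * \<sigma>\<^sup>2))"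
        using 2(1) by (simp add: field_simps power2_eq_square)
      hence "exp (- (x\<^sup>2 / (2 * \<sigma>\<^sup>2))) * exp (s * x) = exp (s\<^sup>2 * \<sigma>\<^sup>2 / 2) * exp (- ((x - s * \<sigma>\<^sup>2)\<^sup>2 / (2 * \<sigma>\<^sup>2)))"
        by (simp only: exp_add[symmetric])
      thus ?thesis by (simp add: normal_density_def)
    qed
    have "(\<integral>\<^sup>+\<omega>. ennreal (exp (s * X \<omega>)) \<partial>M) = (\<integral>\<^sup>+x. ennreal (normal_density 0 \<sigma> x) * ennreal (exp (s * x)) \<partial>lborel)"
      by (rule distributed_nn_integral[OF 2(2), symmetric]) simp
    also have "\<dots> = (\<integral>\<^sup>+x. ennreal (exp (s\<^sup>2 * \<sigma>\<^sup>2 / 2)) * ennreal (normal_density (s * \<sigma>\<^sup>2) \<sigma> x) \<partial>lborel)"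
      by (simp add: ennreal_mult'[symmetric] eq)
    also have "\<dots> = ennreal (exp (s\<^sup>2 * \<sigma>\<^sup>2 / 2)) * (\<integral>\<^sup>+x. ennreal (normal_density (s * \<sigma>\<^sup>2) \<sigma> x) \<partial>lborel)"
      by (rule nn_integral_cmult) simp
    also have "(\<integral>\<^sup>+x. ennreal (normal_density (s * \<sigma>\<^sup>2) \<sigma> x) \<partial>lborel) = 1"
      using 2(1) by (subst nn_integral_eq_integral) auto
    finally show ?thesis using 2 by simp
  qed
qed

lemma centered_gaussian_rv_tail:
  assumes "gaussian_rv X" "expectation X = 0"
    and v: "expectation (\<lambda>\<omega>. (X \<omega>)\<^sup>2) \<le> v" "0 < v" and a: "0 \<le> a"
  shows "prob {\<omega> \<in> space M. a \<le> X \<omega>} \<le> exp (- a\<^sup>2 / (2 * v))"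
proof -
  have [measurable]: "X \<in> borel_measurable M" using assms by (simp add: gaussian_rv_def)
  define s where "s = a / v"
  have s: "0 \<le> s" using v a by (simp add: s_def)
  have "ennreal (exp (s * a)) * emeasure M {\<omega> \<in> space M. a \<le> X \<omega>}
      = (\<integral>\<^sup>+\<omega>. ennreal (exp (s * a)) * indicator {\<omega> \<in> space M. a \<le> X \<omega>} \<omega> \<partial>M)"
    by (rule nn_integral_cmult_indicator[symmetric]) simp
  also have "\<dots> \<le> (\<integral>\<^sup>+\<omega>. ennreal (exp (s * X \<omega>)) \<partial>M)"
    using s by (intro nn_integral_mono) (auto simp: indicator_def intro!: mult_left_mono)
  also have "\<dots> = ennreal (exp (s\<^sup>2 * expectation (\<lambda>\<omega>. (X \<omega>)\<^sup>2) / 2))"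
    using assms by (intro centered_gaussian_rv_mgf)
  also have "\<dots> \<le> ennreal (exp (s\<^sup>2 * v / 2))"
    using v by (intro ennreal_leI) (auto intro!: mult_left_mono divide_right_mono)
  finally have "exp (s * a) * prob {\<omega> \<in> space M. a \<le> X \<omega>} \<le> exp (s\<^sup>2 * v / 2)"
    by (simp add: emeasure_eq_measure ennreal_mult'[symmetric])
  hence "prob {\<omega> \<in> space M. a \<le> X \<omega>} \<le> exp (s\<^sup>2 * v / 2) / exp (s * a)"
    by (simp add: field_simps)
  also have "\<dots> = exp (s\<^sup>2 * v / 2 - s * a)" by (simp add: exp_diff)
  also have "s\<^sup>2 * v / 2 - s * a = - a\<^sup>2 / (2 * v)"
    using v by (simp add: s_def field_simps power2_eq_square)
  finally show ?thesis .
qed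

text \<open>Keeping only the part of the density over the interval from \<open>a\<close> to \<open>a + 1\<close> loses a factor \<open>exp (- a)\<close> or so, which does
not matter on the exponential scale in \<open>a\<^sup>2\<close>.\<close>

lemma standard_gaussian_rv_tail_lower:
  assumes "gaussian_rv X" "expectation X = 0" "expectation (\<lambda>\<omega>. (X \<omega>)\<^sup>2) = 1" and a: "0 \<le> a"
  shows "exp (- (a + 1)\<^sup>2 / 2) / sqrt (2 * pi) \<le> prob {\<omega> \<in> space M. a \<le> X \<omega>}"
  using assms(1,2)
proof (cases rule: centered_gaussian_rv_cases)
  case 1 thus ?thesis using assms(3) by simp
next
  case (2 \<sigma>)
  hence D: "distributed M lborel X std_normal_density" using assms(3) by (simp add: power2_eq_1_iff)
  have "ennreal (exp (- (a + 1)\<^sup>2 / 2) / sqrt (2 * pi)) = (\<integral>\<^sup>+x. ennreal (exp (- (a + 1)\<^sup>2 / 2) / sqrt (2 * pi)) * indicator {a..a+1} x \<partial>lborel)"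
    by (subst nn_integral_cmult_indicator) auto
  also have "\<dots> \<le> (\<integral>\<^sup>+x. ennreal (std_normal_density x) * indicator {a..} x \<partial>lborel)"
  proof (intro nn_integral_mono)
    fix x
    have "exp (- (a + 1)\<^sup>2 / 2) \<le> exp (- x\<^sup>2 / 2)" if "a \<le> x" "x \<le> a + 1"
      using that a by (auto intro!: power_mono)
    thus "ennreal (exp (- (a + 1)\<^sup>2 / 2) / sqrt (2 * pi)) * indicator {a..a+1} x \<le> ennreal (std_normal_density x) * indicator {a..} x"
      by (auto simp: indicator_def std_normal_density_def intro!: ennreal_leI divide_right_mono)
  qed
  also have "\<dots> = emeasure M (X -` {a..} \<inter> space M)"
    using D by (intro distributed_emeasure[symmetric]) auto
  also have "X -` {a..} \<inter> space M = {\<omega> \<in> space M. a \<le> X \<omega>}" by auto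
  finally show ?thesis by (simp add: emeasure_eq_measure)
qed

end

section \<open>Concentration of Gaussian maxima\<close>

text \<open>Jensen's inequality for the exponential and the uniform distribution on \<open>{..<K}\<close>, with the mean written as a sum.\<close>

lemma exp_mean_le_mean_exp:
  fixes x :: "nat \<Rightarrow> real"
  assumes "0 < K"
  shows "exp (\<Sum>k<K. x k) \<le> (\<Sum>k<K. exp (real K * x k)) / real K"
proof -
  define m where "m = (\<Sum>k<K. x k)"
  have "exp m * (1 + (real K * x k - m)) \<le> exp (real K * x k)" for k
  proof -
    have "exp m * (1 + (real K * x k - m)) \<le> exp m * exp (real K * x k - m)"
      by (intro mult_left_mono exp_ge_add_one_self) auto
    thus ?thesis by (simp add: exp_add[symmetric])
  qed
  hence "(\<Sum>k<K. exp m * (1 + (real K * x k - m))) \<le> (\<Sum>k<K. exp (real K * x k))" by (intro sum_mono)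
  also have "(\<Sum>k<K. exp m * (1 + (real K * x k - m))) = exp m * (real K + (real K * m - real K * m))"
    unfolding sum_distrib_left[symmetric] sum.distrib sum_subtractf by (simp add: m_def sum_distrib_left)
  finally show ?thesis using assms by (simp add: m_def field_simps)
qed

context prob_space
begin

definition centered_gaussian_field :: "('t \<Rightarrow> 'a \<Rightarrow> real) \<Rightarrow> bool" where
  "centered_gaussian_field X \<longleftrightarrow> gaussian_field X \<and> (\<forall>t. expectation (X t) = 0)"

lemma centered_gaussian_fieldD:
  assumes "centered_gaussian_field X"
  shows "gaussian_rv (X t)" "expectation (X t) = 0" "X t \<in> borel_measurable M"
proof -
  show g: "gaussian_rv (X t)"
    using assms unfolding centered_gaussian_field_def gaussian_field_def
    by (auto dest!: spec[of _ "{t}"] spec[of _ "\<lambda>_. 1"])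
  show "expectation (X t) = 0" using assms by (simp add: centered_gaussian_field_def)
  show "X t \<in> borel_measurable M" using g by (simp add: gaussian_rv_def)
qed

lemma centered_gaussian_field_combination:
  assumes X: "centered_gaussian_field X" and T: "finite T"
  shows "gaussian_rv (\<lambda>\<omega>. \<Sum>t\<in>T. a t * X t \<omega>)" "expectation (\<lambda>\<omega>. \<Sum>t\<in>T. a t * X t \<omega>) = 0"
proof -
  show "gaussian_rv (\<lambda>\<omega>. \<Sum>t\<in>T. a t * X t \<omega>)"
    using X T by (auto simp: centered_gaussian_field_def gaussian_field_def)
  have "expectation (\<lambda>\<omega>. \<Sum>t\<in>T. a t * X t \<omega>) = (\<Sum>t\<in>T. expectation (\<lambda>\<omega>. a t * X t \<omega>))"
    by (rule Bochner_Integration.integral_sum)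
       (auto intro: gaussian_rv_integrable centered_gaussian_fieldD[OF X])
  also have "\<dots> = 0" using X by (simp add: centered_gaussian_field_def)
  finally show "expectation (\<lambda>\<omega>. \<Sum>t\<in>T. a t * X t \<omega>) = 0" .
qed

lemma centered_gaussian_field_integrable_mult:
  assumes X: "centered_gaussian_field X"
  shows "integrable M (\<lambda>\<omega>. X s \<omega> * X t \<omega>)"
proof (rule Bochner_Integration.integrable_bound)
  note [measurable] = centered_gaussian_fieldD(3)[OF X]
  show "integrable M (\<lambda>\<omega>. (X s \<omega>)\<^sup>2 + (X t \<omega>)\<^sup>2)"
    using centered_gaussian_fieldD[OF X] by (intro Bochner_Integration.integrable_add centered_gaussian_rv_square_integrable)
  show "(\<lambda>\<omega>. X s \<omega> * X t \<omega>) \<in> borel_measurable M" by simp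
  have "\<bar>x * y\<bar> \<le> \<bar>x\<^sup>2 + y\<^sup>2\<bar>" for x y :: real
  proof -
    have "0 \<le> (\<bar>x\<bar> - \<bar>y\<bar>)\<^sup>2" "0 \<le> \<bar>x\<bar> * \<bar>y\<bar>" by auto
    moreover have "(\<bar>x\<bar> - \<bar>y\<bar>)\<^sup>2 = x\<^sup>2 + y\<^sup>2 - 2 * (\<bar>x\<bar> * \<bar>y\<bar>)"
      by (simp add: power2_diff)
    ultimately show ?thesis unfolding abs_mult by linarith
  qed
  thus "AE \<omega> in M. norm (X s \<omega> * X t \<omega>) \<le> norm ((X s \<omega>)\<^sup>2 + (X t \<omega>)\<^sup>2)" by simp
qed

lemma centered_gaussian_field_second_moment:
  assumes X: "centered_gaussian_field X" and T: "finite T"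
  shows "expectation (\<lambda>\<omega>. (\<Sum>t\<in>T. a t * X t \<omega>)\<^sup>2) = (\<Sum>s\<in>T. \<Sum>t\<in>T. a s * a t * expectation (\<lambda>\<omega>. X s \<omega> * X t \<omega>))"
proof -
  have i: "integrable M (\<lambda>\<omega>. c * (X s \<omega> * X t \<omega>))" for c s t
    using centered_gaussian_field_integrable_mult[OF X] by simp
  have "expectation (\<lambda>\<omega>. (\<Sum>t\<in>T. a t * X t \<omega>)\<^sup>2) = expectation (\<lambda>\<omega>. \<Sum>s\<in>T. \<Sum>t\<in>T. (a s * a t) * (X s \<omega> * X t \<omega>))"
    by (simp add: power2_eq_square sum_product algebra_simps)
  also have "\<dots> = (\<Sum>s\<in>T. \<Sum>t\<in>T. expectation (\<lambda>\<omega>. (a s * a t) * (X s \<omega> * X t \<omega>)))"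
    using i by (simp add: Bochner_Integration.integral_sum Bochner_Integration.integrable_sum del: integral_mult_right_zero)
  finally show ?thesis by simp
qed

lemma centered_gaussian_field_char:
  assumes X: "centered_gaussian_field X" and T: "finite T"
  shows "(CLINT \<omega>|M. iexp (\<Sum>t\<in>T. a t * X t \<omega>)) =
    exp (- complex_of_real (\<Sum>s\<in>T. \<Sum>t\<in>T. a s * a t * expectation (\<lambda>\<omega>. X s \<omega> * X t \<omega>)) / 2)"
  using centered_gaussian_rv_char[OF centered_gaussian_field_combination[OF X T], of a]
  unfolding centered_gaussian_field_second_moment[OF X T] .

lemma centered_gaussian_field_diff:
  assumes X: "centered_gaussian_field X"
  shows "centered_gaussian_field (\<lambda>t \<omega>. X t \<omega> - X u \<omega>)"
  unfolding centered_gaussian_field_def gaussian_field_def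
proof (intro conjI allI impI)
  fix t
  show "expectation (\<lambda>\<omega>. X t \<omega> - X u \<omega>) = 0"
    using centered_gaussian_fieldD(2)[OF X]
    by (subst Bochner_Integration.integral_diff) (auto intro: gaussian_rv_integrable centered_gaussian_fieldD[OF X])
next
  fix T :: "'b set" and a :: "'b \<Rightarrow> real" assume T: "finite T"
  define b where "b t = (if t \<in> T then a t else 0) - (if t = u then \<Sum>t\<in>T. a t else 0)" for t
  have "(\<Sum>t\<in>T. a t * (X t \<omega> - X u \<omega>)) = (\<Sum>t\<in>insert u T. b t * X t \<omega>)" for \<omega>
  proof -
    have "(\<Sum>t\<in>insert u T. b t * X t \<omega>) = (\<Sum>t\<in>insert u T. (if t \<in> T then a t * X t \<omega> else 0))
        - (\<Sum>t\<in>insert u T. if t = u then (\<Sum>t\<in>T. a t) * X t \<omega> else 0)"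
      by (auto simp: b_def sum_subtractf[symmetric] left_diff_distrib intro!: sum.cong)
    also have "(\<Sum>t\<in>insert u T. (if t \<in> T then a t * X t \<omega> else 0)) = (\<Sum>t\<in>T. a t * X t \<omega>)"
      using T by (intro sum.mono_neutral_cong_right) auto
    also have "(\<Sum>t\<in>insert u T. if t = u then (\<Sum>t\<in>T. a t) * X t \<omega> else 0) = (\<Sum>t\<in>T. a t) * X u \<omega>"
      using T by (subst sum.delta) auto
    finally show ?thesis by (simp add: right_diff_distrib sum_subtractf sum_distrib_right)
  qed
  thus "gaussian_rv (\<lambda>\<omega>. \<Sum>t\<in>T. a t * (X t \<omega> - X u \<omega>))"
    using centered_gaussian_field_combination(1)[OF X, of "insert u T" b] T by simp
qed

lemma iid_pair_char:
  assumes X: "centered_gaussian_field X" and T: "finite T"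
  shows "(CLINT z|M \<Otimes>\<^sub>M M. iexp ((\<Sum>t\<in>T. a t * X t (fst z)) + (\<Sum>t\<in>T. b t * X t (snd z)))) =
    exp (- complex_of_real ((\<Sum>s\<in>T. \<Sum>t\<in>T. a s * a t * expectation (\<lambda>\<omega>. X s \<omega> * X t \<omega>))
        + (\<Sum>s\<in>T. \<Sum>t\<in>T. b s * b t * expectation (\<lambda>\<omega>. X s \<omega> * X t \<omega>))) / 2)"
proof -
  interpret P: pair_prob_space M M ..
  note [measurable] = centered_gaussian_fieldD(3)[OF X]
  let ?f = "\<lambda>z. iexp ((\<Sum>t\<in>T. a t * X t (fst z)) + (\<Sum>t\<in>T. b t * X t (snd z)))"
  have "integrable (M \<Otimes>\<^sub>M M) ?f"
    by (rule P.integrable_const_bound[where B=1]) auto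
  hence "(CLINT z|M \<Otimes>\<^sub>M M. ?f z) = (CLINT x|M. CLINT y|M. ?f (x, y))"
    by (rule P.integral_fst'[symmetric])
  also have "\<dots> = (CLINT x|M. CLINT y|M. iexp (\<Sum>t\<in>T. a t * X t x) * iexp (\<Sum>t\<in>T. b t * X t y))"
    by (simp add: distrib_left exp_add)
  also have "\<dots> = (CLINT x|M. iexp (\<Sum>t\<in>T. a t * X t x)) * (CLINT y|M. iexp (\<Sum>t\<in>T. b t * X t y))"
    by simp
  also have "\<dots> = exp (- complex_of_real (\<Sum>s\<in>T. \<Sum>t\<in>T. a s * a t * expectation (\<lambda>\<omega>. X s \<omega> * X t \<omega>)) / 2)
      * exp (- complex_of_real (\<Sum>s\<in>T. \<Sum>t\<in>T. b s * b t * expectation (\<lambda>\<omega>. X s \<omega> * X t \<omega>)) / 2)"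
    by (simp only: centered_gaussian_field_char[OF X T])
  also have "exp (- complex_of_real p / 2) * exp (- complex_of_real q / 2) = exp (- complex_of_real (p + q) / 2)" for p q
    by (simp add: exp_add[symmetric] diff_divide_distrib)
  finally show ?thesis .
qed

text \<open>The product space carries two independent copies of \<open>X\<close>, read off the two components. The characteristic function of
the pair is the exponential of \<open>- (Q a + Q b) / 2\<close> with a quadratic form \<open>Q\<close>, and the sum of the two values of \<open>Q\<close> is
unchanged by an orthogonal change of the coefficients. The Boolean index distinguishes the two rotated copies.\<close>

lemma iid_pair_rotation:
  fixes X :: "'t \<Rightarrow> 'a \<Rightarrow> real"
  assumes X: "centered_gaussian_field X" and T: "finite T" and sc: "s\<^sup>2 + c\<^sup>2 = (1::real)"
    and f: "f \<in> borel_measurable (Pi\<^sub>M (T \<times> UNIV) (\<lambda>_. borel))"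
  shows "(\<integral>\<^sup>+z. f (\<lambda>(t, b)\<in>T \<times> UNIV. if b then s * X t (fst z) + c * X t (snd z) else c * X t (fst z) - s * X t (snd z)) \<partial>(M \<Otimes>\<^sub>M M))
    = (\<integral>\<^sup>+z. f (\<lambda>(t, b)\<in>T \<times> UNIV. if b then X t (fst z) else X t (snd z)) \<partial>(M \<Otimes>\<^sub>M M))"
proof -
  interpret P: pair_prob_space M M ..
  note [measurable] = centered_gaussian_fieldD(3)[OF X]
  let ?K = "\<lambda>s t. expectation (\<lambda>\<omega>. X s \<omega> * X t \<omega>)"
  define Q where "Q a = (\<Sum>s\<in>T. \<Sum>t\<in>T. a s * a t * ?K s t)" for a
  define V where "V i z = (if snd i then s * X (fst i) (fst z) + c * X (fst i) (snd z) else c * X (fst i) (fst z) - s * X (fst i) (snd z))" for i :: "'t \<times> bool" and z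
  define U where "U i z = (if snd i then X (fst i) (fst z) else X (fst i) (snd z))" for i :: "'t \<times> bool" and z
  have UM[measurable]: "U i \<in> borel_measurable (M \<Otimes>\<^sub>M M)" and VM[measurable]: "V i \<in> borel_measurable (M \<Otimes>\<^sub>M M)" for i
    unfolding U_def V_def by (cases "snd i"; simp)+
  have sum2: "(\<Sum>i\<in>T \<times> UNIV. g i) = (\<Sum>t\<in>T. g (t, True) + g (t, False))" for g :: "'t \<times> bool \<Rightarrow> real"
    using T by (simp add: sum.Sigma[symmetric] UNIV_bool sum.cartesian_product' add.commute)
  have "distr (M \<Otimes>\<^sub>M M) (Pi\<^sub>M (T \<times> UNIV) (\<lambda>_. borel)) (\<lambda>z. \<lambda>i\<in>T \<times> UNIV. V i z)
      = distr (M \<Otimes>\<^sub>M M) (Pi\<^sub>M (T \<times> UNIV) (\<lambda>_. borel)) (\<lambda>z. \<lambda>i\<in>T \<times> UNIV. U i z)"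
  proof (rule char_eq_imp_distr_PiM_eq)
    fix k :: "'t \<times> bool \<Rightarrow> real"
    define a where "a t = k (t, True)" for t
    define b where "b t = k (t, False)" for t
    have 1: "(\<Sum>i\<in>T \<times> UNIV. k i * V i z) = (\<Sum>t\<in>T. (s * a t + c * b t) * X t (fst z)) + (\<Sum>t\<in>T. (c * a t - s * b t) * X t (snd z))" for z
      unfolding sum2 sum.distrib[symmetric] by (intro sum.cong) (auto simp: V_def a_def b_def algebra_simps)
    have 2: "(\<Sum>i\<in>T \<times> UNIV. k i * U i z) = (\<Sum>t\<in>T. a t * X t (fst z)) + (\<Sum>t\<in>T. b t * X t (snd z))" for z
      unfolding sum2 sum.distrib[symmetric] by (intro sum.cong) (auto simp: U_def a_def b_def algebra_simps)
    have q: "(s * x + c * y) * (s * x' + c * y') + (c * x - s * y) * (c * x' - s * y') = x * x' + y * y'" for x y x' y'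
    proof -
      have "(s * x + c * y) * (s * x' + c * y') + (c * x - s * y) * (c * x' - s * y') = (s\<^sup>2 + c\<^sup>2) * (x * x' + y * y')"
        by (simp add: algebra_simps power2_eq_square)
      thus ?thesis by (simp add: sc)
    qed
    have Q: "Q (\<lambda>t. s * a t + c * b t) + Q (\<lambda>t. c * a t - s * b t) = Q a + Q b"
      unfolding Q_def sum.distrib[symmetric] distrib_right[symmetric] q ..
    show "(CLINT z|M \<Otimes>\<^sub>M M. iexp (\<Sum>i\<in>T \<times> UNIV. k i * V i z)) = (CLINT z|M \<Otimes>\<^sub>M M. iexp (\<Sum>i\<in>T \<times> UNIV. k i * U i z))"
      unfolding 1 2 iid_pair_char[OF X T] using Q unfolding Q_def by simp
  qed (use T in \<open>auto intro: P.prob_space_axioms\<close>)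
  hence "(\<integral>\<^sup>+w. f w \<partial>distr (M \<Otimes>\<^sub>M M) (Pi\<^sub>M (T \<times> UNIV) (\<lambda>_. borel)) (\<lambda>z. \<lambda>i\<in>T \<times> UNIV. V i z))
      = (\<integral>\<^sup>+w. f w \<partial>distr (M \<Otimes>\<^sub>M M) (Pi\<^sub>M (T \<times> UNIV) (\<lambda>_. borel)) (\<lambda>z. \<lambda>i\<in>T \<times> UNIV. U i z))" by simp
  hence "(\<integral>\<^sup>+z. f (\<lambda>i\<in>T \<times> UNIV. V i z) \<partial>(M \<Otimes>\<^sub>M M)) = (\<integral>\<^sup>+z. f (\<lambda>i\<in>T \<times> UNIV. U i z) \<partial>(M \<Otimes>\<^sub>M M))"
    using f by (subst (asm) (1 2) nn_integral_distr) (auto intro!: measurable_restrict)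
  thus ?thesis by (simp add: U_def V_def case_prod_beta')
qed

text \<open>Fix the first copy and let \<open>t\<close> be a maximiser of it. Evaluating the second maximum at the same \<open>t\<close> bounds the difference by
\<open>(1 - cos h) * X t\<close> for the first copy plus \<open>sin h * X t\<close> for the second one. As the second copy is independent of the
choice of \<open>t\<close>, its contribution is the moment generating function of one Gaussian variable. The maximiser is chosen
inside the inner integral, so no measurable selection is involved.\<close>

lemma rotation_step_mgf_bound:
  fixes X :: "'t \<Rightarrow> 'a \<Rightarrow> real"
  assumes X: "centered_gaussian_field X" and T: "finite T" "T \<noteq> {}" and r: "0 \<le> r"
    and v: "\<And>t. t \<in> T \<Longrightarrow> expectation (\<lambda>\<omega>. (X t \<omega>)\<^sup>2) \<le> v"
  shows "(\<integral>\<^sup>+z. ennreal (exp (r * (Max ((\<lambda>t. X t (fst z)) ` T)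
            - Max ((\<lambda>t. cos h * X t (fst z) - sin h * X t (snd z)) ` T)))) \<partial>(M \<Otimes>\<^sub>M M))
    \<le> ennreal (exp ((r * sin h)\<^sup>2 * v / 2)) * (\<integral>\<^sup>+\<omega>. ennreal (exp (r * (1 - cos h) * Max ((\<lambda>t. X t \<omega>) ` T))) \<partial>M)"
proof -
  note [measurable] = centered_gaussian_fieldD(3)[OF X] and [simp] = T(1)
  let ?m = "\<lambda>\<omega>. Max ((\<lambda>t. X t \<omega>) ` T)"
  let ?f = "\<lambda>z. ennreal (exp (r * (?m (fst z) - Max ((\<lambda>t. cos h * X t (fst z) - sin h * X t (snd z)) ` T))))"
  have "(\<integral>\<^sup>+z. ?f z \<partial>(M \<Otimes>\<^sub>M M)) = (\<integral>\<^sup>+x. \<integral>\<^sup>+y. ?f (x, y) \<partial>M \<partial>M)"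
    by (rule nn_integral_fst[symmetric]) measurable
  also have "\<dots> \<le> (\<integral>\<^sup>+x. ennreal (exp ((r * sin h)\<^sup>2 * v / 2)) * ennreal (exp (r * (1 - cos h) * ?m x)) \<partial>M)"
  proof (rule nn_integral_mono)
    fix x
    have "?m x \<in> (\<lambda>t. X t x) ` T" using T by (intro Max_in) auto
    then obtain t where t: "t \<in> T" "?m x = X t x" by auto
    have "(\<integral>\<^sup>+y. ?f (x, y) \<partial>M) \<le> (\<integral>\<^sup>+y. ennreal (exp (r * (1 - cos h) * ?m x)) * ennreal (exp ((r * sin h) * X t y)) \<partial>M)"
    proof (rule nn_integral_mono)
      fix y
      have "cos h * X t x - sin h * X t y \<le> Max ((\<lambda>t. cos h * X t x - sin h * X t y) ` T)"
        using t by (intro Max_ge) auto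
      hence "r * (?m x - Max ((\<lambda>t. cos h * X t x - sin h * X t y) ` T)) \<le> r * (X t x - (cos h * X t x - sin h * X t y))"
        using r t(2) by (intro mult_left_mono) auto
      also have "\<dots> = r * (1 - cos h) * ?m x + r * sin h * X t y"
        unfolding t(2) by (simp add: algebra_simps)
      finally show "?f (x, y) \<le> ennreal (exp (r * (1 - cos h) * ?m x)) * ennreal (exp ((r * sin h) * X t y))"
        by (simp add: ennreal_mult'[symmetric] exp_add[symmetric])
    qed
    also have "\<dots> = ennreal (exp (r * (1 - cos h) * ?m x)) * (\<integral>\<^sup>+y. ennreal (exp ((r * sin h) * X t y)) \<partial>M)"
      by (rule nn_integral_cmult) simp
    also have "\<dots> \<le> ennreal (exp (r * (1 - cos h) * ?m x)) * ennreal (exp ((r * sin h)\<^sup>2 * v / 2))"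
    proof (rule mult_left_mono)
      have "(\<integral>\<^sup>+y. ennreal (exp ((r * sin h) * X t y)) \<partial>M) = ennreal (exp ((r * sin h)\<^sup>2 * expectation (\<lambda>\<omega>. (X t \<omega>)\<^sup>2) / 2))"
        by (intro centered_gaussian_rv_mgf centered_gaussian_fieldD[OF X])
      also have "\<dots> \<le> ennreal (exp ((r * sin h)\<^sup>2 * v / 2))"
        using v[OF t(1)] by (intro ennreal_leI) (auto intro!: mult_left_mono divide_right_mono)
      finally show "(\<integral>\<^sup>+y. ennreal (exp ((r * sin h) * X t y)) \<partial>M) \<le> ennreal (exp ((r * sin h)\<^sup>2 * v / 2))" .
    qed simp
    finally show "(\<integral>\<^sup>+y. ?f (x, y) \<partial>M) \<le> ennreal (exp ((r * sin h)\<^sup>2 * v / 2)) * ennreal (exp (r * (1 - cos h) * ?m x))"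
      by (simp only: mult.commute)
  qed
  also have "\<dots> = ennreal (exp ((r * sin h)\<^sup>2 * v / 2)) * (\<integral>\<^sup>+x. ennreal (exp (r * (1 - cos h) * ?m x)) \<partial>M)"
    by (rule nn_integral_cmult) measurable
  finally show ?thesis .
qed

text \<open>The first copy is reached from the second one in \<open>K\<close> rotations by the angle \<open>h\<close>. The difference of the maxima telescopes
along the way; Jensen's inequality separates the increments, and each has, by rotation invariance, the law
of the single step estimated above.\<close>

lemma max_difference_mgf_discretised:
  fixes X :: "'t \<Rightarrow> 'a \<Rightarrow> real"
  assumes X: "centered_gaussian_field X" and T: "finite T" "T \<noteq> {}" and s: "0 \<le> s" and K: "0 < K"
    and v: "\<And>t. t \<in> T \<Longrightarrow> expectation (\<lambda>\<omega>. (X t \<omega>)\<^sup>2) \<le> v"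
  defines "h \<equiv> pi / (2 * real K)"
  shows "(\<integral>\<^sup>+z. ennreal (exp (s * (Max ((\<lambda>t. X t (fst z)) ` T) - Max ((\<lambda>t. X t (snd z)) ` T)))) \<partial>(M \<Otimes>\<^sub>M M))
    \<le> ennreal (exp ((s * K * sin h)\<^sup>2 * v / 2)) * (\<integral>\<^sup>+\<omega>. ennreal (exp (s * K * (1 - cos h) * Max ((\<lambda>t. X t \<omega>) ` T))) \<partial>M)"
    (is "?L \<le> ?R")
proof -
  note [measurable] = centered_gaussian_fieldD(3)[OF X] and [simp] = T(1)
  define U where "U \<theta> t z = sin \<theta> * X t (fst z) + cos \<theta> * X t (snd z)" for \<theta> t z
  define F where "F k z = Max ((\<lambda>t. U (real k * h) t z) ` T)" for k z
  have UM[measurable]: "U \<theta> t \<in> borel_measurable (M \<Otimes>\<^sub>M M)" for \<theta> t unfolding U_def by measurable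
  have FM[measurable]: "F k \<in> borel_measurable (M \<Otimes>\<^sub>M M)" for k unfolding F_def by measurable
  have F0: "F 0 z = Max ((\<lambda>t. X t (snd z)) ` T)" for z by (simp add: F_def U_def)
  have Kh: "real K * h = pi / 2" using K by (simp add: h_def)
  have FK: "F K z = Max ((\<lambda>t. X t (fst z)) ` T)" for z unfolding F_def U_def Kh by simp
  have step: "(\<integral>\<^sup>+z. ennreal (exp (real K * (s * (F (Suc k) z - F k z)))) \<partial>(M \<Otimes>\<^sub>M M)) \<le> ?R" for k
  proof -
    define \<theta> where "\<theta> = real (Suc k) * h"
    define f where "f w = ennreal (exp (s * K * (Max ((\<lambda>t. w (t, True)) ` T) - Max ((\<lambda>t. cos h * w (t, True) - sin h * w (t, False)) ` T))))" for w :: "'t \<times> bool \<Rightarrow> real"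
    have fM: "f \<in> borel_measurable (Pi\<^sub>M (T \<times> UNIV) (\<lambda>_. borel))"
    proof -
      have [measurable]: "(\<lambda>w. w (t, b)) \<in> borel_measurable (Pi\<^sub>M (T \<times> UNIV) (\<lambda>_. borel))" if "t \<in> T" for t and b :: bool
        by (rule measurable_component_singleton) (use that in auto)
      show ?thesis unfolding f_def by measurable
    qed
    have prev_angle: "U (real k * h) t z = cos h * (sin \<theta> * X t (fst z) + cos \<theta> * X t (snd z)) - sin h * (cos \<theta> * X t (fst z) - sin \<theta> * X t (snd z))" for t z
    proof -
      have "real k * h = \<theta> - h" by (simp add: \<theta>_def algebra_simps)
      thus ?thesis unfolding U_def by (simp only: sin_diff cos_diff) (simp add: algebra_simps)
    qed
    have cong1: "Max ((\<lambda>t. g t) ` T) = Max ((\<lambda>t. g' t) ` T)" if "\<And>t. t \<in> T \<Longrightarrow> g t = g' t" for g g' :: "'t \<Rightarrow> real"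
      using that by (metis image_cong)
    have "(\<integral>\<^sup>+z. ennreal (exp (real K * (s * (F (Suc k) z - F k z)))) \<partial>(M \<Otimes>\<^sub>M M))
       = (\<integral>\<^sup>+z. f (\<lambda>(t, b)\<in>T \<times> UNIV. if b then sin \<theta> * X t (fst z) + cos \<theta> * X t (snd z) else cos \<theta> * X t (fst z) - sin \<theta> * X t (snd z)) \<partial>(M \<Otimes>\<^sub>M M))"
    proof (rule nn_integral_cong)
      fix z
      have "F (Suc k) z = Max ((\<lambda>t. (\<lambda>(t, b)\<in>T \<times> UNIV. if b then sin \<theta> * X t (fst z) + cos \<theta> * X t (snd z) else cos \<theta> * X t (fst z) - sin \<theta> * X t (snd z)) (t, True)) ` T)"
        unfolding F_def by (rule cong1) (simp add: U_def \<theta>_def)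
      moreover have "F k z = Max ((\<lambda>t. cos h * (\<lambda>(t, b)\<in>T \<times> UNIV. if b then sin \<theta> * X t (fst z) + cos \<theta> * X t (snd z) else cos \<theta> * X t (fst z) - sin \<theta> * X t (snd z)) (t, True) 
         - sin h * (\<lambda>(t, b)\<in>T \<times> UNIV. if b then sin \<theta> * X t (fst z) + cos \<theta> * X t (snd z) else cos \<theta> * X t (fst z) - sin \<theta> * X t (snd z)) (t, False)) ` T)"
        unfolding F_def by (rule cong1) (simp add: prev_angle)
      ultimately show "ennreal (exp (real K * (s * (F (Suc k) z - F k z)))) = f (\<lambda>(t, b)\<in>T \<times> UNIV. if b then sin \<theta> * X t (fst z) + cos \<theta> * X t (snd z) else cos \<theta> * X t (fst z) - sin \<theta> * X t (snd z))"
        by (simp only: f_def mult_ac)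
    qed
    also have "\<dots> = (\<integral>\<^sup>+z. f (\<lambda>(t, b)\<in>T \<times> UNIV. if b then X t (fst z) else X t (snd z)) \<partial>(M \<Otimes>\<^sub>M M))"
      by (rule iid_pair_rotation[OF X T(1) _ fM]) simp
    also have "\<dots> = (\<integral>\<^sup>+z. ennreal (exp (s * K * (Max ((\<lambda>t. X t (fst z)) ` T)
            - Max ((\<lambda>t. cos h * X t (fst z) - sin h * X t (snd z)) ` T)))) \<partial>(M \<Otimes>\<^sub>M M))"
    proof (rule nn_integral_cong)
      fix z
      have "Max ((\<lambda>t. X t (fst z)) ` T) = Max ((\<lambda>t. (\<lambda>(t, b)\<in>T \<times> UNIV. if b then X t (fst z) else X t (snd z)) (t, True)) ` T)"
        by (rule cong1) simp
      moreover have "Max ((\<lambda>t. cos h * X t (fst z) - sin h * X t (snd z)) ` T) = 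
         Max ((\<lambda>t. cos h * (\<lambda>(t, b)\<in>T \<times> UNIV. if b then X t (fst z) else X t (snd z)) (t, True) - sin h * (\<lambda>(t, b)\<in>T \<times> UNIV. if b then X t (fst z) else X t (snd z)) (t, False)) ` T)"
        by (rule cong1) simp
      ultimately show "f (\<lambda>(t, b)\<in>T \<times> UNIV. if b then X t (fst z) else X t (snd z)) = ennreal (exp (s * K * (Max ((\<lambda>t. X t (fst z)) ` T)
            - Max ((\<lambda>t. cos h * X t (fst z) - sin h * X t (snd z)) ` T))))"
        by (simp only: f_def)
    qed
    also have "\<dots> \<le> ?R"
      using s by (intro rotation_step_mgf_bound[OF X T _ v]) auto
    finally show ?thesis .
  qed
  have "?L = (\<integral>\<^sup>+z. ennreal (exp (\<Sum>k<K. s * (F (Suc k) z - F k z))) \<partial>(M \<Otimes>\<^sub>M M))"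
    using sum_lessThan_telescope[of "\<lambda>k. F k z" K for z] by (simp only: sum_distrib_left[symmetric] F0 FK)
  also have "\<dots> \<le> (\<integral>\<^sup>+z. (\<Sum>k<K. ennreal (1 / K) * ennreal (exp (real K * (s * (F (Suc k) z - F k z))))) \<partial>(M \<Otimes>\<^sub>M M))"
  proof (rule nn_integral_mono)
    fix z
    have "exp (\<Sum>k<K. s * (F (Suc k) z - F k z)) \<le> (\<Sum>k<K. 1 / K * exp (real K * (s * (F (Suc k) z - F k z))))"
      using exp_mean_le_mean_exp[OF K, of "\<lambda>k. s * (F (Suc k) z - F k z)"] by (simp add: sum_divide_distrib)
    thus "ennreal (exp (\<Sum>k<K. s * (F (Suc k) z - F k z))) \<le> (\<Sum>k<K. ennreal (1 / K) * ennreal (exp (real K * (s * (F (Suc k) z - F k z)))))"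
      by (simp add: ennreal_mult'[symmetric] ennreal_leI)
  qed
  also have "\<dots> = (\<Sum>k<K. ennreal (1 / K) * (\<integral>\<^sup>+z. ennreal (exp (real K * (s * (F (Suc k) z - F k z)))) \<partial>(M \<Otimes>\<^sub>M M)))"
    by (simp add: nn_integral_sum nn_integral_cmult)
  also have "\<dots> \<le> (\<Sum>k<K. ennreal (1 / K) * ?R)"
    by (intro sum_mono mult_left_mono step) auto
  also have "\<dots> = ?R"
  proof -
    have "(\<Sum>k<K. ennreal (1 / K) * ?R) = (of_nat K * ennreal (1 / K)) * ?R" by (simp add: mult.assoc)
    also have "of_nat K * ennreal (1 / real K) = 1"
      using K by (simp add: ennreal_of_nat_eq_real_of_nat ennreal_mult'[symmetric])
    finally show ?thesis by simp
  qed
  finally show ?thesis .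
qed

text \<open>The limit of the discretised bound as the number of steps grows: \<open>K * sin h\<close> stays below \<open>pi / 2\<close>, while \<open>K * (1 - cos h)\<close>
tends to \<open>0\<close>, so that the factor containing the maximum itself tends to \<open>1\<close>. This is a difference form of
the Maurey--Pisier inequality.\<close>

lemma max_difference_mgf:
  fixes X :: "'t \<Rightarrow> 'a \<Rightarrow> real"
  assumes X: "centered_gaussian_field X" and T: "finite T" "T \<noteq> {}" and s: "0 \<le> s" and v0: "0 \<le> v"
    and v: "\<And>t. t \<in> T \<Longrightarrow> expectation (\<lambda>\<omega>. (X t \<omega>)\<^sup>2) \<le> v"
  shows "(\<integral>\<^sup>+z. ennreal (exp (s * (Max ((\<lambda>t. X t (fst z)) ` T) - Max ((\<lambda>t. X t (snd z)) ` T)))) \<partial>(M \<Otimes>\<^sub>M M))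
    \<le> ennreal (exp (s\<^sup>2 * pi\<^sup>2 * v / 8))" (is "?L \<le> _")
proof -
  note [measurable] = centered_gaussian_fieldD(3)[OF X] and [simp] = T(1)
  let ?m = "\<lambda>\<omega>. Max ((\<lambda>t. X t \<omega>) ` T)"
  have "(\<integral>\<^sup>+\<omega>. ennreal (exp (?m \<omega>)) \<partial>M) \<le> (\<integral>\<^sup>+\<omega>. (\<Sum>t\<in>T. ennreal (exp (1 * X t \<omega>))) \<partial>M)"
  proof (rule nn_integral_mono)
    fix \<omega>
    have "?m \<omega> \<in> (\<lambda>t. X t \<omega>) ` T" using T by (intro Max_in) auto
    then obtain t where t: "t \<in> T" "?m \<omega> = X t \<omega>" by auto
    show "ennreal (exp (?m \<omega>)) \<le> (\<Sum>t\<in>T. ennreal (exp (1 * X t \<omega>)))"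
      unfolding t(2) using member_le_sum[OF t(1), of "\<lambda>t. ennreal (exp (1 * X t \<omega>))"] by simp
  qed
  also have "\<dots> = (\<Sum>t\<in>T. \<integral>\<^sup>+\<omega>. ennreal (exp (1 * X t \<omega>)) \<partial>M)"
    by (rule nn_integral_sum) measurable
  also have "\<dots> = (\<Sum>t\<in>T. ennreal (exp (1\<^sup>2 * expectation (\<lambda>\<omega>. (X t \<omega>)\<^sup>2) / 2)))"
    by (intro sum.cong refl centered_gaussian_rv_mgf centered_gaussian_fieldD[OF X])
  finally have "(\<integral>\<^sup>+\<omega>. ennreal (exp (?m \<omega>)) \<partial>M) < top"
    by (auto simp: less_top[symmetric] top_unique)
  then obtain C where C: "(\<integral>\<^sup>+\<omega>. ennreal (exp (?m \<omega>)) \<partial>M) = ennreal C" "0 \<le> C"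
    by (cases "(\<integral>\<^sup>+\<omega>. ennreal (exp (?m \<omega>)) \<partial>M)") auto
  define c where "c K = s * pi\<^sup>2 / (8 * real K)" for K :: nat
  have c0: "c \<longlonglongrightarrow> 0" unfolding c_def by real_asymp
  have bound: "?L \<le> ennreal (exp (s\<^sup>2 * pi\<^sup>2 * v / 8) * (1 + c K * C))" if K: "0 < K" "c K \<le> 1" for K
  proof -
    define h where "h = pi / (2 * real K)"
    define d where "d = s * K * (1 - cos h)"
    have d0: "0 \<le> d" using s by (simp add: d_def)
    have "1 - cos h = 2 * (sin (h / 2))\<^sup>2" using cos_double_sin[of "h/2"] by simp
    also have "\<dots> \<le> 2 * (h / 2)\<^sup>2"
      using abs_le_square_iff[THEN iffD1, OF abs_sin_x_le_abs_x[of "h/2"]] by simp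
    finally have ch: "1 - cos h \<le> h\<^sup>2 / 2" by (simp add: power2_eq_square)
    have "d \<le> s * K * (h\<^sup>2 / 2)"
      unfolding d_def using s ch by (intro mult_left_mono) auto
    also have "\<dots> = c K" using K by (simp add: h_def c_def power2_eq_square field_simps)
    finally have dc: "d \<le> c K" .
    \<comment> \<open>convexity of \<open>exp\<close> between \<open>0\<close> and the maximum; valid for a maximum of either sign\<close>
    have "(\<integral>\<^sup>+\<omega>. ennreal (exp (d * ?m \<omega>)) \<partial>M) \<le> (\<integral>\<^sup>+\<omega>. 1 + ennreal d * ennreal (exp (?m \<omega>)) \<partial>M)"
    proof (rule nn_integral_mono)
      fix \<omega>
      have "convex_on UNIV (exp :: real \<Rightarrow> real)" by (rule exp_convex)
      hence "exp ((1 - d) *\<^sub>R 0 + d *\<^sub>R ?m \<omega>) \<le> (1 - d) * exp 0 + d * exp (?m \<omega>)"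
        using d0 dc K(2) by (intro convex_onD) auto
      also have "\<dots> \<le> 1 + d * exp (?m \<omega>)" using d0 by simp
      finally show "ennreal (exp (d * ?m \<omega>)) \<le> 1 + ennreal d * ennreal (exp (?m \<omega>))"
        using d0 by (simp add: ennreal_mult[symmetric] ennreal_plus[symmetric] del: ennreal_plus flip: ennreal_1)
    qed
    also have "\<dots> = 1 + ennreal d * ennreal C"
      by (simp add: nn_integral_add nn_integral_cmult C emeasure_space_1)
    also have "\<dots> = ennreal (1 + d * C)"
      using d0 C by (simp add: ennreal_mult ennreal_plus)
    also have "\<dots> \<le> ennreal (1 + c K * C)"
      using dc C by (intro ennreal_leI) (auto intro: mult_right_mono)
    finally have A: "(\<integral>\<^sup>+\<omega>. ennreal (exp (d * ?m \<omega>)) \<partial>M) \<le> ennreal (1 + c K * C)" .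
    have "0 \<le> h" by (simp add: h_def)
    hence "\<bar>sin h\<bar> \<le> h" using abs_sin_x_le_abs_x[of h] by simp
    hence "s * K * \<bar>sin h\<bar> \<le> s * K * h" using s by (intro mult_left_mono) auto
    hence "\<bar>s * K * sin h\<bar> \<le> s * K * h" using s by (simp add: abs_mult)
    also have "s * K * h = s * (pi / 2)" using K by (simp add: h_def)
    finally have "(s * K * sin h)\<^sup>2 \<le> (s * (pi / 2))\<^sup>2" by (metis abs_ge_zero power2_abs power_mono)
    hence "(s * K * sin h)\<^sup>2 * v / 2 \<le> (s * (pi / 2))\<^sup>2 * v / 2"
      using v0 by (intro divide_right_mono mult_right_mono) auto
    also have "\<dots> = s\<^sup>2 * pi\<^sup>2 * v / 8" by (simp add: power2_eq_square)
    finally have B: "exp ((s * K * sin h)\<^sup>2 * v / 2) \<le> exp (s\<^sup>2 * pi\<^sup>2 * v / 8)" by simp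
    have "?L \<le> ennreal (exp ((s * K * sin h)\<^sup>2 * v / 2)) * (\<integral>\<^sup>+\<omega>. ennreal (exp (d * ?m \<omega>)) \<partial>M)"
      unfolding d_def h_def by (rule max_difference_mgf_discretised[OF X T s K(1) v])
    also have "\<dots> \<le> ennreal (exp (s\<^sup>2 * pi\<^sup>2 * v / 8)) * ennreal (1 + c K * C)"
      by (intro mult_mono A ennreal_leI B) auto
    finally show ?thesis by (simp add: ennreal_mult'[symmetric])
  qed
  have ev: "\<forall>\<^sub>F K in sequentially. ?L \<le> ennreal (exp (s\<^sup>2 * pi\<^sup>2 * v / 8) * (1 + c K * C))"
    using eventually_gt_at_top[of "0::nat"] order_tendstoD(2)[OF c0 zero_less_one]
    by (eventually_elim) (auto intro!: bound)
  have "(\<lambda>K. ennreal (exp (s\<^sup>2 * pi\<^sup>2 * v / 8) * (1 + c K * C))) \<longlonglongrightarrow> ennreal (exp (s\<^sup>2 * pi\<^sup>2 * v / 8) * (1 + 0 * C))"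
    by (intro tendsto_intros c0 tendsto_ennrealI)
  hence "?L \<le> ennreal (exp (s\<^sup>2 * pi\<^sup>2 * v / 8) * (1 + 0 * C))"
    by (rule tendsto_lowerbound[OF _ ev]) simp
  thus ?thesis by simp
qed

text \<open>If the first copy has maximum at least \<open>a\<close> and the second one at most \<open>b\<close>, then the difference of maxima is at least \<open>a - b\<close>;
the two events are independent, and an exponential Markov inequality finishes the argument.\<close>

lemma gaussian_max_concentration_finite:
  fixes X :: "'t \<Rightarrow> 'a \<Rightarrow> real"
  assumes X: "centered_gaussian_field X" and T: "finite T" and v0: "0 < v"
    and v: "\<And>t. t \<in> T \<Longrightarrow> expectation (\<lambda>\<omega>. (X t \<omega>)\<^sup>2) \<le> v" and ab: "b \<le> a"
  shows "prob {\<omega> \<in> space M. \<exists>t\<in>T. a \<le> X t \<omega>} * prob {\<omega> \<in> space M. \<forall>t\<in>T. X t \<omega> \<le> b}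
    \<le> exp (- 2 * (a - b)\<^sup>2 / (pi\<^sup>2 * v))"
proof (cases "T = {}")
  case True thus ?thesis by simp
next
  case False
  note [measurable] = centered_gaussian_fieldD(3)[OF X] and [simp] = T
  let ?m = "\<lambda>\<omega>. Max ((\<lambda>t. X t \<omega>) ` T)"
  define A where "A = {\<omega> \<in> space M. \<exists>t\<in>T. a \<le> X t \<omega>}"
  define B where "B = {\<omega> \<in> space M. \<forall>t\<in>T. X t \<omega> \<le> b}"
  have [measurable]: "A \<in> sets M" "B \<in> sets M" unfolding A_def B_def by measurable
  \<comment> \<open>the minimiser of \<open>s\<^sup>2 * pi\<^sup>2 * v / 8 - s * (a - b)\<close>\<close>
  define s where "s = 4 * (a - b) / (pi\<^sup>2 * v)"
  have s: "0 \<le> s" using ab v0 by (simp add: s_def)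
  have "ennreal (exp (s * (a - b))) * (emeasure M A * emeasure M B) = (\<integral>\<^sup>+z. ennreal (exp (s * (a - b))) * indicator (A \<times> B) z \<partial>(M \<Otimes>\<^sub>M M))"
    by (subst nn_integral_cmult_indicator) (auto simp: emeasure_pair_measure_Times)
  also have "\<dots> \<le> (\<integral>\<^sup>+z. ennreal (exp (s * (?m (fst z) - ?m (snd z)))) \<partial>(M \<Otimes>\<^sub>M M))"
  proof (rule nn_integral_mono)
    fix z
    show "ennreal (exp (s * (a - b))) * indicator (A \<times> B) z \<le> ennreal (exp (s * (?m (fst z) - ?m (snd z))))"
    proof (cases "z \<in> A \<times> B")
      case True
      hence "a \<le> ?m (fst z)" "?m (snd z) \<le> b"
        using False by (auto simp: A_def B_def Max_ge_iff)
      thus ?thesis using True s by (auto intro!: mult_left_mono)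
    qed simp
  qed
  also have "\<dots> \<le> ennreal (exp (s\<^sup>2 * pi\<^sup>2 * v / 8))"
    using v0 by (intro max_difference_mgf[OF X T False s _ v]) auto
  finally have "exp (s * (a - b)) * (prob A * prob B) \<le> exp (s\<^sup>2 * pi\<^sup>2 * v / 8)"
    by (simp add: emeasure_eq_measure ennreal_mult'[symmetric])
  hence "prob A * prob B \<le> exp (s\<^sup>2 * pi\<^sup>2 * v / 8 - s * (a - b))"
    unfolding exp_diff by (simp add: pos_le_divide_eq mult_ac)
  also have "s\<^sup>2 * pi\<^sup>2 * v / 8 - s * (a - b) = - 2 * (a - b)\<^sup>2 / (pi\<^sup>2 * v)"
    using v0 by (simp add: s_def field_simps power2_eq_square)
  finally show ?thesis by (simp add: A_def B_def)
qed

text \<open>The product form turns a lower bound on either probability, however weak, into an upper bound on the other one. The upper bound for the dimension uses it in one direction and the lower bound in the other.\<close>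

lemma gaussian_max_concentration:
  fixes X :: "'t \<Rightarrow> 'a \<Rightarrow> real"
  assumes X: "centered_gaussian_field X" and D: "countable D" and v0: "0 < v"
    and v: "\<And>t. t \<in> D \<Longrightarrow> expectation (\<lambda>\<omega>. (X t \<omega>)\<^sup>2) \<le> v" and ab: "b \<le> a"
  shows "prob {\<omega> \<in> space M. \<exists>t\<in>D. a \<le> X t \<omega>} * prob {\<omega> \<in> space M. \<forall>t\<in>D. X t \<omega> \<le> b}
    \<le> exp (- 2 * (a - b)\<^sup>2 / (pi\<^sup>2 * v))"
proof (cases "D = {}")
  case True thus ?thesis by simp
next
  case False
  note [measurable] = centered_gaussian_fieldD(3)[OF X] and [simp] = D
  define T where "T n = from_nat_into D ` {..n}" for n :: nat
  have TD: "T n \<subseteq> D" for n using from_nat_into[OF False] by (auto simp: T_def)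
  have UT: "(\<Union>n. T n) = D"
  proof (intro equalityI subsetI)
    fix t assume "t \<in> D"
    hence "t = from_nat_into D (to_nat_on D t)" using D by simp
    thus "t \<in> (\<Union>n. T n)" by (auto simp: T_def)
  qed (use TD in auto)
  let ?A = "\<lambda>D. {\<omega> \<in> space M. \<exists>t\<in>D. a \<le> X t \<omega>}" and ?B = "\<lambda>D. {\<omega> \<in> space M. \<forall>t\<in>D. X t \<omega> \<le> b}"
  have [measurable]: "?A D \<in> sets M" "?B D \<in> sets M" if "countable D" for D using that by measurable
  have "(\<lambda>n. prob (?A (T n))) \<longlonglongrightarrow> prob (\<Union>n. ?A (T n))"
    by (intro finite_Lim_measure_incseq) (auto simp: incseq_def T_def intro!: countable_finite)
  also have "(\<Union>n. ?A (T n)) = ?A D" unfolding UT[symmetric] by blast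
  finally have L: "(\<lambda>n. prob (?A (T n)) * prob (?B D)) \<longlonglongrightarrow> prob (?A D) * prob (?B D)"
    by (intro tendsto_intros)
  show ?thesis
  proof (rule LIMSEQ_le_const2[OF L], intro exI allI impI)
    fix n :: nat
    have "prob (?B D) \<le> prob (?B (T n))"
      using TD[of n] by (intro finite_measure_mono) (auto simp: T_def intro!: countable_finite)
    hence "prob (?A (T n)) * prob (?B D) \<le> prob (?A (T n)) * prob (?B (T n))"
      by (intro mult_left_mono) auto
    also have "\<dots> \<le> exp (- 2 * (a - b)\<^sup>2 / (pi\<^sup>2 * v))"
      using TD[of n] by (intro gaussian_max_concentration_finite[OF X _ v0 v ab]) (auto simp: T_def)
    finally show "prob (?A (T n)) * prob (?B D) \<le> exp (- 2 * (a - b)\<^sup>2 / (pi\<^sup>2 * v))" .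
  qed
qed

end

section \<open>Coverings of the shells by cubes\<close>

lemma interval_unit_cover:
  fixes u w :: real
  assumes "1 \<le> w"
  obtains A where "finite A" "real (card A) \<le> w + 1" "\<And>a. a \<in> A \<Longrightarrow> u \<le> a \<and> a + 1 \<le> u + w"
    "\<And>y. u \<le> y \<Longrightarrow> y < u + w \<Longrightarrow> \<exists>a\<in>A. a \<le> y \<and> y < a + 1"
proof -
  \<comment> \<open>consecutive unit intervals, the last one pushed back so that it ends at \<open>u + w\<close>\<close>
  define A where "A = (\<lambda>k. min (u + real k) (u + w - 1)) ` {..<nat \<lceil>w\<rceil>}"
  show ?thesis
  proof (rule that[of A])
    show "finite A" by (simp add: A_def)
    have "card A \<le> nat \<lceil>w\<rceil>" unfolding A_def using card_image_le[of "{..<nat \<lceil>w\<rceil>}"] by simp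
    thus "real (card A) \<le> w + 1" using assms by linarith
    show "u \<le> a \<and> a + 1 \<le> u + w" if "a \<in> A" for a using that assms by (auto simp: A_def)
    fix y assume y: "u \<le> y" "y < u + w"
    define k where "k = nat \<lfloor>y - u\<rfloor>"
    have k: "real k \<le> y - u" "y - u < real k + 1" using y by (auto simp: k_def)
    have "k < nat \<lceil>w\<rceil>" using k(1) y(2) by linarith
    thus "\<exists>a\<in>A. a \<le> y \<and> y < a + 1"
      using k y by (intro bexI[of _ "min (u + real k) (u + w - 1)"]) (auto simp: A_def)
  qed
qed

lemma exp_Suc_minus_exp_ge_1: "exp (real (Suc n)) - exp (real n) \<ge> 1"
proof -
  have "exp (real (Suc n)) = exp 1 * exp (real n)" by (simp add: exp_add[symmetric] add.commute)
  moreover have "exp 1 \<ge> (2::real)" using exp_ge_add_one_self[of 1] by simp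
  ultimately have "exp (real (Suc n)) \<ge> 2 * exp (real n)" by (simp add: mult_right_mono)
  moreover have "exp (real n) \<ge> 1" by simp
  ultimately show ?thesis by linarith
qed

lemma macro_S_norm_ge:
  fixes y :: "real ^ 'd"
  assumes "y \<in> macro_S (Suc n)"
  shows "exp (real n) \<le> norm y"
proof -
  obtain i where "\<not> (- exp (real n) \<le> y $ i \<and> y $ i < exp (real n))"
    using assms by (auto simp: macro_V_def)
  hence "exp (real n) \<le> \<bar>y $ i\<bar>" by auto
  also have "\<dots> \<le> norm y" by (rule component_le_norm_cart)
  finally show ?thesis .
qed

lemma card_vec:
  fixes A :: "'d::finite \<Rightarrow> 'b set"
  assumes "\<And>i. finite (A i)"
  shows "finite {x :: 'b ^ 'd. \<forall>i. x $ i \<in> A i}" "card {x :: 'b ^ 'd. \<forall>i. x $ i \<in> A i} = (\<Prod>i\<in>UNIV. card (A i))"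
proof -
  have eq: "{x :: 'b ^ 'd. \<forall>i. x $ i \<in> A i} = vec_lambda ` Pi\<^sub>E UNIV A"
  proof (intro equalityI subsetI)
    fix x :: "'b ^ 'd" assume "x \<in> {x. \<forall>i. x $ i \<in> A i}"
    thus "x \<in> vec_lambda ` Pi\<^sub>E UNIV A" by (intro image_eqI[of _ _ "\<lambda>i. x $ i"]) auto
  qed auto
  have inj: "inj_on vec_lambda (Pi\<^sub>E UNIV A)" by (auto simp: inj_on_def vec_lambda_inject)
  have fin: "finite (Pi\<^sub>E UNIV A)" using assms by (intro finite_PiE) auto
  show "finite {x :: 'b ^ 'd. \<forall>i. x $ i \<in> A i}" unfolding eq using fin by simp
  show "card {x :: 'b ^ 'd. \<forall>i. x $ i \<in> A i} = (\<Prod>i\<in>UNIV. card (A i))"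
    unfolding eq card_image[OF inj] by (rule card_PiE) simp
qed

text \<open>Each coordinate axis is cut at the four points \<open>\<plusminus> exp n\<close> and \<open>\<plusminus> exp (n + 1)\<close>, and the three resulting intervals are covered by
unit intervals that do not cross the cuts. A product of such intervals lies in the shell as soon as one factor is outside
the middle interval.\<close>

lemma shell_unit_cover:
  obtains X :: "(real ^ 'd) set" where "finite X" "real (card X) \<le> (5 * exp (real (Suc n))) ^ CARD('d)"
    "\<And>x. x \<in> X \<Longrightarrow> half_open_cube x 1 \<subseteq> macro_S (Suc n)" "macro_S (Suc n) \<subseteq> (\<Union>x\<in>X. half_open_cube x 1)"
proof -
  define b where "b = exp (real (Suc n))"
  define a where "a = exp (real n)"
  have ab: "1 \<le> a" "1 \<le> b - a" using exp_Suc_minus_exp_ge_1[of n] by (auto simp: a_def b_def)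
  have mid1: "1 \<le> 2 * a" using ab by simp
  obtain A1 where A1: "finite A1" "real (card A1) \<le> (b - a) + 1" "\<And>x. x \<in> A1 \<Longrightarrow> -b \<le> x \<and> x + 1 \<le> -b + (b - a)"
    "\<And>y. -b \<le> y \<Longrightarrow> y < -b + (b - a) \<Longrightarrow> \<exists>x\<in>A1. x \<le> y \<and> y < x + 1"
    using interval_unit_cover[OF ab(2), of "-b"] by metis
  obtain A2 where A2: "finite A2" "real (card A2) \<le> 2 * a + 1" "\<And>x. x \<in> A2 \<Longrightarrow> -a \<le> x \<and> x + 1 \<le> -a + 2 * a"
    "\<And>y. -a \<le> y \<Longrightarrow> y < -a + 2 * a \<Longrightarrow> \<exists>x\<in>A2. x \<le> y \<and> y < x + 1"
    using interval_unit_cover[OF mid1, of "-a"] by metis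
  obtain A3 where A3: "finite A3" "real (card A3) \<le> (b - a) + 1" "\<And>x. x \<in> A3 \<Longrightarrow> a \<le> x \<and> x + 1 \<le> a + (b - a)"
    "\<And>y. a \<le> y \<Longrightarrow> y < a + (b - a) \<Longrightarrow> \<exists>x\<in>A3. x \<le> y \<and> y < x + 1"
    using interval_unit_cover[OF ab(2), of a] by metis
  define A where "A = A1 \<union> A2 \<union> A3"
  have finA: "finite A" using A1 A2 A3 by (simp add: A_def)
  have "card A \<le> card A1 + card A2 + card A3"
    unfolding A_def using card_Un_le[of "A1 \<union> A2" A3] card_Un_le[of A1 A2] by linarith
  hence cardA: "real (card A) \<le> 5 * b" using A1(2) A2(2) A3(2) ab by linarith
  have inV: "-b \<le> x \<and> x + 1 \<le> b" if "x \<in> A" for x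
    using that A1(3) A2(3) A3(3) ab unfolding A_def by force
  have cov: "\<exists>x\<in>A. x \<le> y \<and> y < x + 1 \<and> (\<not> (-a \<le> y \<and> y < a) \<longrightarrow> x + 1 \<le> -a \<or> a \<le> x)"
    if y: "-b \<le> y" "y < b" for y
  proof -
    consider "y < -a" | "-a \<le> y" "y < a" | "a \<le> y" by linarith
    thus ?thesis
    proof cases
      case 1
      then obtain x where x: "x \<in> A1" "x \<le> y" "y < x + 1" using A1(4)[of y] y by auto
      with A1(3)[OF x(1)] show ?thesis by (intro bexI[of _ x]) (auto simp: A_def)
    next
      case 2
      then obtain x where x: "x \<in> A2" "x \<le> y" "y < x + 1" using A2(4)[of y] y by auto
      with 2 show ?thesis by (intro bexI[of _ x]) (auto simp: A_def)
    next
      case 3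
      then obtain x where x: "x \<in> A3" "x \<le> y" "y < x + 1" using A3(4)[of y] y by auto
      with A3(3)[OF x(1)] show ?thesis by (intro bexI[of _ x]) (auto simp: A_def)
    qed
  qed
  define X0 where "X0 = {x :: real ^ 'd. \<forall>i. x $ i \<in> A}"
  define X where "X = {x \<in> X0. half_open_cube x 1 \<subseteq> macro_S (Suc n)}"
  have finX0: "finite X0" and cX0: "card X0 \<le> card A ^ CARD('d)"
    using card_vec[where 'd = 'd and A = "\<lambda>_. A"] finA by (auto simp: X0_def)
  show ?thesis
  proof (rule that[of X])
    show "finite X" using finX0 by (simp add: X_def)
    have "card X \<le> card X0" using finX0 by (intro card_mono) (auto simp: X_def)
    hence "real (card X) \<le> real (card A ^ CARD('d))" using cX0 by linarith
    also have "\<dots> = real (card A) ^ CARD('d)" by simp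
    also have "\<dots> \<le> (5 * b) ^ CARD('d)" using cardA by (intro power_mono) auto
    finally show "real (card X) \<le> (5 * exp (real (Suc n))) ^ CARD('d)" by (simp add: b_def)
    show "\<And>x. x \<in> X \<Longrightarrow> half_open_cube x 1 \<subseteq> macro_S (Suc n)" by (simp add: X_def)
    show "macro_S (Suc n) \<subseteq> (\<Union>x\<in>X. half_open_cube x 1)"
    proof
      fix y :: "real ^ 'd" assume y: "y \<in> macro_S (Suc n)"
      hence yV: "-b \<le> y $ i" "y $ i < b" for i by (auto simp: macro_V_def b_def)
      obtain j where j: "\<not> (-a \<le> y $ j \<and> y $ j < a)" using y by (auto simp: macro_V_def a_def)
      obtain f where f: "\<And>i. f i \<in> A \<and> f i \<le> y $ i \<and> y $ i < f i + 1 \<and> (\<not> (-a \<le> y $ i \<and> y $ i < a) \<longrightarrow> f i + 1 \<le> -a \<or> a \<le> f i)"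
        using cov[OF yV] by metis
      define x where "x = (\<chi> i. f i)"
      have yx: "y \<in> half_open_cube x 1" using f by (auto simp: half_open_cube_def x_def)
      have "half_open_cube x 1 \<subseteq> macro_S (Suc n)"
      proof
        fix z assume z: "z \<in> half_open_cube x 1"
        hence z': "f i \<le> z $ i" "z $ i < f i + 1" for i by (auto simp: half_open_cube_def x_def)
        have "-b \<le> z $ i \<and> z $ i < b" for i using z'[of i] f[of i] inV[of "f i"] by linarith
        moreover have "\<not> (-a \<le> z $ j \<and> z $ j < a)" using f[of j] j z'[of j] by linarith
        ultimately show "z \<in> macro_S (Suc n)" by (auto simp: macro_V_def a_def b_def simp del: of_nat_Suc)
      qed
      hence "x \<in> X" using f by (auto simp: X_def X0_def x_def)
      thus "y \<in> (\<Union>x\<in>X. half_open_cube x 1)" using yx by blast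
    qed
  qed
qed

lemma macro_nu_le_unit_cover:
  fixes E :: "(real ^ 'd) set"
  assumes X: "finite X" "\<And>x. x \<in> X \<Longrightarrow> half_open_cube x 1 \<subseteq> macro_S n"
    and E: "E \<inter> macro_S n \<subseteq> (\<Union>x\<in>X. half_open_cube x 1)"
  shows "macro_nu \<rho> n E \<le> (\<Sum>x\<in>X. ennreal (exp (- real n * \<rho>)))"
proof -
  obtain f where f: "bij_betw f {..<card X} X"
    using ex_bij_betw_nat_finite[OF X(1)] by (auto simp: atLeast0LessThan)
  have "macro_nu \<rho> n E \<le> (\<Sum>i<card X. ennreal ((1 / exp (real n)) powr \<rho>))"
    unfolding macro_nu_def
  proof (rule Inf_lower, rule CollectI, intro exI conjI)
    show "(\<Sum>i<card X. ennreal ((1 / exp (real n)) powr \<rho>)) = (\<Sum>i<card X. ennreal (((\<lambda>_. 1) i / exp (real n)) powr \<rho>))"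
      by simp
    show "\<forall>i<card X. 1 \<le> (1::real) \<and> half_open_cube (f i) 1 \<subseteq> macro_S n"
      using X(2) f by (auto simp: bij_betw_def)
    show "E \<inter> macro_S n \<subseteq> (\<Union>i<card X. half_open_cube (f i) 1)"
    proof
      fix y assume "y \<in> E \<inter> macro_S n"
      then obtain x where x: "x \<in> X" "y \<in> half_open_cube x 1" using E by blast
      then obtain i where "i < card X" "x = f i" using f by (auto simp: bij_betw_def)
      thus "y \<in> (\<Union>i<card X. half_open_cube (f i) 1)" using x by blast
    qed
  qed
  also have "(1 / exp (real n)) powr \<rho> = exp (- real n * \<rho>)"
    by (simp add: powr_def ln_div)
  finally show ?thesis by simp
qed

lemma card_nat_open_interval_le:
  fixes a b :: real
  assumes "a \<le> b"
  shows "finite {j::nat. a < real j \<and> real j < b}" "real (card {j::nat. a < real j \<and> real j < b}) \<le> b - a + 1"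
proof -
  let ?S = "{j::nat. a < real j \<and> real j < b}"
  have sub: "int ` ?S \<subseteq> {\<lfloor>a\<rfloor> + 1..\<lceil>b\<rceil> - 1}"
    by (auto; linarith)
  hence fin: "finite (int ` ?S)" by (rule finite_subset) simp
  thus "finite ?S" by (rule finite_imageD) (auto simp: inj_on_def)
  have "card ?S = card (int ` ?S)" by (intro card_image[symmetric]) (auto simp: inj_on_def)
  also have "\<dots> \<le> card {\<lfloor>a\<rfloor> + 1..\<lceil>b\<rceil> - 1}" using sub by (intro card_mono) auto
  also have "\<dots> = nat (\<lceil>b\<rceil> - 1 - \<lfloor>a\<rfloor>)" by simp
  finally show "real (card ?S) \<le> b - a + 1" using assms by linarith
qed

text \<open>The points \<open>p k\<close> are representatives of the cells of a grid with mesh \<open>L\<close>, so this counts the cells whose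
representative is caught by a cube of side \<open>r\<close>.\<close>

lemma card_grid_cells_meeting_cube:
  fixes p :: "(nat ^ 'd) \<Rightarrow> real ^ 'd" and L r u :: real
  assumes L: "0 < L" and r: "0 \<le> r"
    and p: "\<And>k i. k \<in> G \<Longrightarrow> u + real (k $ i) * L \<le> p k $ i \<and> p k $ i < u + (real (k $ i) + 1) * L"
  shows "real (card {k \<in> G. p k \<in> half_open_cube x r}) \<le> (r / L + 2) ^ CARD('d)"
proof -
  define A where "A i = {j::nat. (x $ i - u) / L - 1 < real j \<and> real j < (x $ i - u + r) / L}" for i
  have le: "(x $ i - u) / L - 1 \<le> (x $ i - u + r) / L" for i
    using L r by (simp add: field_simps)
  have finA: "finite (A i)" for i unfolding A_def by (rule card_nat_open_interval_le[OF le])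
  have cA: "real (card (A i)) \<le> r / L + 2" for i
    using card_nat_open_interval_le(2)[OF le[of i]] by (simp add: A_def add_divide_distrib)
  have sub: "{k \<in> G. p k \<in> half_open_cube x r} \<subseteq> {k. \<forall>i. k $ i \<in> A i}"
  proof safe
    fix k i assume k: "k \<in> G" "p k \<in> half_open_cube x r"
    have "x $ i \<le> p k $ i" "p k $ i < x $ i + r" using k(2) by (auto simp: half_open_cube_def)
    hence "x $ i - u < (real (k $ i) + 1) * L" "real (k $ i) * L < x $ i - u + r" using p[OF k(1), of i] by linarith+
    thus "k $ i \<in> A i" using L by (auto simp: A_def field_simps)
  qed
  have "card {k \<in> G. p k \<in> half_open_cube x r} \<le> card {k. \<forall>i. k $ i \<in> A i}"
    using sub card_vec(1)[of A, OF finA] by (rule card_mono[rotated])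
  also have "\<dots> = (\<Prod>i\<in>UNIV. card (A i))" by (rule card_vec(2)[OF finA])
  finally have "real (card {k \<in> G. p k \<in> half_open_cube x r}) \<le> real (\<Prod>i\<in>UNIV. card (A i))" by linarith
  also have "\<dots> = (\<Prod>i\<in>UNIV. real (card (A i)))" by simp
  also have "\<dots> \<le> (\<Prod>i\<in>(UNIV::'d set). r / L + 2)" using cA by (intro prod_mono) auto
  finally show "real (card {k \<in> G. p k \<in> half_open_cube x r}) \<le> (r / L + 2) ^ CARD('d)" by simp
qed

lemma cube_side_le:
  fixes x :: "real ^ 'd"
  assumes "half_open_cube x r \<subseteq> macro_S n" "0 < r"
  shows "r \<le> 2 * exp (real n)"
proof (rule ccontr)
  assume *: "\<not> ?thesis"
  have V: "macro_S n \<subseteq> (macro_V n :: (real ^ 'd) set)" by (cases n) auto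
  have "x \<in> half_open_cube x r" using assms(2) by (simp add: half_open_cube_def)
  hence 1: "- exp (real n) \<le> x $ i" for i using assms(1) V by (auto simp: macro_V_def)
  have "(\<chi> i. x $ i + 2 * exp (real n)) \<in> half_open_cube x r" using * by (simp add: half_open_cube_def)
  hence "x $ i + 2 * exp (real n) < exp (real n)" for i using assms(1) V by (auto simp: macro_V_def subset_iff)
  from this[of undefined] 1[of undefined] show False using exp_gt_zero[of "real n"] by linarith
qed

text \<open>A mass distribution argument with the uniform measure on representatives of the occupied cells \<open>G\<close>. A cube of side
\<open>r \<le> L\<close> catches boundedly many of them, a larger one of the order of \<open>(r / L) ^ d\<close>; by \<open>LR\<close> in the first case and
\<open>\<rho> \<le> d\<close> in the second, \<open>(r / exp n) powr \<rho>\<close> pays for that number, in units of the total number of cells. The constant \<open>6\<close> absorbs the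
boundary effects and the fact that cubes in the shell may have side up to \<open>2 * exp n\<close>.\<close>

lemma macro_nu_ge_grid_count:
  fixes E :: "(real ^ 'd) set" and p :: "(nat ^ 'd) \<Rightarrow> real ^ 'd"
  assumes L: "1 \<le> L" and rho: "0 < \<rho>" "\<rho> \<le> real CARD('d)" and LR: "exp (real n * \<rho>) \<le> (exp (real n) / L) ^ CARD('d)"
    and G: "finite G" "\<And>k. k \<in> G \<Longrightarrow> p k \<in> E \<inter> macro_S n"
      "\<And>k i. k \<in> G \<Longrightarrow> u + real (k $ i) * L \<le> p k $ i \<and> p k $ i < u + (real (k $ i) + 1) * L"
  shows "ennreal (real (card G) / (6 * exp (real n) / L) ^ CARD('d)) \<le> macro_nu \<rho> n E"
  unfolding macro_nu_def
proof (rule Inf_greatest, clarify)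
  fix m :: nat and x :: "nat \<Rightarrow> real ^ 'd" and r :: "nat \<Rightarrow> real"
  assume r: "\<forall>i<m. 1 \<le> r i \<and> half_open_cube (x i) (r i) \<subseteq> macro_S n"
    and cov: "E \<inter> macro_S n \<subseteq> (\<Union>i<m. half_open_cube (x i) (r i))"
  let ?d = "CARD('d)"
  define N where "N = exp (real n)"
  have N: "0 < N" by (simp add: N_def)
  have each: "(r i / L + 2) ^ ?d \<le> (6 * N / L) ^ ?d * (r i / N) powr \<rho>" if i: "i < m" for i
  proof -
    have r1: "1 \<le> r i" and sub: "half_open_cube (x i) (r i) \<subseteq> macro_S n" using r i by auto
    have r2: "r i \<le> 2 * N" unfolding N_def using cube_side_le[OF sub] r1 by simp
    define q where "q = r i / N"
    have q: "0 < q" "q \<le> 2" using r1 r2 N by (auto simp: q_def field_simps)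
    show ?thesis
    proof (cases "r i \<le> L")
      case True
      have "(r i / L + 2) ^ ?d \<le> 3 ^ ?d" using True r1 L by (intro power_mono) (auto simp: field_simps)
      also have "\<dots> \<le> 6 ^ ?d * (r i) powr \<rho>"
      proof -
        have "(3::real) ^ ?d * 1 \<le> 6 ^ ?d * (r i) powr \<rho>"
          using r1 rho by (intro mult_mono power_mono ge_one_powr_ge_zero) auto
        thus ?thesis by simp
      qed
      also have "(r i) powr \<rho> = exp (real n * \<rho>) * (r i / N) powr \<rho>"
        using r1 by (simp add: powr_def N_def ln_div exp_add[symmetric] algebra_simps)
      also have "6 ^ ?d * (exp (real n * \<rho>) * (r i / N) powr \<rho>) \<le> 6 ^ ?d * ((N / L) ^ ?d * (r i / N) powr \<rho>)"
        using LR unfolding N_def by (intro mult_left_mono mult_right_mono) auto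
      finally show ?thesis by (simp add: power_mult_distrib power_divide)
    next
      case False
      have "q ^ ?d \<le> 2 ^ ?d * q powr \<rho>"
      proof (cases "q \<le> 1")
        case True
        have "q ^ ?d = q powr (real ?d)" using q by (simp add: powr_realpow)
        also have "\<dots> \<le> q powr \<rho>" using q True rho by (intro powr_mono') auto
        also have "\<dots> = 1 * q powr \<rho>" by simp
        also have "\<dots> \<le> 2 ^ ?d * q powr \<rho>" by (intro mult_right_mono) auto
        finally show ?thesis .
      next
        case False
        have "q ^ ?d * 1 \<le> 2 ^ ?d * q powr \<rho>"
          using q False rho by (intro mult_mono power_mono ge_one_powr_ge_zero) auto
        thus ?thesis by simp
      qed
      have "(r i / L + 2) ^ ?d \<le> (3 * (r i / L)) ^ ?d" using False r1 L by (intro power_mono) (auto simp: field_simps)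
      also have "\<dots> = (3 * N / L) ^ ?d * q ^ ?d" using N by (simp add: q_def power_mult_distrib[symmetric])
      also have "\<dots> \<le> (3 * N / L) ^ ?d * (2 ^ ?d * q powr \<rho>)"
        using \<open>q ^ ?d \<le> 2 ^ ?d * q powr \<rho>\<close> N L by (intro mult_left_mono) auto
      also have "\<dots> = (6 * N / L) ^ ?d * q powr \<rho>"
        by (simp add: mult.assoc[symmetric] power_mult_distrib[symmetric])
      finally show ?thesis by (simp add: q_def)
    qed
  qed
  have "G \<subseteq> (\<Union>i<m. {k \<in> G. p k \<in> half_open_cube (x i) (r i)})" using G(2) cov by fastforce
  hence "card G \<le> card (\<Union>i<m. {k \<in> G. p k \<in> half_open_cube (x i) (r i)})"
    using G(1) by (intro card_mono) auto
  also have "\<dots> \<le> (\<Sum>i<m. card {k \<in> G. p k \<in> half_open_cube (x i) (r i)})" by (rule card_UN_le) simp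
  finally have "real (card G) \<le> (\<Sum>i<m. real (card {k \<in> G. p k \<in> half_open_cube (x i) (r i)}))"
    unfolding of_nat_sum[symmetric] by (rule of_nat_mono)
  also have "\<dots> \<le> (\<Sum>i<m. (r i / L + 2) ^ ?d)"
    using r L by (intro sum_mono card_grid_cells_meeting_cube[OF _ _ G(3)]) force+
  also have "\<dots> \<le> (\<Sum>i<m. (6 * N / L) ^ ?d * (r i / N) powr \<rho>)" by (intro sum_mono each) auto
  also have "\<dots> = (6 * N / L) ^ ?d * (\<Sum>i<m. (r i / N) powr \<rho>)" by (simp add: sum_distrib_left)
  finally have "real (card G) / (6 * N / L) ^ ?d \<le> (\<Sum>i<m. (r i / N) powr \<rho>)"
    using N L by (simp add: pos_divide_le_eq mult.commute)
  thus "ennreal (real (card G) / (6 * exp (real n) / L) ^ ?d) \<le> (\<Sum>i<m. ennreal ((r i / exp (real n)) powr \<rho>))"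
    unfolding N_def by (subst sum_ennreal) (auto intro: ennreal_leI)
qed

section \<open>The field on bounded sets and the upper bound for the content\<close>

text \<open>The setting of the theorem with the correlation hypothesis written as a covariance.\<close>

locale decorrelating_gaussian_field = prob_space M for M :: "'w measure" +
  fixes Z :: "real ^ 'd \<Rightarrow> 'w \<Rightarrow> real" and \<rho> :: "real \<Rightarrow> real"
  assumes gaussian: "centered_gaussian_field Z"
    and paths: "AE \<omega> in M. continuous_on UNIV (\<lambda>t. Z t \<omega>)"
    and stationary: "stationary_field Z"
    and cov: "expectation (\<lambda>\<omega>. Z t \<omega> * Z s \<omega>) = \<rho> (norm (t - s))"
    and rho_0: "\<rho> 0 = 1"
    and rho_mono: "0 \<le> r \<Longrightarrow> r \<le> r' \<Longrightarrow> \<rho> r' \<le> \<rho> r"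
    and rho_lim: "(\<rho> \<longlongrightarrow> 0) at_top"
begin

lemma Z_measurable[measurable]: "Z t \<in> borel_measurable M"
  by (rule centered_gaussian_fieldD(3)[OF gaussian])

lemma second_moment: "expectation (\<lambda>\<omega>. (Z t \<omega>)\<^sup>2) = 1"
  using cov[of t t] by (simp add: rho_0 power2_eq_square)

lemma linear_combination_second_moment:
  "expectation (\<lambda>\<omega>. (a * Z t \<omega> + b * Z s \<omega>)\<^sup>2) = a\<^sup>2 + b\<^sup>2 + 2 * a * b * \<rho> (norm (t - s))"
proof -
  have i: "integrable M (\<lambda>\<omega>. c * (Z u \<omega> * Z w \<omega>))" for c u w
    using centered_gaussian_field_integrable_mult[OF gaussian] by simp
  have "expectation (\<lambda>\<omega>. (a * Z t \<omega> + b * Z s \<omega>)\<^sup>2)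
      = expectation (\<lambda>\<omega>. a\<^sup>2 * (Z t \<omega> * Z t \<omega>) + (b\<^sup>2 * (Z s \<omega> * Z s \<omega>) + (2 * a * b) * (Z t \<omega> * Z s \<omega>)))"
    by (simp add: power2_eq_square algebra_simps)
  also have "\<dots> = a\<^sup>2 * \<rho> (norm (t - t)) + (b\<^sup>2 * \<rho> (norm (s - s)) + (2 * a * b) * \<rho> (norm (t - s)))"
    unfolding cov[symmetric] integral_mult_right_zero[symmetric]
    by (subst Bochner_Integration.integral_add[OF i Bochner_Integration.integrable_add[OF i i]])
       (subst Bochner_Integration.integral_add[OF i i], rule refl)
  finally show ?thesis by (simp add: rho_0)
qed

lemma increment_second_moment:
  "expectation (\<lambda>\<omega>. (Z t \<omega> - Z s \<omega>)\<^sup>2) = 2 * (1 - \<rho> (norm (t - s)))"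
  using linear_combination_second_moment[of 1 t "-1" s] by simp

text \<open>Along a sequence of points tending to \<open>0\<close>, the increments of \<open>Z\<close> tend to \<open>0\<close> almost surely, hence their characteristic
functions at \<open>1\<close>, which are \<open>exp (- (1 - \<rho> r))\<close>, tend to \<open>1\<close>. Monotonicity of \<open>\<rho>\<close> then covers the remaining radii.\<close>

lemma rho_continuous_at_0:
  assumes "0 < e"
  obtains \<delta> where "0 < \<delta>" "\<And>r. 0 \<le> r \<Longrightarrow> r < \<delta> \<Longrightarrow> 1 - \<rho> r < e"
proof -
  define u :: "nat \<Rightarrow> real ^ 'd" where "u n = (1 / real (Suc n)) *\<^sub>R axis undefined 1" for n
  have nu: "norm (u n) = 1 / real (Suc n)" for n by (simp add: u_def norm_axis_1)
  have "u \<longlonglongrightarrow> 0 *\<^sub>R axis undefined 1"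
    unfolding u_def by (rule tendsto_scaleR[OF LIMSEQ_Suc[OF lim_inverse_n'] tendsto_const])
  hence u0: "u \<longlonglongrightarrow> 0" by simp
  have inc: "centered_gaussian_field (\<lambda>t \<omega>. Z t \<omega> - Z 0 \<omega>)"
    by (rule centered_gaussian_field_diff[OF gaussian])
  have "(\<lambda>n. CLINT \<omega>|M. iexp (Z (u n) \<omega> - Z 0 \<omega>)) \<longlonglongrightarrow> (CLINT \<omega>|M. 1)"
  proof (rule integral_dominated_convergence[where w = "\<lambda>_. 1"])
    show "AE \<omega> in M. (\<lambda>n. iexp (Z (u n) \<omega> - Z 0 \<omega>)) \<longlonglongrightarrow> 1"
      using paths
    proof eventually_elim
      fix \<omega> assume c: "continuous_on UNIV (\<lambda>t. Z t \<omega>)"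
      have "isCont (\<lambda>t. Z t \<omega>) 0" using c by (simp add: continuous_on_eq_continuous_at)
      hence "(\<lambda>n. Z (u n) \<omega>) \<longlonglongrightarrow> Z 0 \<omega>" using u0 by (rule isCont_tendsto_compose)
      hence "(\<lambda>n. iexp (Z (u n) \<omega> - Z 0 \<omega>)) \<longlonglongrightarrow> iexp (Z 0 \<omega> - Z 0 \<omega>)" by (intro tendsto_intros)
      thus "(\<lambda>n. iexp (Z (u n) \<omega> - Z 0 \<omega>)) \<longlonglongrightarrow> 1" by simp
    qed
  qed auto
  moreover have "(CLINT \<omega>|M. iexp (Z (u n) \<omega> - Z 0 \<omega>)) = complex_of_real (exp (- (1 - \<rho> (1 / real (Suc n)))))" for n
    using centered_gaussian_rv_char[OF centered_gaussian_fieldD(1,2)[OF inc], of "u n"]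
    unfolding increment_second_moment by (simp add: nu exp_of_real[symmetric] diff_divide_distrib del: of_nat_Suc)
  ultimately have "(\<lambda>n. complex_of_real (exp (- (1 - \<rho> (1 / real (Suc n)))))) \<longlonglongrightarrow> complex_of_real 1"
    by (simp add: prob_space del: of_nat_Suc)
  hence "(\<lambda>n. exp (- (1 - \<rho> (1 / real (Suc n))))) \<longlonglongrightarrow> 1" unfolding tendsto_of_real_iff .
  hence "\<forall>\<^sub>F n in sequentially. exp (- e) < exp (- (1 - \<rho> (1 / real (Suc n))))"
    by (rule order_tendstoD(1)) (use assms in simp)
  then obtain n where "exp (- e) < exp (- (1 - \<rho> (1 / real (Suc n))))"
    by (auto simp: eventually_sequentially)
  hence n: "1 - \<rho> (1 / real (Suc n)) < e" by simp
  show ?thesis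
  proof (rule that[of "1 / real (Suc n)"])
    fix r assume "0 \<le> r" "r < 1 / real (Suc n)"
    thus "1 - \<rho> r < e" using rho_mono[of r "1 / real (Suc n)"] n by linarith
  qed simp
qed

text \<open>Continuous paths are bounded on bounded sets; one value of \<open>b\<close> works on half of the probability space. This crude
information is all that the concentration inequality asks for.\<close>

lemma bounded_increments_probable:
  assumes D: "countable D" "bounded D"
  obtains b where "0 \<le> b" "1 / 2 \<le> prob {\<omega> \<in> space M. \<forall>t\<in>D. Z t \<omega> - Z c \<omega> \<le> b}"
proof -
  note [simp] = D(1)
  define A where "A n = {\<omega> \<in> space M. \<forall>t\<in>D. Z t \<omega> - Z c \<omega> \<le> real n}" for n
  have AM[measurable]: "A n \<in> sets M" for n unfolding A_def by measurable
  have "AE \<omega> in M. \<omega> \<in> (\<Union>n. A n)"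
    using paths AE_space
  proof eventually_elim
    fix \<omega> assume c: "continuous_on UNIV (\<lambda>t. Z t \<omega>)" and w: "\<omega> \<in> space M"
    have "compact ((\<lambda>t. Z t \<omega>) ` closure D)"
      using D(2) by (intro compact_continuous_image continuous_on_subset[OF c]) auto
    hence "bounded ((\<lambda>t. Z t \<omega>) ` closure D)" by (rule compact_imp_bounded)
    then obtain B where B: "\<And>t. t \<in> closure D \<Longrightarrow> \<bar>Z t \<omega>\<bar> \<le> B"
      by (auto simp: bounded_iff)
    obtain n where n: "B - Z c \<omega> \<le> real n" using real_arch_simple by blast
    have "Z t \<omega> - Z c \<omega> \<le> real n" if "t \<in> D" for t
      using B[of t] closure_subset[of D] that n by force
    thus "\<omega> \<in> (\<Union>n. A n)" using w by (auto simp: A_def)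
  qed
  hence "prob (\<Union>n. A n) = 1" by (subst prob_eq_1) auto
  moreover have "(\<lambda>n. prob (A n)) \<longlonglongrightarrow> prob (\<Union>n. A n)"
    by (intro finite_Lim_measure_incseq) (auto simp: incseq_def A_def intro: order_trans)
  ultimately have "\<forall>\<^sub>F n in sequentially. 1 / 2 < prob (A n)"
    by (intro order_tendstoD(1)) auto
  then obtain n where "1 / 2 < prob (A n)" by (auto simp: eventually_sequentially)
  thus ?thesis using that[of "real n"] by (simp add: A_def)
qed

text \<open>The hypothesis on \<open>\<rho>\<close> bounds the variance of the increments. Once the level is at least twice the bound \<open>b\<close>, concentration
applies with \<open>a - b \<ge> a / 2\<close>; for lower levels the estimate is trivial if \<open>C\<close> is large.\<close>

lemma small_ball_increment_tail:
  assumes \<epsilon>: "0 < \<epsilon>" and \<alpha>: "0 < \<alpha>" and D: "countable D" "bounded D"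
    and var: "\<And>t. t \<in> D \<Longrightarrow> 1 - \<rho> (norm (t - c)) \<le> \<epsilon>\<^sup>2 / (4 * pi\<^sup>2 * \<alpha>)"
  obtains C where "0 \<le> C" "\<And>z. 0 \<le> z \<Longrightarrow> prob {\<omega> \<in> space M. \<exists>t\<in>D. \<epsilon> * z \<le> Z t \<omega> - Z c \<omega>} \<le> C * exp (- \<alpha> * z\<^sup>2)"
proof -
  note [simp] = D(1)
  \<comment> \<open>chosen such that concentration over the distance \<open>\<epsilon> * z / 2\<close> gives exactly \<open>exp (- \<alpha> * z\<^sup>2)\<close>\<close>
  define v where "v = \<epsilon>\<^sup>2 / (2 * pi\<^sup>2 * \<alpha>)"
  have v: "0 < v" using \<epsilon> \<alpha> by (simp add: v_def)
  obtain b where b: "0 \<le> b" "1 / 2 \<le> prob {\<omega> \<in> space M. \<forall>t\<in>D. Z t \<omega> - Z c \<omega> \<le> b}"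
    using bounded_increments_probable[OF D] by blast
  define C where "C = max 2 (exp (\<alpha> * (2 * b / \<epsilon>)\<^sup>2))"
  show ?thesis
  proof (rule that[of C])
    show "0 \<le> C" by (simp add: C_def)
    fix z :: real assume z: "0 \<le> z"
    let ?A = "{\<omega> \<in> space M. \<exists>t\<in>D. \<epsilon> * z \<le> Z t \<omega> - Z c \<omega>}"
    let ?B = "{\<omega> \<in> space M. \<forall>t\<in>D. Z t \<omega> - Z c \<omega> \<le> b}"
    show "prob ?A \<le> C * exp (- \<alpha> * z\<^sup>2)"
    proof (cases "2 * b \<le> \<epsilon> * z")
      case True
      hence bl: "b \<le> \<epsilon> * z" using b by linarith
      have "prob ?A * (1 / 2) \<le> prob ?A * prob ?B" using b by (intro mult_left_mono) auto
      also have "\<dots> \<le> exp (- 2 * (\<epsilon> * z - b)\<^sup>2 / (pi\<^sup>2 * v))"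
      proof (rule gaussian_max_concentration[OF centered_gaussian_field_diff[OF gaussian] D(1) v _ bl])
        fix t assume "t \<in> D"
        thus "expectation (\<lambda>\<omega>. (Z t \<omega> - Z c \<omega>)\<^sup>2) \<le> v"
          using var[of t] unfolding increment_second_moment v_def by (simp add: field_simps)
      qed
      also have "\<dots> \<le> exp (- \<alpha> * z\<^sup>2)"
      proof -
        have "(\<epsilon> * z / 2)\<^sup>2 \<le> (\<epsilon> * z - b)\<^sup>2" using True b \<epsilon> z by (intro power_mono) auto
        hence "2 * (\<epsilon> * z / 2)\<^sup>2 / (pi\<^sup>2 * v) \<le> 2 * (\<epsilon> * z - b)\<^sup>2 / (pi\<^sup>2 * v)"
          using v by (intro divide_right_mono mult_left_mono) auto
        moreover have "2 * (\<epsilon> * z / 2)\<^sup>2 / (pi\<^sup>2 * v) = \<alpha> * z\<^sup>2"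
          using \<epsilon> \<alpha> by (simp add: v_def field_simps power2_eq_square)
        ultimately show ?thesis by simp
      qed
      finally have "prob ?A \<le> 2 * exp (- \<alpha> * z\<^sup>2)" by simp
      also have "\<dots> \<le> C * exp (- \<alpha> * z\<^sup>2)" by (intro mult_right_mono) (auto simp: C_def)
      finally show ?thesis .
    next
      case False
      hence "z \<le> 2 * b / \<epsilon>" using \<epsilon> by (simp add: field_simps)
      hence "z\<^sup>2 \<le> (2 * b / \<epsilon>)\<^sup>2" using z by (intro power_mono) auto
      hence "0 \<le> \<alpha> * (2 * b / \<epsilon>)\<^sup>2 + - \<alpha> * z\<^sup>2" using \<alpha> by (simp add: mult_left_mono)
      hence "1 \<le> exp (\<alpha> * (2 * b / \<epsilon>)\<^sup>2) * exp (- \<alpha> * z\<^sup>2)" unfolding exp_add[symmetric] by simp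
      also have "\<dots> \<le> C * exp (- \<alpha> * z\<^sup>2)" by (intro mult_right_mono) (auto simp: C_def)
      finally show ?thesis using prob_le_1[of ?A] by linarith
    qed
  qed
qed

text \<open>If \<open>Z t \<ge> z\<close> for a \<open>t\<close> near \<open>c\<close>, then either \<open>Z c \<ge> (1 - \<epsilon>) * z\<close>, whose probability has the exponent of a single
Gaussian variable up to \<open>\<epsilon>\<close>, or the increment from \<open>c\<close> to \<open>t\<close> is at least \<open>\<epsilon> * z\<close>, which is rarer when the ball is
small. Finitely many balls suffice.\<close>

lemma bounded_set_sup_tail:
  assumes \<alpha>: "0 < \<alpha>" "\<alpha> < 1 / 2" and D: "countable D" "bounded D"
  obtains C where "0 \<le> C" "\<And>z. 0 \<le> z \<Longrightarrow> prob {\<omega> \<in> space M. \<exists>t\<in>D. z \<le> Z t \<omega>} \<le> C * exp (- \<alpha> * z\<^sup>2)"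
proof -
  \<comment> \<open>small enough for \<open>(1 - \<epsilon>)\<^sup>2 / 2 \<ge> \<alpha>\<close>\<close>
  define \<epsilon> where "\<epsilon> = 1 / 2 - \<alpha>"
  have \<epsilon>: "0 < \<epsilon>" "\<epsilon> < 1" using \<alpha> by (auto simp: \<epsilon>_def)
  have \<epsilon>2: "2 * \<alpha> \<le> (1 - \<epsilon>)\<^sup>2"
    using zero_le_power2[of "1 / 2 - \<alpha>"] by (simp add: \<epsilon>_def power2_eq_square algebra_simps)
  have "0 < \<epsilon>\<^sup>2 / (4 * pi\<^sup>2 * \<alpha>)" using \<epsilon> \<alpha> by simp
  then obtain \<delta> where \<delta>: "0 < \<delta>" "\<And>r. 0 \<le> r \<Longrightarrow> r < \<delta> \<Longrightarrow> 1 - \<rho> r < \<epsilon>\<^sup>2 / (4 * pi\<^sup>2 * \<alpha>)"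
    by (rule rho_continuous_at_0) blast
  obtain F where F: "finite F" "closure D \<subseteq> (\<Union>c\<in>F. ball c \<delta>)"
  proof -
    have "compact (closure D)" using D by simp
    thus ?thesis using that \<delta>(1) unfolding compact_eq_totally_bounded by blast
  qed
  have ex: "\<exists>C. 0 \<le> C \<and> (\<forall>z\<ge>0. prob {\<omega> \<in> space M. \<exists>t\<in>D \<inter> ball c \<delta>. \<epsilon> * z \<le> Z t \<omega> - Z c \<omega>} \<le> C * exp (- \<alpha> * z\<^sup>2))" for c
  proof -
    have cnt: "countable (D \<inter> ball c \<delta>)" "bounded (D \<inter> ball c \<delta>)" using D by auto
    obtain C where "0 \<le> C" "\<And>z. 0 \<le> z \<Longrightarrow> prob {\<omega> \<in> space M. \<exists>t\<in>D \<inter> ball c \<delta>. \<epsilon> * z \<le> Z t \<omega> - Z c \<omega>} \<le> C * exp (- \<alpha> * z\<^sup>2)"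
    proof (rule small_ball_increment_tail[OF \<epsilon>(1) \<alpha>(1) cnt, of c])
      fix t assume "t \<in> D \<inter> ball c \<delta>"
      thus "1 - \<rho> (norm (t - c)) \<le> \<epsilon>\<^sup>2 / (4 * pi\<^sup>2 * \<alpha>)"
        using \<delta>(2)[of "norm (t - c)"] by (simp add: dist_norm norm_minus_commute)
    qed blast
    thus ?thesis by blast
  qed
  define C where "C c = (SOME C. 0 \<le> C \<and> (\<forall>z\<ge>0. prob {\<omega> \<in> space M. \<exists>t\<in>D \<inter> ball c \<delta>. \<epsilon> * z \<le> Z t \<omega> - Z c \<omega>} \<le> C * exp (- \<alpha> * z\<^sup>2)))" for c
  have "0 \<le> C c \<and> (\<forall>z\<ge>0. prob {\<omega> \<in> space M. \<exists>t\<in>D \<inter> ball c \<delta>. \<epsilon> * z \<le> Z t \<omega> - Z c \<omega>} \<le> C c * exp (- \<alpha> * z\<^sup>2))" for c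
    unfolding C_def by (rule someI_ex, rule ex)
  hence C: "\<And>c. 0 \<le> C c"
    "\<And>c z. 0 \<le> z \<Longrightarrow> prob {\<omega> \<in> space M. \<exists>t\<in>D \<inter> ball c \<delta>. \<epsilon> * z \<le> Z t \<omega> - Z c \<omega>} \<le> C c * exp (- \<alpha> * z\<^sup>2)"
    by auto
  have [measurable]: "countable (D \<inter> B)" for B using D by auto
  show ?thesis
  proof (rule that[of "\<Sum>c\<in>F. 1 + C c"])
    show "0 \<le> (\<Sum>c\<in>F. 1 + C c)" using C(1) by (intro sum_nonneg) (simp add: add_nonneg_nonneg)
    fix z :: real assume z: "0 \<le> z"
    let ?A = "\<lambda>c. {\<omega> \<in> space M. (1 - \<epsilon>) * z \<le> Z c \<omega>}"
    let ?B = "\<lambda>c. {\<omega> \<in> space M. \<exists>t\<in>D \<inter> ball c \<delta>. \<epsilon> * z \<le> Z t \<omega> - Z c \<omega>}"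
    have BM: "?B c \<in> sets M" for c using D by measurable
    have "prob {\<omega> \<in> space M. \<exists>t\<in>D. z \<le> Z t \<omega>} \<le> prob (\<Union>c\<in>F. ?A c \<union> ?B c)"
    proof (rule finite_measure_mono)
      show "{\<omega> \<in> space M. \<exists>t\<in>D. z \<le> Z t \<omega>} \<subseteq> (\<Union>c\<in>F. ?A c \<union> ?B c)"
      proof safe
        fix \<omega> t assume t: "\<omega> \<in> space M" "t \<in> D" "z \<le> Z t \<omega>"
        obtain c where c: "c \<in> F" "t \<in> ball c \<delta>" using F(2) t(2) closure_subset[of D] by blast
        have "(1 - \<epsilon>) * z \<le> Z c \<omega> \<or> \<epsilon> * z \<le> Z t \<omega> - Z c \<omega>" using t(3) by (auto simp: algebra_simps)
        thus "\<omega> \<in> (\<Union>c\<in>F. ?A c \<union> ?B c)" using t c by blast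
      qed
      show "(\<Union>c\<in>F. ?A c \<union> ?B c) \<in> sets M" using F(1) BM by (intro sets.finite_UN sets.Un) auto
    qed
    also have "\<dots> \<le> (\<Sum>c\<in>F. prob (?A c \<union> ?B c))"
      using F(1) BM by (intro finite_measure_subadditive_finite) auto
    also have "\<dots> \<le> (\<Sum>c\<in>F. (1 + C c) * exp (- \<alpha> * z\<^sup>2))"
    proof (rule sum_mono)
      fix c
      have "prob (?A c) \<le> exp (- ((1 - \<epsilon>) * z)\<^sup>2 / (2 * 1))"
        using \<epsilon> z second_moment by (intro centered_gaussian_rv_tail centered_gaussian_fieldD[OF gaussian]) auto
      also have "\<dots> \<le> exp (- \<alpha> * z\<^sup>2)"
        using mult_right_mono[OF \<epsilon>2, of "z\<^sup>2"] by (simp add: power_mult_distrib)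
      finally have "prob (?A c) \<le> exp (- \<alpha> * z\<^sup>2)" .
      moreover have "prob (?A c \<union> ?B c) \<le> prob (?A c) + prob (?B c)"
        by (rule measure_Un_le) (use BM in auto)
      ultimately show "prob (?A c \<union> ?B c) \<le> (1 + C c) * exp (- \<alpha> * z\<^sup>2)"
        using C(2)[OF z, of c] by (simp add: distrib_right)
    qed
    finally show "prob {\<omega> \<in> space M. \<exists>t\<in>D. z \<le> Z t \<omega>} \<le> (\<Sum>c\<in>F. 1 + C c) * exp (- \<alpha> * z\<^sup>2)"
      by (simp add: sum_distrib_right)
  qed
qed

lemma exceedance_prob_translate_finite:
  assumes "finite T"
  shows "prob {\<omega> \<in> space M. \<exists>t\<in>T. z \<le> Z (t + h) \<omega>} = prob {\<omega> \<in> space M. \<exists>t\<in>T. z \<le> Z t \<omega>}"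
proof -
  note [simp] = assms
  let ?P = "Pi\<^sub>M T (\<lambda>_. borel) :: (real ^ 'd \<Rightarrow> real) measure"
  let ?W = "{w \<in> space ?P. \<exists>t\<in>T. z \<le> w t}"
  have W: "?W \<in> sets ?P"
    by (intro sets.sets_Collect_finite_Ex assms borel_measurable_le measurable_const measurable_component_singleton) auto
  have eq: "distr M ?P (\<lambda>\<omega>. \<lambda>t\<in>T. Z (t + h) \<omega>) = distr M ?P (\<lambda>\<omega>. \<lambda>t\<in>T. Z t \<omega>)"
    using stationary assms by (auto simp: stationary_field_def)
  have *: "measure (distr M ?P (\<lambda>\<omega>. \<lambda>t\<in>T. Z (t + k) \<omega>)) ?W = prob {\<omega> \<in> space M. \<exists>t\<in>T. z \<le> Z (t + k) \<omega>}" for k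
    using W by (subst measure_distr) (auto intro!: arg_cong[where f = prob] measurable_restrict simp: space_PiM)
  show ?thesis using *[of h] *[of 0] eq by simp
qed

text \<open>Stationarity makes the constant in the tail bound the same for all unit cubes.\<close>

lemma exceedance_prob_translate:
  assumes D: "countable D"
  shows "prob {\<omega> \<in> space M. \<exists>t\<in>D. z \<le> Z (t + h) \<omega>} = prob {\<omega> \<in> space M. \<exists>t\<in>D. z \<le> Z t \<omega>}"
proof (cases "D = {}")
  case False
  define T where "T n = from_nat_into D ` {..n}" for n :: nat
  have UT: "(\<Union>n. T n) = D"
  proof (intro equalityI subsetI)
    fix t assume "t \<in> D"
    hence "t = from_nat_into D (to_nat_on D t)" using D by simp
    thus "t \<in> (\<Union>n. T n)" by (auto simp: T_def)
  qed (use from_nat_into[OF False] in \<open>auto simp: T_def\<close>)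
  have L: "(\<lambda>n. prob {\<omega> \<in> space M. \<exists>t\<in>T n. z \<le> Z (t + k) \<omega>}) \<longlonglongrightarrow> prob {\<omega> \<in> space M. \<exists>t\<in>D. z \<le> Z (t + k) \<omega>}" for k
  proof -
    have "(\<lambda>n. prob {\<omega> \<in> space M. \<exists>t\<in>T n. z \<le> Z (t + k) \<omega>}) \<longlonglongrightarrow> prob (\<Union>n. {\<omega> \<in> space M. \<exists>t\<in>T n. z \<le> Z (t + k) \<omega>})"
    proof (rule finite_Lim_measure_incseq)
      have "{\<omega> \<in> space M. \<exists>t\<in>T n. z \<le> Z (t + k) \<omega>} \<in> sets M" for n
      proof -
        have [simp]: "finite (T n)" by (simp add: T_def)
        show ?thesis by measurable
      qed
      thus "range (\<lambda>n. {\<omega> \<in> space M. \<exists>t\<in>T n. z \<le> Z (t + k) \<omega>}) \<subseteq> sets M" by blast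
      show "incseq (\<lambda>n. {\<omega> \<in> space M. \<exists>t\<in>T n. z \<le> Z (t + k) \<omega>})"
        by (auto simp: incseq_def T_def)
    qed
    also have "(\<Union>n. {\<omega> \<in> space M. \<exists>t\<in>T n. z \<le> Z (t + k) \<omega>}) = {\<omega> \<in> space M. \<exists>t\<in>D. z \<le> Z (t + k) \<omega>}"
      unfolding UT[symmetric] by blast
    finally show ?thesis .
  qed
  have "prob {\<omega> \<in> space M. \<exists>t\<in>T n. z \<le> Z (t + h) \<omega>} = prob {\<omega> \<in> space M. \<exists>t\<in>T n. z \<le> Z (t + 0) \<omega>}" for n
    using exceedance_prob_translate_finite[of "T n"] by (simp add: T_def)
  with L[of h] L[of 0] show ?thesis by (simp add: LIMSEQ_unique)
qed simp

text \<open>A unit cube of the cover is used only if \<open>Z\<close> exceeds the threshold somewhere in it. By continuity this is detected on a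
countable dense set, at the price of lowering the threshold by \<open>1\<close>, so the expected content of the shell is at most a
constant times \<open>exp (n * (d - r) - \<alpha> * (sqrt (2 * \<gamma> * n) - 1)\<^sup>2)\<close> with \<open>\<alpha>\<close> as close to \<open>1 / 2\<close> as desired.\<close>

lemma exceedance_shell_content_summable:
  assumes \<gamma>: "0 < \<gamma>" and r: "0 < r" "real CARD('d) - \<gamma> < r"
  shows "AE \<omega> in M. (\<Sum>n. macro_nu r (Suc n) (exceedance_set Z \<gamma> \<omega>)) < \<infinity>"
proof -
  let ?d = "real CARD('d)"
  define q where "q = max 0 ((?d - r) / \<gamma>)"
  have q: "0 \<le> q" "q < 1" "?d - r \<le> q * \<gamma>" using \<gamma> r by (auto simp: q_def max_def field_simps)
  \<comment> \<open>the midpoint of \<open>q / 2\<close> and \<open>1 / 2\<close>, so that \<open>\<alpha> < 1 / 2\<close> and still \<open>d - r < 2 * \<alpha> * \<gamma>\<close>\<close>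
  define \<alpha> where "\<alpha> = (q + 1) / 4"
  have \<alpha>: "0 < \<alpha>" "\<alpha> < 1 / 2" using q by (auto simp: \<alpha>_def)
  have \<delta>: "?d - r < 2 * \<alpha> * \<gamma>"
  proof -
    have "q * \<gamma> < (q + 1) / 2 * \<gamma>" using q \<gamma> by (intro mult_strict_right_mono) auto
    moreover have "(q + 1) / 2 * \<gamma> = 2 * \<alpha> * \<gamma>" by (simp add: \<alpha>_def)
    ultimately show ?thesis using q(3) by linarith
  qed
  obtain D0 :: "(real ^ 'd) set" where D0: "countable D0" "\<And>X. open X \<Longrightarrow> X \<noteq> {} \<Longrightarrow> \<exists>d\<in>D0. d \<in> X"
    using countable_dense_exists by metis
  define D where "D = D0 \<inter> half_open_cube 0 1"
  have D: "countable D" using D0 by (simp add: D_def)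
  note [simp] = D
  have "half_open_cube 0 1 \<subseteq> cbox 0 (1 :: real ^ 'd)" by (auto simp: half_open_cube_def mem_box_cart less_imp_le)
  hence "D \<subseteq> cbox 0 (1 :: real ^ 'd)" by (auto simp: D_def)
  hence bD: "bounded D" by (rule bounded_subset[OF bounded_cbox])
  have dense: "\<exists>s\<in>D. c \<le> f (s + x)" if f: "continuous_on UNIV f" and t: "t \<in> half_open_cube x 1" "c < f t"
    for f :: "real ^ 'd \<Rightarrow> real" and c x t
  proof -
    define U where "U = {s. c < f (s + x)}"
    have "continuous_on UNIV (\<lambda>s. f (s + x))"
      by (rule continuous_on_compose2[OF f]) (auto intro!: continuous_intros)
    hence U: "open U" unfolding U_def by (intro open_Collect_less continuous_on_const)
    have ne: "box 0 (1 :: real ^ 'd) \<noteq> {}"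
    proof -
      have "(\<chi> i. 1 / 2) \<in> box 0 (1 :: real ^ 'd)" by (simp add: mem_box_cart)
      thus ?thesis by blast
    qed
    have "t - x \<in> U \<inter> closure (box 0 1)"
      using t unfolding closure_box[OF ne] by (auto simp: U_def half_open_cube_def mem_box_cart algebra_simps intro: less_imp_le)
    hence "U \<inter> box 0 1 \<noteq> {}" using open_Int_closure_eq_empty[OF U] by blast
    then obtain s where s: "s \<in> D0" "s \<in> U \<inter> box 0 1" using D0(2)[of "U \<inter> box 0 1"] U by auto
    hence "s \<in> D" by (auto simp: D_def half_open_cube_def mem_box_cart less_imp_le)
    thus ?thesis using s by (intro bexI[of _ s]) (auto simp: U_def)
  qed
  obtain C where C: "0 \<le> C" "\<And>z. 0 \<le> z \<Longrightarrow> prob {\<omega> \<in> space M. \<exists>t\<in>D. z \<le> Z t \<omega>} \<le> C * exp (- \<alpha> * z\<^sup>2)"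
    using bounded_set_sup_tail[OF \<alpha> D bD] by blast
  define X :: "nat \<Rightarrow> (real ^ 'd) set" where "X n = (SOME X. finite X \<and> real (card X) \<le> (5 * exp (real (Suc n))) ^ CARD('d) \<and>
    (\<forall>x\<in>X. half_open_cube x 1 \<subseteq> macro_S (Suc n)) \<and> macro_S (Suc n) \<subseteq> (\<Union>x\<in>X. half_open_cube x 1))" for n
  have X: "finite (X n) \<and> real (card (X n)) \<le> (5 * exp (real (Suc n))) ^ CARD('d) \<and>
    (\<forall>x\<in>X n. half_open_cube x 1 \<subseteq> macro_S (Suc n)) \<and> macro_S (Suc n) \<subseteq> (\<Union>x\<in>X n. half_open_cube x 1)" for n
    unfolding X_def by (rule shell_unit_cover[where 'd = 'd and n = n], rule someI) blast
  have X: "finite (X n)" "real (card (X n)) \<le> (5 * exp (real (Suc n))) ^ CARD('d)"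
    "\<And>x. x \<in> X n \<Longrightarrow> half_open_cube x 1 \<subseteq> macro_S (Suc n)" "macro_S (Suc n) \<subseteq> (\<Union>x\<in>X n. half_open_cube x 1)" for n
    using X[of n] by blast+
  define l where "l n = sqrt (2 * \<gamma> * real n) - 1" for n
  define Bad where "Bad n x = {\<omega> \<in> space M. \<exists>t\<in>D. l n \<le> Z (t + x) \<omega>}" for n x
  have BadM[measurable]: "Bad n x \<in> sets M" for n x unfolding Bad_def by measurable
  define P where "P n = prob {\<omega> \<in> space M. \<exists>t\<in>D. l n \<le> Z t \<omega>}" for n
  have PB: "prob (Bad n x) = P n" for n x
    unfolding Bad_def P_def by (rule exceedance_prob_translate[OF D])
  define g where "g n \<omega> = (\<Sum>x\<in>X n. ennreal (exp (- real (Suc n) * r)) * indicator (Bad n x) \<omega>)" for n \<omega>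
  have gM[measurable]: "g n \<in> borel_measurable M" for n unfolding g_def by measurable
  have "AE \<omega> in M. \<forall>n. macro_nu r (Suc n) (exceedance_set Z \<gamma> \<omega>) \<le> g n \<omega>"
    using paths AE_space
  proof eventually_elim
    fix \<omega> assume c: "continuous_on UNIV (\<lambda>t. Z t \<omega>)" and w: "\<omega> \<in> space M"
    show "\<forall>n. macro_nu r (Suc n) (exceedance_set Z \<gamma> \<omega>) \<le> g n \<omega>"
    proof
      fix n
      let ?Y = "{x \<in> X n. \<omega> \<in> Bad n x}"
      have "macro_nu r (Suc n) (exceedance_set Z \<gamma> \<omega>) \<le> (\<Sum>x\<in>?Y. ennreal (exp (- real (Suc n) * r)))"
      proof (rule macro_nu_le_unit_cover)
        show "exceedance_set Z \<gamma> \<omega> \<inter> macro_S (Suc n) \<subseteq> (\<Union>x\<in>?Y. half_open_cube x 1)"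
        proof
          fix t assume t: "t \<in> exceedance_set Z \<gamma> \<omega> \<inter> macro_S (Suc n)"
          then obtain x where x: "x \<in> X n" "t \<in> half_open_cube x 1" using X(4)[of n] by blast
          have "real n = ln (exp (real n))" by simp
          also have "\<dots> \<le> ln (norm t)" using macro_S_norm_ge[of t n] t
            by (subst ln_le_cancel_iff) (auto intro: less_le_trans[OF exp_gt_zero])
          finally have "l n < sqrt (2 * \<gamma> * ln (norm t))" using \<gamma>
            by (simp add: l_def) (smt (verit) mult_left_mono real_sqrt_le_mono)
          also have "\<dots> \<le> Z t \<omega>" using t by (simp add: exceedance_set_def)
          finally have "\<exists>s\<in>D. l n \<le> Z (s + x) \<omega>" by (rule dense[OF c x(2)])
          hence "x \<in> ?Y" using x w by (auto simp: Bad_def)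
          thus "t \<in> (\<Union>x\<in>?Y. half_open_cube x 1)" using x by blast
        qed
      qed (use X in auto)
      also have "\<dots> = g n \<omega>"
        unfolding g_def using X(1)[of n] by (intro sum.mono_neutral_cong_left) (auto simp: indicator_def)
      finally show "macro_nu r (Suc n) (exceedance_set Z \<gamma> \<omega>) \<le> g n \<omega>" .
    qed
  qed
  moreover have "AE \<omega> in M. (\<Sum>n. g n \<omega>) \<noteq> \<infinity>"
  proof (rule nn_integral_PInf_AE)
    define b where "b n = 5 ^ CARD('d) * exp (real (Suc n) * (?d - r)) * P n" for n
    have b0: "0 \<le> b n" for n by (simp add: b_def P_def)
    have gb: "(\<integral>\<^sup>+\<omega>. g n \<omega> \<partial>M) \<le> ennreal (b n)" for n
    proof -
      have "(\<integral>\<^sup>+\<omega>. g n \<omega> \<partial>M) = (\<Sum>x\<in>X n. ennreal (exp (- real (Suc n) * r)) * emeasure M (Bad n x))"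
        unfolding g_def by (subst nn_integral_sum) (auto simp: nn_integral_cmult_indicator)
      also have "\<dots> = (\<Sum>x\<in>X n. ennreal (exp (- real (Suc n) * r) * P n))"
        by (simp add: emeasure_eq_measure PB ennreal_mult')
      also have "\<dots> = ennreal (real (card (X n)) * (exp (- real (Suc n) * r) * P n))"
        by (simp add: ennreal_mult P_def ennreal_of_nat_eq_real_of_nat)
      also have "\<dots> \<le> ennreal ((5 * exp (real (Suc n))) ^ CARD('d) * (exp (- real (Suc n) * r) * P n))"
        using X(2)[of n] by (intro ennreal_leI mult_right_mono) (auto simp: P_def)
      also have "(5 * exp (real (Suc n))) ^ CARD('d) * (exp (- real (Suc n) * r) * P n) = b n"
      proof -
        have "exp (real (Suc n)) ^ CARD('d) * exp (- real (Suc n) * r) = exp (real (Suc n) * (?d - r))"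
          by (simp add: exp_of_nat_mult[symmetric] exp_add[symmetric] algebra_simps)
        thus ?thesis unfolding b_def by (metis mult.assoc power_mult_distrib)
      qed
      finally show ?thesis .
    qed
    have "summable b"
    proof -
      define \<kappa> where "\<kappa> = (2 * \<alpha> * \<gamma> - (?d - r)) / 2"
      have \<kappa>: "0 < \<kappa>" using \<delta> by (simp add: \<kappa>_def)
      define e where "e n = real (Suc n) * (?d - r) - \<alpha> * (l n)\<^sup>2" for n
      \<comment> \<open>separates the constant from the square root, so that the limit is one of an explicit function of \<open>n\<close>\<close>
      define s where "s = sqrt (2 * \<gamma>)"
      have s: "0 < s" "s\<^sup>2 = 2 * \<gamma>" using \<gamma> by (auto simp: s_def)
      have ls: "l n = s * sqrt (real n) - 1" for n by (simp add: l_def s_def real_sqrt_mult)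
      have "(\<lambda>n. e n / real n) \<longlonglongrightarrow> (?d - r) - \<alpha> * s\<^sup>2"
        unfolding e_def ls using s(1) by real_asymp
      moreover have "(?d - r) - \<alpha> * s\<^sup>2 < - \<kappa>"
      proof -
        have as: "\<alpha> * s\<^sup>2 = 2 * \<alpha> * \<gamma>" by (simp add: s(2))
        have half: "y - w < - ((w - y) / 2)" if "y < w" for y w :: real using that by (simp add: field_simps)
        show ?thesis unfolding \<kappa>_def as by (rule half[OF \<delta>])
      qed
      ultimately have "\<forall>\<^sub>F n in sequentially. e n / real n < - \<kappa>"
        by (rule order_tendstoD(2))
      moreover have "\<forall>\<^sub>F n in sequentially. 0 \<le> l n"
        unfolding ls using s(1) by real_asymp
      ultimately have ev: "\<forall>\<^sub>F n in sequentially. norm (b n) \<le> 5 ^ CARD('d) * C * (exp (- \<kappa>)) ^ n"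
        using eventually_gt_at_top[of "0 :: nat"]
      proof eventually_elim
        fix n :: nat assume n: "e n / real n < - \<kappa>" "0 \<le> l n" "0 < n"
        have "b n \<le> 5 ^ CARD('d) * exp (real (Suc n) * (?d - r)) * (C * exp (- \<alpha> * (l n)\<^sup>2))"
          unfolding b_def P_def using C(2)[OF n(2)] by (intro mult_left_mono) auto
        also have "\<dots> = 5 ^ CARD('d) * C * exp (e n)"
        proof -
          have eq: "5 ^ CARD('d) * exp x * (C * exp y) = 5 ^ CARD('d) * C * exp (x + y)" for x y
            by (simp add: exp_add mult_ac)
          show ?thesis unfolding eq by (simp add: e_def del: of_nat_Suc)
        qed
        also have "\<dots> \<le> 5 ^ CARD('d) * C * exp (real n * (- \<kappa>))"
        proof -
          have "e n < - \<kappa> * real n" using n(1,3) by (simp add: pos_divide_less_eq)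
          hence "exp (e n) \<le> exp (real n * (- \<kappa>))" by (simp add: mult.commute)
          thus ?thesis using C(1) by (intro mult_left_mono) auto
        qed
        finally show "norm (b n) \<le> 5 ^ CARD('d) * C * (exp (- \<kappa>)) ^ n"
          using b0[of n] unfolding exp_of_nat_mult by simp
      qed
      have "summable (\<lambda>n. 5 ^ CARD('d) * C * (exp (- \<kappa>)) ^ n)"
        using \<kappa> by (intro summable_mult summable_geometric) auto
      thus ?thesis by (rule summable_comparison_test_ev[OF ev])
    qed
    have "(\<integral>\<^sup>+\<omega>. (\<Sum>n. g n \<omega>) \<partial>M) = (\<Sum>n. \<integral>\<^sup>+\<omega>. g n \<omega> \<partial>M)"
      by (rule nn_integral_suminf) simp
    also have "\<dots> \<le> (\<Sum>n. ennreal (b n))" by (intro suminf_le gb) auto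
    also have "\<dots> = ennreal (\<Sum>n. b n)" using \<open>summable b\<close> b0 by (intro suminf_ennreal2) auto
    also have "\<dots> < \<infinity>" by simp
    finally show "(\<integral>\<^sup>+\<omega>. (\<Sum>n. g n \<omega>) \<partial>M) \<noteq> \<infinity>" by simp
  qed simp
  ultimately show ?thesis
  proof eventually_elim
    fix \<omega> assume *: "\<forall>n. macro_nu r (Suc n) (exceedance_set Z \<gamma> \<omega>) \<le> g n \<omega>" "(\<Sum>n. g n \<omega>) \<noteq> \<infinity>"
    have "(\<Sum>n. macro_nu r (Suc n) (exceedance_set Z \<gamma> \<omega>)) \<le> (\<Sum>n. g n \<omega>)"
      using * by (intro suminf_le) auto
    also have "\<dots> < \<infinity>" using * by (simp add: less_top)
    finally show "(\<Sum>n. macro_nu r (Suc n) (exceedance_set Z \<gamma> \<omega>)) < \<infinity>" .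
  qed
qed

end

section \<open>Exceedances on well separated sets\<close>

context decorrelating_gaussian_field
begin

text \<open>The sum \<open>Z s + Z t\<close> is Gaussian with second moment at most \<open>2 + 2 * \<delta>\<close>, so a one-dimensional tail bound replaces the
bivariate density.\<close>

lemma pair_exceedance_prob:
  assumes st: "s \<noteq> t" and \<delta>: "\<rho> (norm (s - t)) \<le> \<delta>" "0 \<le> \<delta>" and z: "0 \<le> z"
  shows "prob {\<omega> \<in> space M. z \<le> Z s \<omega> \<and> z \<le> Z t \<omega>} \<le> exp (- z\<^sup>2 / (1 + \<delta>))"
proof -
  have comb: "gaussian_rv (\<lambda>\<omega>. Z s \<omega> + Z t \<omega>)" "expectation (\<lambda>\<omega>. Z s \<omega> + Z t \<omega>) = 0"
    using centered_gaussian_field_combination[OF gaussian, of "{s, t}" "\<lambda>_. 1"] st by simp_all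
  have var: "expectation (\<lambda>\<omega>. (Z s \<omega> + Z t \<omega>)\<^sup>2) \<le> 2 + 2 * \<delta>"
    using linear_combination_second_moment[of 1 s 1 t] \<delta> by simp
  have "prob {\<omega> \<in> space M. z \<le> Z s \<omega> \<and> z \<le> Z t \<omega>} \<le> prob {\<omega> \<in> space M. 2 * z \<le> Z s \<omega> + Z t \<omega>}"
    by (intro finite_measure_mono) auto
  also have "\<dots> \<le> exp (- (2 * z)\<^sup>2 / (2 * (2 + 2 * \<delta>)))"
    using \<delta> z by (intro centered_gaussian_rv_tail[OF comb var]) auto
  also have "- (2 * z)\<^sup>2 / (2 * (2 + 2 * \<delta>)) = - z\<^sup>2 / (1 + \<delta>)"
    using \<delta> by (simp add: power2_eq_square field_simps)
  finally show ?thesis .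
qed

text \<open>The Paley--Zygmund (second moment) inequality for the number \<open>S\<close> of exceedances, with the pair probabilities bounded
uniformly.\<close>

lemma exceedance_prob_ge_second_moment:
  assumes T: "finite T" "T \<noteq> {}" and p0: "0 < p0" and P2: "0 \<le> P2"
    and p: "\<And>t. t \<in> T \<Longrightarrow> p0 \<le> prob {\<omega> \<in> space M. z \<le> Z t \<omega>}"
    and pp: "\<And>s t. s \<in> T \<Longrightarrow> t \<in> T \<Longrightarrow> s \<noteq> t \<Longrightarrow> prob {\<omega> \<in> space M. z \<le> Z s \<omega> \<and> z \<le> Z t \<omega>} \<le> P2"
  shows "1 / (1 / (real (card T) * p0) + P2 / p0\<^sup>2) \<le> prob {\<omega> \<in> space M. \<exists>t\<in>T. z \<le> Z t \<omega>}"
proof -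
  note [simp] = T(1)
  define N where "N = real (card T)"
  have N: "0 < N" using T by (simp add: N_def card_gt_0_iff)
  define A where "A t = {\<omega> \<in> space M. z \<le> Z t \<omega>}" for t
  have AM[measurable]: "A t \<in> sets M" for t unfolding A_def by measurable
  define U where "U = {\<omega> \<in> space M. \<exists>t\<in>T. z \<le> Z t \<omega>}"
  have UM[measurable]: "U \<in> sets M" unfolding U_def by measurable
  have iI[simp, intro]: "integrable M (indicat_real B)" if "B \<in> sets M" for B
    by (rule integrable_real_indicator[OF that]) (simp add: emeasure_eq_measure)
  define S where "S \<omega> = (\<Sum>t\<in>T. indicator (A t) \<omega> :: real)" for \<omega>
  define m where "m = (\<Sum>t\<in>T. prob (A t))"
  have m_ge: "N * p0 \<le> m"
    unfolding m_def N_def using p sum_bounded_below[of T p0 "\<lambda>t. prob (A t)"] by (simp add: A_def)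
  have m: "0 < m" using m_ge N p0 by (smt (verit) mult_pos_pos)
  define Q where "Q = m + N\<^sup>2 * P2"
  have Q: "0 < Q" using m P2 by (simp add: Q_def add_pos_nonneg)
  have ES: "expectation S = m" unfolding S_def m_def by (subst Bochner_Integration.integral_sum) auto
  have iS: "integrable M S" unfolding S_def by (intro Bochner_Integration.integrable_sum) auto
  have SS: "(S \<omega>)\<^sup>2 = (\<Sum>s\<in>T. \<Sum>t\<in>T. indicator (A s \<inter> A t) \<omega>)" for \<omega>
    unfolding S_def power2_eq_square sum_product by (intro sum.cong refl) (auto simp: indicator_def)
  have iSS: "integrable M (\<lambda>\<omega>. (S \<omega>)\<^sup>2)"
    unfolding SS by (intro Bochner_Integration.integrable_sum) auto
  have "expectation (\<lambda>\<omega>. (S \<omega>)\<^sup>2) = (\<Sum>s\<in>T. \<Sum>t\<in>T. prob (A s \<inter> A t))"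
    unfolding SS by (subst Bochner_Integration.integral_sum, force intro!: Bochner_Integration.integrable_sum)
       (subst Bochner_Integration.integral_sum, auto)
  also have "\<dots> \<le> (\<Sum>s\<in>T. \<Sum>t\<in>T. (if t = s then prob (A s) else 0) + P2)"
  proof (intro sum_mono)
    fix s t assume "s \<in> T" "t \<in> T"
    have "A s \<inter> A t = {\<omega> \<in> space M. z \<le> Z s \<omega> \<and> z \<le> Z t \<omega>}" by (auto simp: A_def)
    thus "prob (A s \<inter> A t) \<le> (if t = s then prob (A s) else 0) + P2"
      using pp[OF \<open>s \<in> T\<close> \<open>t \<in> T\<close>] P2 by auto
  qed
  also have "\<dots> = Q" by (simp add: sum.distrib Q_def m_def N_def power2_eq_square)
  finally have ESS: "expectation (\<lambda>\<omega>. (S \<omega>)\<^sup>2) \<le> Q" .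
  \<comment> \<open>the weight that makes the arithmetic-geometric mean inequality below as sharp as the Cauchy--Schwarz inequality\<close>
  define a where "a = Q / m"
  have a: "0 < a" using Q m by (simp add: a_def)
  have pt: "2 * S \<omega> \<le> (S \<omega>)\<^sup>2 / a + a * indicator U \<omega>" if "\<omega> \<in> space M" for \<omega>
  proof (cases "\<omega> \<in> U")
    case True
    have "0 \<le> (S \<omega> - a)\<^sup>2 / a" using a by simp
    also have "\<dots> = (S \<omega>)\<^sup>2 / a + a - 2 * S \<omega>" using a by (simp add: power2_eq_square field_simps)
    finally show ?thesis using True by simp
  next
    case False
    hence "S \<omega> = 0" unfolding S_def using that by (intro sum.neutral) (auto simp: U_def A_def)
    thus ?thesis using False by simp
  qed
  have "2 * m = expectation (\<lambda>\<omega>. 2 * S \<omega>)" using ES by simp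
  also have "\<dots> \<le> expectation (\<lambda>\<omega>. (S \<omega>)\<^sup>2 / a + a * indicator U \<omega>)"
    using iS iSS pt by (intro integral_mono) auto
  also have "\<dots> = expectation (\<lambda>\<omega>. (S \<omega>)\<^sup>2) / a + a * prob U"
    using iSS by (subst Bochner_Integration.integral_add) auto
  also have "\<dots> \<le> Q / a + a * prob U" using ESS a by (intro add_right_mono divide_right_mono) auto
  also have "Q / a = m" using Q m by (simp add: a_def)
  finally have "m \<le> a * prob U" by simp
  hence "m / a \<le> prob U" using a by (simp add: pos_divide_le_eq mult.commute)
  moreover have "m / a = 1 / (1 / m + (N / m)\<^sup>2 * P2)"
    using m Q by (simp add: a_def Q_def field_simps power2_eq_square)
  moreover have "1 / (1 / (N * p0) + P2 / p0\<^sup>2) \<le> 1 / (1 / m + (N / m)\<^sup>2 * P2)"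
  proof (rule divide_left_mono)
    have Np: "0 < N * p0" using N p0 by simp
    have "1 / m \<le> 1 / (N * p0)" using m_ge Np m by (intro divide_left_mono) auto
    moreover have "N / m \<le> 1 / p0" using m_ge m p0 N by (simp add: field_simps)
    hence "(N / m)\<^sup>2 \<le> (1 / p0)\<^sup>2" using N m by (intro power_mono) auto
    hence "(N / m)\<^sup>2 * P2 \<le> (1 / p0)\<^sup>2 * P2" using P2 by (rule mult_right_mono)
    ultimately show "1 / m + (N / m)\<^sup>2 * P2 \<le> 1 / (N * p0) + P2 / p0\<^sup>2"
      by (simp add: power_divide)
    show "0 < (1 / (N * p0) + P2 / p0\<^sup>2) * (1 / m + (N / m)\<^sup>2 * P2)"
      using Np m P2 by (intro mult_pos_pos add_pos_nonneg) auto
  qed simp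
  ultimately show ?thesis unfolding U_def N_def by linarith
qed

text \<open>The hypothesis on the cardinality makes the expected number of exceedances at least \<open>1\<close>; the remaining loss is the ratio
of the pair probability to the square of the single probability, which is about \<open>exp (\<delta> * z\<^sup>2)\<close>.\<close>

lemma separated_exceedance_prob:
  assumes T: "finite T" and card: "exp ((z + 1)\<^sup>2 / 2 + 2) \<le> real (card T)" and z: "0 \<le> z" and \<delta>: "0 \<le> \<delta>"
    and sep: "\<And>s t. s \<in> T \<Longrightarrow> t \<in> T \<Longrightarrow> s \<noteq> t \<Longrightarrow> \<rho> (norm (s - t)) \<le> \<delta>"
  shows "exp (- (\<delta> * z\<^sup>2 + 2 * z + 4)) \<le> prob {\<omega> \<in> space M. \<exists>t\<in>T. z \<le> Z t \<omega>}"
proof -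
  define p0 where "p0 = exp (- (z + 1)\<^sup>2 / 2) / sqrt (2 * pi)"
  define P2 where "P2 = exp (- z\<^sup>2 / (1 + \<delta>))"
  define w where "w = \<delta> * z\<^sup>2 + 2 * z + 1"
  have w: "0 \<le> w" using \<delta> z by (simp add: w_def)
  have p0: "0 < p0" by (simp add: p0_def)
  have ne: "T \<noteq> {}" using card by (auto simp: not_le)
  have A: "1 / (1 / (real (card T) * p0) + P2 / p0\<^sup>2) \<le> prob {\<omega> \<in> space M. \<exists>t\<in>T. z \<le> Z t \<omega>}"
  proof (rule exceedance_prob_ge_second_moment[OF T ne p0])
    show "0 \<le> P2" by (simp add: P2_def)
    show "p0 \<le> prob {\<omega> \<in> space M. z \<le> Z t \<omega>}" for t
      unfolding p0_def using z by (intro standard_gaussian_rv_tail_lower centered_gaussian_fieldD[OF gaussian] second_moment)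
    show "prob {\<omega> \<in> space M. z \<le> Z s \<omega> \<and> z \<le> Z t \<omega>} \<le> P2" if "s \<in> T" "t \<in> T" "s \<noteq> t" for s t
      unfolding P2_def by (rule pair_exceedance_prob[OF that(3) sep[OF that] \<delta> z])
  qed
  have e2: "sqrt (2 * pi) \<le> exp 2"
  proof -
    have "sqrt (2 * pi) \<le> sqrt (3\<^sup>2)" using pi_less_4 by (intro real_sqrt_le_mono) simp
    also have "\<dots> \<le> exp 2" using exp_ge_add_one_self[of 2] by simp
    finally show ?thesis .
  qed
  have "1 = exp ((z + 1)\<^sup>2 / 2 + 2) * (exp (- (z + 1)\<^sup>2 / 2) / exp 2)"
    by (simp add: exp_add[symmetric] exp_diff[symmetric])
  also have "\<dots> \<le> real (card T) * p0"
    unfolding p0_def using card e2 by (intro mult_mono divide_left_mono) auto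
  finally have "1 / (real (card T) * p0) \<le> 1" by simp
  moreover have "P2 / p0\<^sup>2 \<le> 7 * exp w"
  proof -
    have "P2 / p0\<^sup>2 = 2 * pi * (exp (- z\<^sup>2 / (1 + \<delta>)) * exp ((z + 1)\<^sup>2))"
    proof -
      have pp: "p0\<^sup>2 = exp (- (z + 1)\<^sup>2) / (2 * pi)"
        by (simp add: p0_def power_divide) (simp add: power2_eq_square exp_add[symmetric])
      have "A / (exp (- q) / c) = c * (A * exp q)" for A q c :: real
        by (simp add: exp_minus inverse_eq_divide)
      thus ?thesis unfolding pp P2_def .
    qed
    also have "exp (- z\<^sup>2 / (1 + \<delta>)) * exp ((z + 1)\<^sup>2) = exp (- z\<^sup>2 / (1 + \<delta>) + (z + 1)\<^sup>2)" by (rule exp_add[symmetric])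
    also have "2 * pi * \<dots> \<le> 7 * exp w"
    proof (intro mult_mono)
      show "2 * pi \<le> 7" using pi_approx by simp
      have "z\<^sup>2 * (1 - \<delta>) * (1 + \<delta>) = z\<^sup>2 - (z * \<delta>)\<^sup>2" by (simp add: power2_eq_square algebra_simps)
      hence "z\<^sup>2 * (1 - \<delta>) * (1 + \<delta>) \<le> z\<^sup>2" by simp
      hence "z\<^sup>2 * (1 - \<delta>) \<le> z\<^sup>2 / (1 + \<delta>)" using \<delta> by (simp add: pos_le_divide_eq)
      thus "exp (- z\<^sup>2 / (1 + \<delta>) + (z + 1)\<^sup>2) \<le> exp w"
        by (simp add: w_def power2_eq_square algebra_simps)
    qed auto
    finally show ?thesis .
  qed
  ultimately have "1 / (real (card T) * p0) + P2 / p0\<^sup>2 \<le> 1 + 7 * exp w" by linarith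
  also have "\<dots> \<le> 8 * exp w" using w by simp
  also have "\<dots> \<le> exp 3 * exp w"
  proof -
    have "(2::real) ^ 3 \<le> exp 1 ^ 3" using exp_ge_add_one_self[of 1] by (intro power_mono) auto
    also have "exp 1 ^ 3 = exp (3::real)" using exp_of_nat_mult[of 3 "1::real"] by simp
    finally show ?thesis by (intro mult_right_mono) auto
  qed
  also have "\<dots> = exp (\<delta> * z\<^sup>2 + 2 * z + 4)" by (simp add: exp_add[symmetric] w_def algebra_simps)
  finally have "1 / exp (\<delta> * z\<^sup>2 + 2 * z + 4) \<le> 1 / (1 / (real (card T) * p0) + P2 / p0\<^sup>2)"
    using p0 ne T by (intro divide_left_mono mult_pos_pos add_pos_nonneg) (auto simp: P2_def card_gt_0_iff)
  also note A
  finally show ?thesis by (simp only: exp_minus inverse_eq_divide)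
qed

lemma rho_nonneg: "0 \<le> r \<Longrightarrow> 0 \<le> \<rho> r"
proof -
  assume r: "0 \<le> r"
  have "\<forall>\<^sub>F x in at_top. \<rho> x \<le> \<rho> r"
    using eventually_ge_at_top[of r] by eventually_elim (use r rho_mono in auto)
  thus ?thesis using tendsto_upperbound[OF rho_lim] by simp
qed

text \<open>The second moment bound is applied at the level \<open>a * sqrt n\<close>, strictly between the level \<open>sqrt (2 * \<gamma>' * n)\<close> of interest and the
typical maximum \<open>sqrt (2 * \<beta> * n)\<close>. It holds with probability \<open>exp (- \<epsilon> * n)\<close> for every \<open>\<epsilon> > 0\<close> and large \<open>n\<close>, and the
gap between the two levels is of order \<open>sqrt n\<close>, so that concentration gives an exponential bound.\<close>

lemma no_exceedance_prob:
  assumes g: "0 < \<gamma>'" "\<gamma>' < \<beta>" and \<eta>: "0 < \<eta>"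
  obtains \<kappa> where "0 < \<kappa>"
    "\<forall>\<^sub>F n in sequentially. \<forall>T. finite T \<longrightarrow> exp (\<beta> * real n) \<le> real (card T) \<longrightarrow>
      (\<forall>s\<in>T. \<forall>t\<in>T. s \<noteq> t \<longrightarrow> exp (\<eta> * real n) \<le> norm (s - t)) \<longrightarrow>
      prob {\<omega> \<in> space M. \<forall>t\<in>T. Z t \<omega> \<le> sqrt (2 * \<gamma>' * real n)} \<le> exp (- \<kappa> * real n)"
proof -
  define \<gamma>2 where "\<gamma>2 = (\<gamma>' + \<beta>) / 2"
  have g2: "\<gamma>' < \<gamma>2" "\<gamma>2 < \<beta>" using g by (auto simp: \<gamma>2_def)
  define a where "a = sqrt (2 * \<gamma>2)"
  define b where "b = sqrt (2 * \<gamma>')"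
  have ab: "0 < b" "b < a" using g g2 by (auto simp: a_def b_def)
  have a2: "a\<^sup>2 < 2 * \<beta>" using g g2 by (simp add: a_def)
  \<comment> \<open>half of the rate that concentration provides; the other half pays for the second moment bound\<close>
  define \<kappa> where "\<kappa> = (a - b)\<^sup>2 / pi\<^sup>2"
  have \<kappa>: "0 < \<kappa>" using ab by (simp add: \<kappa>_def)
  define \<delta> where "\<delta> n = \<rho> (exp (\<eta> * real n))" for n :: nat
  have \<delta>0: "\<delta> \<longlonglongrightarrow> 0"
  proof -
    have "filterlim (\<lambda>n::nat. exp (\<eta> * real n)) at_top sequentially" using \<eta> by real_asymp
    thus ?thesis unfolding \<delta>_def by (rule filterlim_compose[OF rho_lim])
  qed
  have "(\<lambda>n. \<delta> n * a\<^sup>2 + (2 * (a * sqrt (real n)) + 4) / real n) \<longlonglongrightarrow> 0 * a\<^sup>2 + 0"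
    using ab by (intro tendsto_intros \<delta>0) real_asymp
  hence ev1: "\<forall>\<^sub>F n in sequentially. \<delta> n * a\<^sup>2 + (2 * (a * sqrt (real n)) + 4) / real n < \<kappa>"
    using \<kappa> by (intro order_tendstoD(2)) auto
  have "(\<lambda>n. ((a * sqrt (real n) + 1)\<^sup>2 / 2 + 2) / real n) \<longlonglongrightarrow> a\<^sup>2 / 2"
    using ab by real_asymp
  hence ev2: "\<forall>\<^sub>F n in sequentially. ((a * sqrt (real n) + 1)\<^sup>2 / 2 + 2) / real n < \<beta>"
    using a2 by (intro order_tendstoD(2)) auto
  show ?thesis
  proof (rule that[OF \<kappa>])
    show "\<forall>\<^sub>F n in sequentially. \<forall>T. finite T \<longrightarrow> exp (\<beta> * real n) \<le> real (card T) \<longrightarrow>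
      (\<forall>s\<in>T. \<forall>t\<in>T. s \<noteq> t \<longrightarrow> exp (\<eta> * real n) \<le> norm (s - t)) \<longrightarrow>
      prob {\<omega> \<in> space M. \<forall>t\<in>T. Z t \<omega> \<le> sqrt (2 * \<gamma>' * real n)} \<le> exp (- \<kappa> * real n)"
      using ev1 ev2 eventually_gt_at_top[of "0 :: nat"]
    proof eventually_elim
      fix n :: nat
      assume n: "\<delta> n * a\<^sup>2 + (2 * (a * sqrt (real n)) + 4) / real n < \<kappa>" "((a * sqrt (real n) + 1)\<^sup>2 / 2 + 2) / real n < \<beta>" "0 < n"
      define z where "z = a * sqrt (real n)"
      have z: "0 \<le> z" "z\<^sup>2 = a\<^sup>2 * real n" using ab by (auto simp: z_def power_mult_distrib)
      have z1: "(z + 1)\<^sup>2 / 2 + 2 \<le> \<beta> * real n" using n(2,3) by (simp add: z_def pos_divide_less_eq)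
      have z2: "\<delta> n * z\<^sup>2 + 2 * z + 4 \<le> \<kappa> * real n"
      proof -
        have "(\<delta> n * a\<^sup>2 + (2 * z + 4) / real n) * real n \<le> \<kappa> * real n"
          using n(1) by (intro mult_right_mono) (auto simp: z_def)
        moreover have "(\<delta> n * a\<^sup>2 + (2 * z + 4) / real n) * real n = \<delta> n * (a\<^sup>2 * real n) + 2 * z + 4"
          using n(3) by (simp add: field_simps)
        ultimately show ?thesis unfolding z(2) by linarith
      qed
      show "\<forall>T. finite T \<longrightarrow> exp (\<beta> * real n) \<le> real (card T) \<longrightarrow>
        (\<forall>s\<in>T. \<forall>t\<in>T. s \<noteq> t \<longrightarrow> exp (\<eta> * real n) \<le> norm (s - t)) \<longrightarrow>
        prob {\<omega> \<in> space M. \<forall>t\<in>T. Z t \<omega> \<le> sqrt (2 * \<gamma>' * real n)} \<le> exp (- \<kappa> * real n)"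
      proof (intro allI impI)
        fix T :: "(real ^ 'd) set"
        assume T: "finite T" "exp (\<beta> * real n) \<le> real (card T)"
          "\<forall>s\<in>T. \<forall>t\<in>T. s \<noteq> t \<longrightarrow> exp (\<eta> * real n) \<le> norm (s - t)"
        let ?A = "{\<omega> \<in> space M. \<exists>t\<in>T. z \<le> Z t \<omega>}" and ?B = "{\<omega> \<in> space M. \<forall>t\<in>T. Z t \<omega> \<le> sqrt (2 * \<gamma>' * real n)}"
        have c1: "exp ((z + 1)\<^sup>2 / 2 + 2) \<le> real (card T)"
        proof -
          have "exp ((z + 1)\<^sup>2 / 2 + 2) \<le> exp (\<beta> * real n)" unfolding exp_le_cancel_iff by (rule z1)
          thus ?thesis using T(2) by linarith
        qed
        have "exp (- (\<kappa> * real n)) \<le> exp (- (\<delta> n * z\<^sup>2 + 2 * z + 4))" using z2 by simp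
        also have "\<dots> \<le> prob ?A"
        proof (rule separated_exceedance_prob[OF T(1) c1 z(1)])
          show "0 \<le> \<delta> n" unfolding \<delta>_def by (rule rho_nonneg) simp
          show "\<rho> (norm (s - t)) \<le> \<delta> n" if "s \<in> T" "t \<in> T" "s \<noteq> t" for s t
            unfolding \<delta>_def by (rule rho_mono) (use T(3) that in auto)
        qed
        finally have PA: "exp (- (\<kappa> * real n)) \<le> prob ?A" .
        have bz: "sqrt (2 * \<gamma>' * real n) = b * sqrt (real n)" by (simp add: b_def real_sqrt_mult)
        have "exp (- (\<kappa> * real n)) * prob ?B \<le> prob ?A * prob ?B" using PA by (intro mult_right_mono) auto
        also have "\<dots> \<le> exp (- 2 * (z - sqrt (2 * \<gamma>' * real n))\<^sup>2 / (pi\<^sup>2 * 1))"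
        proof (rule gaussian_max_concentration[OF gaussian])
          show "countable T" using T(1) by (rule countable_finite)
          show "sqrt (2 * \<gamma>' * real n) \<le> z" unfolding bz z_def using ab by (intro mult_right_mono) auto
        qed (simp_all add: second_moment)
        also have "- 2 * (z - sqrt (2 * \<gamma>' * real n))\<^sup>2 / (pi\<^sup>2 * 1) = - 2 * (\<kappa> * real n)"
          unfolding bz z_def \<kappa>_def left_diff_distrib[symmetric] power_mult_distrib by simp
        finally have "prob ?B \<le> exp (- 2 * (\<kappa> * real n)) / exp (- (\<kappa> * real n))"
          by (simp add: pos_le_divide_eq mult.commute)
        also have "\<dots> = exp (- \<kappa> * real n)" by (simp add: exp_diff[symmetric])
        finally show "prob ?B \<le> exp (- \<kappa> * real n)" .
      qed
    qed
  qed
qed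

end

section \<open>The lower bound for the content\<close>

lemma suminf_ennreal_eq_infinity:
  fixes f :: "nat \<Rightarrow> ennreal"
  assumes c: "0 < c" and ev: "\<forall>\<^sub>F n in sequentially. ennreal c \<le> f n"
  shows "(\<Sum>n. f n) = \<infinity>"
proof (rule ccontr)
  assume "(\<Sum>n. f n) \<noteq> \<infinity>"
  then obtain R where R: "(\<Sum>n. f n) = ennreal R" "0 \<le> R" by (cases "\<Sum>n. f n") auto
  obtain N where N: "\<And>n. N \<le> n \<Longrightarrow> ennreal c \<le> f n" using ev by (auto simp: eventually_sequentially)
  obtain m :: nat where m: "R < real m * c" using c reals_Archimedean3 by blast
  have "ennreal (real m * c) = (\<Sum>n\<in>{N..<N + m}. ennreal c)"
    using c by (simp add: ennreal_mult ennreal_of_nat_eq_real_of_nat)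
  also have "\<dots> \<le> (\<Sum>n\<in>{N..<N + m}. f n)" by (intro sum_mono N) auto
  also have "\<dots> \<le> (\<Sum>n. f n)" by (intro sum_le_suminf) auto
  finally have "ennreal (real m * c) \<le> ennreal R" using R by simp
  thus False using m R(2) by (simp add: ennreal_le_iff)
qed

text \<open>Markov's inequality for the number of events that occur. It holds whatever the dependence between the events, hence
also for neighbouring cells of a correlated field.\<close>

lemma (in prob_space) few_bad_events:
  fixes I :: "'i set"
  assumes I: "finite I" "I \<noteq> {}" and B: "\<And>k. k \<in> I \<Longrightarrow> B k \<in> sets M" and q: "\<And>k. k \<in> I \<Longrightarrow> prob (B k) \<le> q"
  shows "{\<omega> \<in> space M. real (card I) \<le> 2 * real (card {k \<in> I. \<omega> \<in> B k})} \<in> sets M"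
    and "prob {\<omega> \<in> space M. real (card I) \<le> 2 * real (card {k \<in> I. \<omega> \<in> B k})} \<le> 2 * q"
proof -
  note [measurable] = B
  have cnt: "real (card {k \<in> I. \<omega> \<in> B k}) = (\<Sum>k\<in>I. indicator (B k) \<omega>)" for \<omega>
  proof -
    have "(\<Sum>k\<in>I. indicator (B k) \<omega> :: real) = (\<Sum>k\<in>I. if \<omega> \<in> B k then 1 else 0)"
      by (intro sum.cong) (auto simp: indicator_def)
    also have "\<dots> = (\<Sum>k\<in>{k \<in> I. \<omega> \<in> B k}. 1)" by (rule sum.inter_filter[OF I(1), symmetric])
    finally show ?thesis by simp
  qed
  define S where "S \<omega> = (\<Sum>k\<in>I. indicator (B k) \<omega> :: real)" for \<omega>
  have SM[measurable]: "S \<in> borel_measurable M" unfolding S_def by measurable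
  have eq: "{\<omega> \<in> space M. real (card I) \<le> 2 * real (card {k \<in> I. \<omega> \<in> B k})} = {\<omega> \<in> space M. real (card I) / 2 \<le> S \<omega>}"
    unfolding cnt S_def by (auto simp: field_simps)
  show "{\<omega> \<in> space M. real (card I) \<le> 2 * real (card {k \<in> I. \<omega> \<in> B k})} \<in> sets M"
    unfolding eq by measurable
  have ii: "integrable M (indicat_real (B k))" if "k \<in> I" for k
    by (rule integrable_real_indicator[OF B[OF that]]) (simp add: emeasure_eq_measure)
  have iS: "integrable M S" unfolding S_def by (intro Bochner_Integration.integrable_sum ii)
  have cI: "0 < real (card I)" using I by (simp add: card_gt_0_iff)
  have "prob {\<omega> \<in> space M. real (card I) / 2 \<le> S \<omega>} \<le> expectation S / (real (card I) / 2)"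
    by (rule integral_Markov_inequality_measure[OF iS sets.empty_sets])
       (use cI in \<open>auto simp: S_def intro!: sum_nonneg AE_I2\<close>)
  also have "expectation S = (\<Sum>k\<in>I. prob (B k))"
    unfolding S_def using ii B by (subst Bochner_Integration.integral_sum) (auto intro!: sum.cong)
  also have "\<dots> / (real (card I) / 2) \<le> (real (card I) * q) / (real (card I) / 2)"
    using q cI sum_bounded_above[of I "\<lambda>k. prob (B k)" q] by (intro divide_right_mono) auto
  also have "\<dots> = 2 * q" using cI by simp
  finally show "prob {\<omega> \<in> space M. real (card I) \<le> 2 * real (card {k \<in> I. \<omega> \<in> B k})} \<le> 2 * q"
    unfolding eq .
qed

context decorrelating_gaussian_field
begin

text \<open>The cells lie in the corner where all coordinates are between \<open>exp n\<close> and \<open>2 * exp n\<close>, which is contained in the shell. The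
exceptional null set is the same for all exponents \<open>r\<close> because the number of occupied cells does not depend on \<open>r\<close>.\<close>

lemma exceedance_shell_content_divergent:
  assumes \<gamma>: "0 < \<gamma>" and \<theta>: "\<gamma> < \<theta> * real CARD('d)" "\<theta> < 1"
  shows "AE \<omega> in M. \<forall>r. 0 < r \<and> r \<le> real CARD('d) * (1 - \<theta>) \<longrightarrow>
    (\<Sum>n. macro_nu r (Suc n) (exceedance_set Z \<gamma> \<omega>)) = \<infinity>"
proof -
  let ?d = "real CARD('d)"
  have d: "1 \<le> ?d" by simp
  have th0: "0 < \<theta>" using \<gamma> \<theta> d by (smt (verit) mult_nonpos_nonneg)
  \<comment> \<open>leaves \<open>exp ((\<theta> - \<eta>) * d * n)\<close> points in a cell, with \<open>\<gamma> < \<gamma>' < \<beta> < (\<theta> - \<eta>) * d\<close>\<close>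
  define \<eta> where "\<eta> = (\<theta> - \<gamma> / ?d) / 2"
  have gd: "\<gamma> / ?d < \<theta>" using \<theta>(1) d by (simp add: field_simps)
  have \<eta>: "0 < \<eta>" "\<eta> < \<theta>" using gd \<gamma> d th0 by (auto simp: \<eta>_def field_simps)
  have \<eta>d: "\<gamma> < (\<theta> - \<eta>) * ?d"
  proof -
    have "\<gamma> / ?d < \<theta> - \<eta>" using gd by (simp add: \<eta>_def field_simps)
    thus ?thesis using d by (simp add: pos_divide_less_eq)
  qed
  define \<beta> where "\<beta> = (\<gamma> + (\<theta> - \<eta>) * ?d) / 2"
  define \<gamma>' where "\<gamma>' = (\<gamma> + \<beta>) / 2"
  have \<beta>: "\<gamma> < \<gamma>'" "\<gamma>' < \<beta>" "\<beta> < (\<theta> - \<eta>) * ?d" using \<eta>d by (auto simp: \<beta>_def \<gamma>'_def)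
  obtain \<kappa> where \<kappa>: "0 < \<kappa>" and tail:
    "\<forall>\<^sub>F n in sequentially. \<forall>T. finite T \<longrightarrow> exp (\<beta> * real n) \<le> real (card T) \<longrightarrow>
      (\<forall>s\<in>T. \<forall>t\<in>T. s \<noteq> t \<longrightarrow> exp (\<eta> * real n) \<le> norm (s - t)) \<longrightarrow>
      prob {\<omega> \<in> space M. \<forall>t\<in>T. Z t \<omega> \<le> sqrt (2 * \<gamma>' * real n)} \<le> exp (- \<kappa> * real n)"
  proof (rule no_exceedance_prob[of \<gamma>' \<beta> \<eta>])
    show "0 < \<gamma>'" using \<gamma> \<beta> by linarith
  qed (use \<beta> \<eta> in blast)+
  define u where "u n = exp (real n)" for n :: nat
  define L where "L n = exp (\<theta> * real n)" for n :: nat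
  define \<sigma> where "\<sigma> n = exp (\<eta> * real n)" for n :: nat
  define K where "K n = nat \<lfloor>exp ((1 - \<theta>) * real n)\<rfloor>" for n :: nat
  define J where "J n = nat \<lfloor>exp ((\<theta> - \<eta>) * real n)\<rfloor>" for n :: nat
  define P where "P n k j = (\<chi> i. u n + real (k $ i) * L n + real (j $ i) * \<sigma> n)" for n and k j :: "nat ^ 'd"
  define Js where "Js n = {j :: nat ^ 'd. \<forall>i. j $ i \<in> {..<J n}}" for n
  define Ks where "Ks n = {k :: nat ^ 'd. \<forall>i. k $ i \<in> {..<K n}}" for n
  have Js: "finite (Js n)" "card (Js n) = J n ^ CARD('d)" for n
    unfolding Js_def using card_vec[where 'd = 'd and A = "\<lambda>_. {..<J n}"] by auto
  have Ks: "finite (Ks n)" "card (Ks n) = K n ^ CARD('d)" for n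
    unfolding Ks_def using card_vec[where 'd = 'd and A = "\<lambda>_. {..<K n}"] by auto
  define T where "T n k = P n k ` Js n" for n k
  have LS: "0 < L n" "0 < \<sigma> n" "1 \<le> L n" for n using th0 by (auto simp: L_def \<sigma>_def)
  have LS0[simp]: "0 \<le> L n" "0 \<le> \<sigma> n" for n by (simp_all add: L_def \<sigma>_def)
  have JL: "real (J n) * \<sigma> n \<le> L n" for n
  proof -
    have "real (J n) * \<sigma> n \<le> exp ((\<theta> - \<eta>) * real n) * \<sigma> n" using LS by (intro mult_right_mono) (auto simp: J_def)
    also have "\<dots> = L n" by (simp add: L_def \<sigma>_def exp_add[symmetric] algebra_simps)
    finally show ?thesis .
  qed
  have KL: "real (K n) * L n \<le> u n" for n
  proof -
    have "real (K n) * L n \<le> exp ((1 - \<theta>) * real n) * L n" using LS by (intro mult_right_mono) (auto simp: K_def)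
    also have "\<dots> = u n" by (simp add: L_def u_def exp_add[symmetric] algebra_simps)
    finally show ?thesis .
  qed
  have sep: "\<sigma> n \<le> norm (P n k j - P n k j')" if jj: "j \<noteq> j'" for n k j j'
  proof -
    obtain i where i: "j $ i \<noteq> j' $ i" using jj unfolding vec_eq_iff by blast
    have "1 \<le> \<bar>real (j $ i) - real (j' $ i)\<bar>" using i by linarith
    hence "\<sigma> n \<le> \<bar>real (j $ i) - real (j' $ i)\<bar> * \<sigma> n" using LS(2)[of n] by (simp add: mult_le_cancel_right1)
    also have "\<dots> = \<bar>(P n k j - P n k j') $ i\<bar>" using LS(2)[of n] by (simp add: P_def left_diff_distrib[symmetric] abs_mult)
    also have "\<dots> \<le> norm (P n k j - P n k j')" by (rule component_le_norm_cart)
    finally show ?thesis .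
  qed
  have injP: "inj_on (P n k) (Js n)" for n k
  proof (rule inj_onI, rule ccontr)
    fix j j' assume "P n k j = P n k j'" "j \<noteq> j'"
    thus False using sep[of j j' n k] LS(2)[of n] by simp
  qed
  have cell: "u n + real (k $ i) * L n \<le> p $ i \<and> p $ i < u n + (real (k $ i) + 1) * L n" if pT: "p \<in> T n k" for n k p i
  proof -
    obtain j where j: "j \<in> Js n" "p = P n k j" using pT by (auto simp: T_def)
    have "real (j $ i) < real (J n)" using j by (auto simp: Js_def)
    hence "real (j $ i) * \<sigma> n < real (J n) * \<sigma> n" using LS by (intro mult_strict_right_mono) auto
    hence "real (j $ i) * \<sigma> n < L n" using JL[of n] by linarith
    moreover have "0 \<le> real (j $ i) * \<sigma> n" by simp
    moreover have "p $ i = u n + real (k $ i) * L n + real (j $ i) * \<sigma> n" by (simp add: j(2) P_def)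
    ultimately show ?thesis unfolding distrib_right by linarith
  qed
  have shell: "p \<in> macro_S (Suc n)" "u n \<le> norm p" "norm p \<le> exp (real n + 1 + ?d)" if "k \<in> Ks n" "p \<in> T n k" for n k p
  proof -
    have lo: "u n \<le> p $ i" and hi: "p $ i < exp (real (Suc n))" for i
    proof -
      have "0 \<le> real (k $ i) * L n" using LS[of n] by simp
      thus "u n \<le> p $ i" using cell[OF that(2), of i] by linarith
      have "k $ i < K n" using that(1) by (simp add: Ks_def)
      hence "real (k $ i) + 1 \<le> real (K n)" by linarith
      hence "(real (k $ i) + 1) * L n \<le> real (K n) * L n" using LS by (intro mult_right_mono) auto
      hence "p $ i < u n + u n" using cell[OF that(2), of i] KL[of n] by linarith
      also have "\<dots> \<le> exp 1 * u n" using exp_ge_add_one_self[of 1] by (simp add: u_def)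
      also have "\<dots> = exp (real (Suc n))" by (simp add: u_def exp_add[symmetric])
      finally show "p $ i < exp (real (Suc n))" .
    qed
    have u0: "0 < u n" by (simp add: u_def)
    have "- exp (real (Suc n)) \<le> p $ i" for i using lo[of i] u0 by (smt (verit) exp_gt_zero)
    moreover have "\<not> p $ i < exp (real n)" for i using lo[of i] by (simp add: u_def)
    ultimately show S: "p \<in> macro_S (Suc n)" using hi by (auto simp: macro_V_def simp del: of_nat_Suc)
    show "u n \<le> norm p" unfolding u_def by (rule macro_S_norm_ge[OF S])
    have "norm p \<le> (\<Sum>i\<in>UNIV. \<bar>p $ i\<bar>)" by (rule norm_le_l1_cart)
    also have "\<dots> \<le> (\<Sum>i\<in>(UNIV :: 'd set). exp (real (Suc n)))"
    proof (rule sum_mono)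
      show "\<bar>p $ i\<bar> \<le> exp (real (Suc n))" for i using lo[of i] hi[of i] u0 by linarith
    qed
    also have "\<dots> = ?d * exp (real (Suc n))" by simp
    also have "\<dots> \<le> exp ?d * exp (real (Suc n))"
    proof (rule mult_right_mono)
      show "?d \<le> exp ?d" using exp_ge_add_one_self[of ?d] by linarith
    qed simp
    also have "\<dots> = exp (real n + 1 + ?d)" by (simp add: exp_add[symmetric] add_ac)
    finally show "norm p \<le> exp (real n + 1 + ?d)" .
  qed
  define B where "B n k = {\<omega> \<in> space M. \<forall>t\<in>T n k. Z t \<omega> \<le> sqrt (2 * \<gamma>' * real n)}" for n k
  have finT[simp]: "finite (T n k)" for n k using Js(1) by (simp add: T_def)
  have BM[measurable]: "B n k \<in> sets M" for n k unfolding B_def by measurable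
  \<comment> \<open>at least half of the cells contain no exceedance\<close>
  define H where "H n = {\<omega> \<in> space M. real (card (Ks n)) \<le> 2 * real (card {k \<in> Ks n. \<omega> \<in> B n k})}" for n
  have big: "\<forall>\<^sub>F n in sequentially. exp (\<beta> * real n) \<le> (exp ((\<theta> - \<eta>) * real n) / 2) ^ CARD('d)"
  proof -
    define \<xi> where "\<xi> = (\<theta> - \<eta>) * ?d - \<beta>"
    have "0 < \<xi>" using \<beta> by (simp add: \<xi>_def)
    hence "\<forall>\<^sub>F n in sequentially. ?d * ln 2 \<le> \<xi> * real n" by real_asymp
    thus ?thesis
    proof eventually_elim
      fix n :: nat assume n: "?d * ln 2 \<le> \<xi> * real n"
      have "exp (\<beta> * real n) = exp (real CARD('d) * ((\<theta> - \<eta>) * real n)) / exp (\<xi> * real n)"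
        by (simp add: exp_diff[symmetric] \<xi>_def algebra_simps)
      also have "\<dots> \<le> exp (real CARD('d) * ((\<theta> - \<eta>) * real n)) / exp (real CARD('d) * ln 2)"
        using n by (intro divide_left_mono) auto
      also have "\<dots> = (exp ((\<theta> - \<eta>) * real n) / 2) ^ CARD('d)"
        unfolding exp_of_nat_mult power_divide by simp
      finally show "exp (\<beta> * real n) \<le> (exp ((\<theta> - \<eta>) * real n) / 2) ^ CARD('d)" .
    qed
  qed
  have big2: "\<forall>\<^sub>F n in sequentially. 2 \<le> exp ((\<theta> - \<eta>) * real n)"
  proof -
    define \<xi> where "\<xi> = \<theta> - \<eta>"
    have "0 < \<xi>" using \<eta> by (simp add: \<xi>_def)
    thus ?thesis unfolding \<xi>_def[symmetric] by real_asymp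
  qed
  have big3: "\<forall>\<^sub>F n in sequentially. 2 \<le> exp ((1 - \<theta>) * real n)"
  proof -
    define \<xi> where "\<xi> = 1 - \<theta>"
    have "0 < \<xi>" using \<theta> by (simp add: \<xi>_def)
    thus ?thesis unfolding \<xi>_def[symmetric] by real_asymp
  qed
  \<comment> \<open>the level \<open>sqrt (2 * \<gamma>' * n)\<close> dominates the threshold at every point of the shell\<close>
  have big4: "\<forall>\<^sub>F n in sequentially. 2 * \<gamma> * (real n + 1 + ?d) \<le> 2 * \<gamma>' * real n"
  proof -
    define \<xi> where "\<xi> = \<gamma>' - \<gamma>"
    have \<xi>: "0 < \<xi>" using \<beta> by (simp add: \<xi>_def)
    have "\<forall>\<^sub>F n in sequentially. \<gamma> * (1 + ?d) \<le> \<xi> * real n" using \<xi> by real_asymp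
    thus ?thesis by eventually_elim (simp add: \<xi>_def algebra_simps)
  qed
  have half: "x / 2 \<le> real (nat \<lfloor>x\<rfloor>)" if "2 \<le> x" for x :: real using that by linarith
  have evH: "\<forall>\<^sub>F n in sequentially. norm (prob (H n)) \<le> 2 * exp (- \<kappa>) ^ n"
    using tail big big2 big3
  proof eventually_elim
    fix n :: nat
    assume n: "\<forall>T. finite T \<longrightarrow> exp (\<beta> * real n) \<le> real (card T) \<longrightarrow>
      (\<forall>s\<in>T. \<forall>t\<in>T. s \<noteq> t \<longrightarrow> exp (\<eta> * real n) \<le> norm (s - t)) \<longrightarrow>
      prob {\<omega> \<in> space M. \<forall>t\<in>T. Z t \<omega> \<le> sqrt (2 * \<gamma>' * real n)} \<le> exp (- \<kappa> * real n)"
      "exp (\<beta> * real n) \<le> (exp ((\<theta> - \<eta>) * real n) / 2) ^ CARD('d)"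
      "2 \<le> exp ((\<theta> - \<eta>) * real n)" "2 \<le> exp ((1 - \<theta>) * real n)"
    have PB: "prob (B n k) \<le> exp (- \<kappa> * real n)" for k
    proof -
      have "(exp ((\<theta> - \<eta>) * real n) / 2) ^ CARD('d) \<le> real (J n) ^ CARD('d)"
        unfolding J_def using half[OF n(3)] by (intro power_mono) auto
      also have "\<dots> = real (card (T n k))" unfolding T_def card_image[OF injP] Js(2) by simp
      finally have c1: "exp (\<beta> * real n) \<le> real (card (T n k))" using n(2) by linarith
      have c2: "\<forall>s\<in>T n k. \<forall>t\<in>T n k. s \<noteq> t \<longrightarrow> exp (\<eta> * real n) \<le> norm (s - t)"
      proof (intro ballI impI)
        fix s t assume st: "s \<in> T n k" "t \<in> T n k" "s \<noteq> t"
        obtain j where j: "s = P n k j" using st(1) unfolding T_def by blast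
        obtain j' where j': "t = P n k j'" using st(2) unfolding T_def by blast
        have "j \<noteq> j'" using st(3) j j' by blast
        thus "exp (\<eta> * real n) \<le> norm (s - t)" using sep unfolding \<sigma>_def j j' by blast
      qed
      show ?thesis
        unfolding B_def
        using n(1)[THEN spec, of "T n k", THEN mp, OF finT, THEN mp, OF c1, THEN mp, OF c2] .
    qed
    have "1 \<le> K n" unfolding K_def using n(4) by linarith
    hence "0 < card (Ks n)" unfolding Ks(2) by simp
    hence "Ks n \<noteq> {}" by auto
    hence "prob (H n) \<le> 2 * exp (- \<kappa> * real n)"
      unfolding H_def by (intro few_bad_events(2) Ks BM PB)
    also have "exp (- \<kappa> * real n) = exp (- \<kappa>) ^ n" using exp_of_nat_mult[of n "- \<kappa>"] by (simp add: mult.commute)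
    finally show "norm (prob (H n)) \<le> 2 * exp (- \<kappa>) ^ n" by simp
  qed
  have HM: "H n \<in> sets M" for n
  proof (cases "Ks n = {}")
    case True thus ?thesis by (simp add: H_def)
  next
    case False thus ?thesis unfolding H_def by (intro few_bad_events(1)[of _ _ 1] Ks BM) auto
  qed
  have "summable (\<lambda>n. 2 * exp (- \<kappa>) ^ n)" using \<kappa> by (intro summable_mult summable_geometric) auto
  hence "summable (\<lambda>n. prob (H n))" by (rule summable_comparison_test_ev[OF evH])
  hence "AE \<omega> in M. \<forall>\<^sub>F n in sequentially. \<omega> \<in> space M - H n"
    using HM by (intro borel_cantelli_AE1) (auto simp: emeasure_eq_measure)
  thus ?thesis
  proof eventually_elim
    fix \<omega> assume w: "\<forall>\<^sub>F n in sequentially. \<omega> \<in> space M - H n"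
    show "\<forall>r. 0 < r \<and> r \<le> ?d * (1 - \<theta>) \<longrightarrow> (\<Sum>n. macro_nu r (Suc n) (exceedance_set Z \<gamma> \<omega>)) = \<infinity>"
    proof (intro allI impI, elim conjE)
      fix r assume r: "0 < r" "r \<le> ?d * (1 - \<theta>)"
      define c :: real where "c = (1 / (12 * exp 1)) ^ CARD('d) / 2"
      have "\<forall>\<^sub>F n in sequentially. ennreal c \<le> macro_nu r (Suc n) (exceedance_set Z \<gamma> \<omega>)"
        using w big3 big4 eventually_ge_at_top[of "1 :: nat"]
      proof eventually_elim
        fix n :: nat
        assume n: "\<omega> \<in> space M - H n" "2 \<le> exp ((1 - \<theta>) * real n)"
          "2 * \<gamma> * (real n + 1 + ?d) \<le> 2 * \<gamma>' * real n" "1 \<le> n"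
        define G where "G = {k \<in> Ks n. \<omega> \<notin> B n k}"
        have "\<exists>t\<in>T n k. sqrt (2 * \<gamma>' * real n) \<le> Z t \<omega>" if "k \<in> G" for k
        proof -
          have "\<omega> \<in> space M" "\<omega> \<notin> B n k" using that n(1) by (auto simp: G_def)
          then obtain t where "t \<in> T n k" "\<not> Z t \<omega> \<le> sqrt (2 * \<gamma>' * real n)" unfolding B_def by blast
          thus ?thesis by (intro bexI[of _ t]) auto
        qed
        hence "\<forall>k\<in>G. \<exists>t. t \<in> T n k \<and> sqrt (2 * \<gamma>' * real n) \<le> Z t \<omega>" by blast
        from bchoice[OF this] obtain p where "\<forall>k\<in>G. p k \<in> T n k \<and> sqrt (2 * \<gamma>' * real n) \<le> Z (p k) \<omega>" ..
        hence p: "\<And>k. k \<in> G \<Longrightarrow> p k \<in> T n k" "\<And>k. k \<in> G \<Longrightarrow> sqrt (2 * \<gamma>' * real n) \<le> Z (p k) \<omega>"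
          by blast+
        have GK: "\<And>k. k \<in> G \<Longrightarrow> k \<in> Ks n" by (simp add: G_def)
        have ex: "p k \<in> exceedance_set Z \<gamma> \<omega> \<inter> macro_S (Suc n)" if k: "k \<in> G" for k
        proof -
          note sh = shell[OF GK[OF k] p(1)[OF k]]
          have "exp 1 \<le> u n" using n(4) by (simp add: u_def)
          hence e1: "exp 1 \<le> norm (p k)" using sh(2) by linarith
          hence "0 < norm (p k)" using exp_gt_zero[of "1 :: real"] by linarith
          hence "ln (norm (p k)) \<le> ln (exp (real n + 1 + ?d))" using sh(3) by (intro ln_mono) auto
          hence "2 * \<gamma> * ln (norm (p k)) \<le> 2 * \<gamma> * (real n + 1 + ?d)" using \<gamma> by (intro mult_left_mono) auto
          hence "sqrt (2 * \<gamma> * ln (norm (p k))) \<le> sqrt (2 * \<gamma>' * real n)" using n(3) by (intro real_sqrt_le_mono) linarith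
          also have "\<dots> \<le> Z (p k) \<omega>" by (rule p(2)[OF k])
          finally show ?thesis using e1 sh(1) by (simp add: exceedance_set_def)
        qed
        have "{k \<in> Ks n. \<omega> \<in> B n k} \<union> G = Ks n" "{k \<in> Ks n. \<omega> \<in> B n k} \<inter> G = {}" by (auto simp: G_def)
        hence "card (Ks n) = card {k \<in> Ks n. \<omega> \<in> B n k} + card G"
          using Ks(1)[of n] by (metis card_Un_disjoint finite_Un)
        moreover have "\<not> real (card (Ks n)) \<le> 2 * real (card {k \<in> Ks n. \<omega> \<in> B n k})"
          using n(1) by (auto simp: H_def)
        ultimately have cG: "real (card (Ks n)) / 2 \<le> real (card G)" by linarith
        have LR: "exp (real (Suc n) * r) \<le> (exp (real (Suc n)) / L n) ^ CARD('d)"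
        proof -
          have "real (Suc n) * r \<le> real (Suc n) * (?d * (1 - \<theta>))" using r by (intro mult_left_mono) auto
          also have "\<dots> \<le> ?d * (real (Suc n) - \<theta> * real n)" using th0 by (simp add: algebra_simps)
          finally have "exp (real (Suc n) * r) \<le> exp (?d * (real (Suc n) - \<theta> * real n))" by simp
          also have "\<dots> = (exp (real (Suc n)) / L n) ^ CARD('d)" unfolding exp_of_nat_mult exp_diff L_def ..
          finally show ?thesis .
        qed
        have rd: "r \<le> ?d"
        proof -
          have "?d * (1 - \<theta>) \<le> ?d * 1" using th0 by (intro mult_left_mono) auto
          thus ?thesis using r(2) unfolding mult_1_right by linarith
        qed
        have "c \<le> real (card G) / (6 * exp (real (Suc n)) / L n) ^ CARD('d)"
        proof -
          define x where "x = exp ((1 - \<theta>) * real n)"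
          have x: "0 < x" "x / 2 \<le> real (K n)" using half[OF n(2)] by (auto simp: x_def K_def)
          have xe: "6 * exp (real (Suc n)) / L n = 6 * exp 1 * x"
          proof -
            have "exp (real (Suc n)) / L n = exp 1 * x"
              unfolding x_def L_def exp_diff[symmetric] exp_add[symmetric] by (simp add: algebra_simps)
            thus ?thesis by simp
          qed
          have "c = (x / 2) ^ CARD('d) / 2 / (6 * exp 1 * x) ^ CARD('d)"
          proof -
            have "(x / 2) ^ CARD('d) / (6 * exp 1 * x) ^ CARD('d) = (1 / (12 * exp 1)) ^ CARD('d)"
            proof -
              have "x / 2 / (6 * exp 1 * x) = 1 / (12 * exp 1)" using x by (simp add: field_simps)
              thus ?thesis unfolding power_divide[symmetric] by simp
            qed
            thus ?thesis by (simp add: c_def)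
          qed
          also have "\<dots> \<le> real (card G) / (6 * exp 1 * x) ^ CARD('d)"
          proof (rule divide_right_mono)
            have "(x / 2) ^ CARD('d) \<le> real (K n) ^ CARD('d)" using x by (intro power_mono) auto
            also have "\<dots> = real (card (Ks n))" unfolding Ks(2) by simp
            finally show "(x / 2) ^ CARD('d) / 2 \<le> real (card G)" using cG by linarith
          qed (use x in auto)
          finally show ?thesis unfolding xe .
        qed
        hence "ennreal c \<le> ennreal (real (card G) / (6 * exp (real (Suc n)) / L n) ^ CARD('d))" by (rule ennreal_leI)
        also have "\<dots> \<le> macro_nu r (Suc n) (exceedance_set Z \<gamma> \<omega>)"
        proof (rule macro_nu_ge_grid_count[OF LS(3) r(1) rd LR])
          show "finite G" using Ks(1) by (simp add: G_def)
          show "p k \<in> exceedance_set Z \<gamma> \<omega> \<inter> macro_S (Suc n)" if "k \<in> G" for k by (rule ex[OF that])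
          show "u n + real (k $ i) * L n \<le> p k $ i \<and> p k $ i < u n + (real (k $ i) + 1) * L n" if "k \<in> G" for k i
            by (rule cell[OF p(1)[OF that]])
        qed
        finally show "ennreal c \<le> macro_nu r (Suc n) (exceedance_set Z \<gamma> \<omega>)" .
      qed
      thus "(\<Sum>n. macro_nu r (Suc n) (exceedance_set Z \<gamma> \<omega>)) = \<infinity>"
        by (rule suminf_ennreal_eq_infinity[rotated]) (simp add: c_def)
    qed
  qed
qed

end

section \<open>The dimension\<close>

context decorrelating_gaussian_field
begin

lemma macro_Dim_H_exceedance_le:
  assumes "0 < \<gamma>"
  shows "AE \<omega> in M. macro_Dim_H (exceedance_set Z \<gamma> \<omega>) \<le> ereal (max (real CARD('d) - \<gamma>) 0)"
proof -
  define D where "D = max (real CARD('d) - \<gamma>) 0"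
  have "AE \<omega> in M. \<forall>n::nat. (\<Sum>m. macro_nu (D + 1 / real (Suc n)) (Suc m) (exceedance_set Z \<gamma> \<omega>)) < \<infinity>"
  proof (subst AE_all_countable, rule allI)
    fix n :: nat
    have "0 < D + 1 / real (Suc n)" "real CARD('d) - \<gamma> < D + 1 / real (Suc n)"
      unfolding D_def by (smt (verit) divide_pos_pos of_nat_0_less_iff zero_less_Suc)+
    thus "AE \<omega> in M. (\<Sum>m. macro_nu (D + 1 / real (Suc n)) (Suc m) (exceedance_set Z \<gamma> \<omega>)) < \<infinity>"
      by (intro exceedance_shell_content_summable assms)
  qed
  thus ?thesis
  proof eventually_elim
    fix \<omega> assume *: "\<forall>n::nat. (\<Sum>m. macro_nu (D + 1 / real (Suc n)) (Suc m) (exceedance_set Z \<gamma> \<omega>)) < \<infinity>"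
    have le: "macro_Dim_H (exceedance_set Z \<gamma> \<omega>) \<le> ereal (D + 1 / real (Suc n))" for n
    proof -
      have "0 < D + 1 / real (Suc n)" unfolding D_def by (smt (verit) divide_pos_pos of_nat_0_less_iff zero_less_Suc)
      thus ?thesis unfolding macro_Dim_H_def using * by (intro Inf_lower) blast
    qed
    have "(\<lambda>n. D + 1 / real (Suc n)) \<longlonglongrightarrow> D + 0"
      by (intro tendsto_add tendsto_const LIMSEQ_Suc[OF lim_inverse_n'])
    hence "(\<lambda>n. ereal (D + 1 / real (Suc n))) \<longlonglongrightarrow> ereal (D + 0)" by (rule tendsto_ereal)
    hence "macro_Dim_H (exceedance_set Z \<gamma> \<omega>) \<le> ereal (D + 0)"
      by (rule LIMSEQ_le_const) (use le in blast)
    thus "macro_Dim_H (exceedance_set Z \<gamma> \<omega>) \<le> ereal (max (real CARD('d) - \<gamma>) 0)" by (simp add: D_def)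
  qed
qed

text \<open>Divergence of the contents is applied to a sequence of \<open>\<theta>\<close> tending to \<open>\<gamma> / d\<close> from above, so that only countably many null sets are
discarded.\<close>

lemma macro_Dim_H_exceedance_ge:
  assumes \<gamma>: "0 < \<gamma>"
  shows "AE \<omega> in M. ereal (max (real CARD('d) - \<gamma>) 0) \<le> macro_Dim_H (exceedance_set Z \<gamma> \<omega>)"
proof (cases "real CARD('d) \<le> \<gamma>")
  case True
  have "0 \<le> macro_Dim_H E" for E :: "(real ^ 'd) set"
    unfolding macro_Dim_H_def by (rule Inf_greatest) auto
  thus ?thesis using True by (simp add: zero_ereal_def)
next
  case False
  let ?d = "real CARD('d)"
  define \<epsilon> where "\<epsilon> n = (1 - \<gamma> / ?d) / real (n + 2)" for n :: nat
  define \<theta> where "\<theta> n = \<gamma> / ?d + \<epsilon> n" for n :: nat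
  have a: "0 < 1 - \<gamma> / ?d" using False by simp
  have \<epsilon>: "0 < \<epsilon> n" "\<epsilon> n < 1 - \<gamma> / ?d" for n using a by (auto simp: \<epsilon>_def divide_less_eq)
  have \<theta>: "\<gamma> < \<theta> n * ?d" "\<theta> n < 1" for n
  proof -
    show "\<gamma> < \<theta> n * ?d" using \<epsilon>(1)[of n] by (simp add: \<theta>_def distrib_right)
    show "\<theta> n < 1" using \<epsilon>(2)[of n] by (simp add: \<theta>_def)
  qed
  have "AE \<omega> in M. \<forall>n. \<forall>r. 0 < r \<and> r \<le> ?d * (1 - \<theta> n) \<longrightarrow>
      (\<Sum>m. macro_nu r (Suc m) (exceedance_set Z \<gamma> \<omega>)) = \<infinity>"
    by (subst AE_all_countable, rule allI, rule exceedance_shell_content_divergent[OF \<gamma> \<theta>])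
  thus ?thesis
  proof eventually_elim
    fix \<omega> assume *: "\<forall>n. \<forall>r. 0 < r \<and> r \<le> ?d * (1 - \<theta> n) \<longrightarrow>
      (\<Sum>m. macro_nu r (Suc m) (exceedance_set Z \<gamma> \<omega>)) = \<infinity>"
    have le: "ereal (?d * (1 - \<theta> n)) \<le> macro_Dim_H (exceedance_set Z \<gamma> \<omega>)" for n
      unfolding macro_Dim_H_def
    proof (rule Inf_greatest)
      fix x assume "x \<in> {ereal r |r. 0 < r \<and> (\<Sum>m. macro_nu r (Suc m) (exceedance_set Z \<gamma> \<omega>)) < \<infinity>}"
      then obtain r where r: "x = ereal r" "0 < r" "(\<Sum>m. macro_nu r (Suc m) (exceedance_set Z \<gamma> \<omega>)) < \<infinity>" by blast
      hence "\<not> r \<le> ?d * (1 - \<theta> n)" using * by (metis less_irrefl)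
      thus "ereal (?d * (1 - \<theta> n)) \<le> x" using r by simp
    qed
    have "(\<lambda>n. (1 - \<gamma> / ?d) / real (n + 2)) \<longlonglongrightarrow> 0" by real_asymp
    hence "\<epsilon> \<longlonglongrightarrow> 0" unfolding \<epsilon>_def .
    hence "(\<lambda>n. ?d * (1 - \<theta> n)) \<longlonglongrightarrow> ?d * (1 - (\<gamma> / ?d + 0))" unfolding \<theta>_def by (intro tendsto_intros)
    moreover have "?d * (1 - (\<gamma> / ?d + 0)) = ?d - \<gamma>" by (simp add: right_diff_distrib)
    ultimately have "(\<lambda>n. ?d * (1 - \<theta> n)) \<longlonglongrightarrow> ?d - \<gamma>" by (simp only:)
    hence "(\<lambda>n. ereal (?d * (1 - \<theta> n))) \<longlonglongrightarrow> ereal (?d - \<gamma>)" by (rule tendsto_ereal)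
    hence "ereal (?d - \<gamma>) \<le> macro_Dim_H (exceedance_set Z \<gamma> \<omega>)"
      by (rule LIMSEQ_le_const2) (use le in blast)
    thus "ereal (max (?d - \<gamma>) 0) \<le> macro_Dim_H (exceedance_set Z \<gamma> \<omega>)" using False by simp
  qed
qed

end

theorem theorem1p4:
  fixes M :: "'w measure"
    and Z :: "real ^ 'd \<Rightarrow> 'w \<Rightarrow> real"
    and \<rho> :: "real \<Rightarrow> real"
    and \<gamma> :: real
  assumes "prob_space M"
    and "prob_space.continuous_field M Z"
    and "prob_space.stationary_field M Z"
    and "prob_space.gaussian_field M Z"
    and "\<And>t. prob_space.expectation M (Z t) = 0"
    and "\<And>t. prob_space.variance M (Z t) = 1"
    and "\<And>t s. prob_space.Corr M (Z t) (Z s) = \<rho> (norm (t - s))"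
    and "antimono_on {0..} \<rho>"
    and "(\<rho> \<longlongrightarrow> 0) at_top"
    and "0 < \<gamma>"
  shows "AE \<omega> in M. macro_Dim_H (exceedance_set Z \<gamma> \<omega>) = ereal (max (real CARD('d) - \<gamma>) 0)"
proof -
  interpret prob_space M by fact
  have cov: "expectation (\<lambda>\<omega>. Z t \<omega> * Z s \<omega>) = \<rho> (norm (t - s))" for t s
    using assms(5,6) assms(7)[of t s] by (simp add: Corr_def Cov_def)
  have "expectation (\<lambda>\<omega>. Z 0 \<omega> * Z 0 \<omega>) = 1"
    using assms(5,6)[of 0] by (simp add: power2_eq_square)
  hence rho0: "\<rho> 0 = 1" using cov[of 0 0] by simp
  interpret decorrelating_gaussian_field M Z \<rho>
  proof
    show "centered_gaussian_field Z" using assms(4,5) by (simp add: centered_gaussian_field_def)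
    show "AE \<omega> in M. continuous_on UNIV (\<lambda>t. Z t \<omega>)" using assms(2) by (simp add: continuous_field_def)
    show "\<rho> r' \<le> \<rho> r" if "0 \<le> r" "r \<le> r'" for r r'
      using assms(8) that by (auto simp: monotone_on_def)
  qed (use assms(3,9) cov rho0 in auto)
  show ?thesis
    using macro_Dim_H_exceedance_le[OF \<open>0 < \<gamma>\<close>] macro_Dim_H_exceedance_ge[OF \<open>0 < \<gamma>\<close>]
    by eventually_elim (rule antisym)
qed

end
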